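(* Let $f\in\mathscr F^n$, $g\in C^0(\overline I\times\mathbb R^n\times\mathbb R;\mathbb R)$ and $u_o\in L^\infty(\mathbb R^n;\mathbb R)$. Fix a distributional solution $u\in L^\infty(I\times\mathbb R^n;\mathbb R)$ to the Cauchy problem $\partial_tu+\operatorname{div}_xf(t,x,u)=g(t,x,u)$, $u(0,x)=u_o(x)$. If $E\in\mathbf{ACR}(\mathbb R;\mathbb R)$, then $$\overline{\mathcal M}_u(E)=\frac12\int_{\mathbb R}\mu_k\,dE'(k),$$ i.e. for every $\varphi\in\mathcal D(I\times\mathbb R^n;\mathbb R)$, $(\overline{\mathcal M}_u(E))(\varphi)=\frac12\int_{\mathbb R}\mu_k(\varphi)\,dE'(k)$ as a Kurzweil–Stieltjes integral.
   Context: Let $n\ge1$ be an integer and let $I=[0,+\infty)$ or $I=[0,T)$ for some $T>0$, with closure $\overline I$. $\nabla_x$ and $\operatorname{div}_x$ applied to functions of $(t,x,u)$ denote derivatives with respect to $x$ only, with $t$ and $u$ fixed. $\mathcal D(I\times\mathbb R^n;\mathbb R)=C_c^\infty(I\times\mathbb R^n;\mathbb R)$, where compact support means that the support is a compact subset of $I\times\mathbb R^n$ (so $\varphi(0,\cdot)$ need not vanish). $\mathscr F$ is the set of $\zeta\in C^1(\overline I\times\mathbb R^n\times\mathbb R;\mathbb R)$, with variables $(t,x,u)$, such that $\partial^2_{tu}\zeta$ and $\nabla_x\partial_u\zeta$ are continuous on $\overline I\times\mathbb R^n\times\mathbb R$; $\mathscr F^n$ is the analogous space of $\mathbb R^n$-valued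 functions. Distributional solution: for all $\varphi\in C^1_c(I\times\mathbb R^n;\mathbb R)$, $$\int_I\int_{\mathbb R^n}\big(u\,\partial_t\varphi+f(t,x,u)\cdot\nabla_x\varphi\big)dx\,dt+\int_I\int_{\mathbb R^n}g(t,x,u)\,\varphi\,dx\,dt+\int_{\mathbb R^n}u_o(x)\varphi(0,x)\,dx=0 .$$ A map $\Psi:\mathbb R\to\mathbb R$ is regulated if the one-sided limits $\Psi(x-)$, $\Psi(x+)$ exist and are finite at every $x$. $\mathbf{ACR}(\mathbb R;\mathbb R)$ is the set of (locally) absolutely continuous $E:\mathbb R\to\mathbb R$ whose derivative $E'$ admits a regulated representative satisfying $E'(u)=\frac12(E'(u-)+E'(u+))$ for every $u\in\mathbb R$; $E'$ always denotes this representative. Entropy production: for $E\in\mathbf{ACR}(\mathbb R;\mathbb R)$ let $F(t,x,u)=\int_0^uE'(w)\,\partial_uf(t,x,w)\,dw$, so that $\operatorname{div}_xF(t,x,u)=\int_0^uE'(w)\operatorname{div}_x\partial_uf(t,x,w)\,dw$, and $$(\overline{\mathcal M}_u(E))(\varphi)=\int_I\int_{\mathbb R^n}\big(E(u)\,\partial_t\varphi+F(t,x,u)\cdot\nabla_x\varphi\big)dx\,dt-\int_I\int_{\mathbb R^n}E'(u)\,(\operatorname{div}_xf)(t,x,u)\,\varphi\,dx\,dt$$ $$+\int_I\int_{\mathbb R^n}(\operatorname{div}_xF)(t,x,u)\,\varphi\,dx\,dt+\int_I\int_{\mathbb R^n}E'(u)\,g(t,x,u)\,\varphi\,dx\,dt+\int_{\mathbb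 R^n}E(u_o(x))\,\varphi(0,x)\,dx .$$ Kruzhkov entropy production: with $\operatorname{sgn}z=1,0,-1$ for $z>0$, $z=0$, $z<0$ and $\Phi(t,x,u,k)=\operatorname{sgn}(u-k)\,(f(t,x,u)-f(t,x,k))$, for $k\in\mathbb R$ $$\mu_k(\varphi)=\int_I\int_{\mathbb R^n}\big(|u-k|\,\partial_t\varphi+\Phi(t,x,u,k)\cdot\nabla_x\varphi\big)dx\,dt-\int_I\int_{\mathbb R^n}\operatorname{sgn}(u-k)\,\operatorname{div}_xf(t,x,k)\,\varphi\,dx\,dt$$ $$+\int_I\int_{\mathbb R^n}\operatorname{sgn}(u-k)\,g(t,x,u)\,\varphi\,dx\,dt+\int_{\mathbb R^n}|u_o(x)-k|\,\varphi(0,x)\,dx .$$ In all formulas $u=u(t,x)$ and $\varphi=\varphi(t,x)$. For a distributional solution $u$, $\mu_k=0$ if $k\le\operatorname{ess\,inf}u$ or $k\ge\operatorname{ess\,sup}u$; the Kurzweil–Stieltjes integral over $\mathbb R$ is the integral over any compact interval $[a,b]$, $a<b$, containing $[\operatorname{ess\,inf}u,\operatorname{ess\,sup}u]$.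
   Formalization: The asserted vanishing of μ_k at k = ess inf u or k = ess sup u can fail for non-entropy solutions; so the interval [a,b] must contain the range of u strictly inside, or μ(φ) must vanish at an endpoint that coincides with ess inf u or ess sup u. *)

theory Defs
  imports "HOL-Probability.Essential_Supremum"
begin

section \<open>Differential operators and spaces of differentiable functions\<close>

text \<open>Class $C^k$ on a set, by recursion on $k$. Derivatives are taken within the set, hence are
  one-sided at those boundary points that belong to it. The definition is used only on products
  of intervals and full spaces, where the derivative within the set is unique. In finite dimension,
  continuity of all the directional derivatives \<open>\<lambda>p. f' p v\<close> is continuity of the
  derivative itself.\<close>

primrec Ck_on :: "nat \<Rightarrow> 'a::euclidean_space set \<Rightarrow> ('a \<Rightarrow> 'b::real_normed_vector) \<Rightarrow> bool" where
  "Ck_on 0 S f \<longleftrightarrow> continuous_on S f"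
| "Ck_on (Suc k) S f \<longleftrightarrow>
     (\<exists>f'. (\<forall>p\<in>S. (f has_derivative f' p) (at p within S)) \<and> (\<forall>v. Ck_on k S (\<lambda>p. f' p v)))"

definition grad :: "(real^'n \<Rightarrow> real) \<Rightarrow> real^'n \<Rightarrow> real^'n" where
  "grad h x = (\<chi> i. frechet_derivative h (at x) (axis i 1))"

definition dvg :: "(real^'n \<Rightarrow> real^'n) \<Rightarrow> real^'n \<Rightarrow> real" where
  "dvg h x = trace (jacobian h (at x))"

definition d_u :: "(real \<Rightarrow> real^'n \<Rightarrow> real \<Rightarrow> 'b::real_normed_vector) \<Rightarrow> real \<Rightarrow> real^'n \<Rightarrow> real \<Rightarrow> 'b" where
  "d_u h t x u = vector_derivative (\<lambda>w. h t x w) (at u)"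

definition d_t :: "real set \<Rightarrow> (real \<Rightarrow> real^'n \<Rightarrow> real) \<Rightarrow> real \<Rightarrow> real^'n \<Rightarrow> real" where
  "d_t I \<phi> t x = vector_derivative (\<lambda>s. \<phi> s x) (at t within I)"

text \<open>The spaces $\mathscr F$ and $\mathscr F^n$. Throughout, functions of $(t,x,u)$ are total
  functions whose values for $t$ outside the closure of $I$ are irrelevant.\<close>

definition class_F :: "real set \<Rightarrow> (real \<Rightarrow> real^'n \<Rightarrow> real \<Rightarrow> real) set" where
  "class_F I = {\<zeta>. let J = closure I; D = J \<times> UNIV \<times> UNIV in
     Ck_on 1 D (\<lambda>(t, x, u). \<zeta> t x u) \<and>
     (\<forall>t\<in>J. \<forall>x u. (\<lambda>s. d_u \<zeta> s x u) differentiable (at t within J)) \<and>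
     continuous_on D (\<lambda>(t, x, u). vector_derivative (\<lambda>s. d_u \<zeta> s x u) (at t within J)) \<and>
     (\<forall>t\<in>J. \<forall>x u. (\<lambda>y. d_u \<zeta> t y u) differentiable (at x)) \<and>
     continuous_on D (\<lambda>(t, x, u). grad (\<lambda>y. d_u \<zeta> t y u) x)}"

definition class_Fn :: "real set \<Rightarrow> (real \<Rightarrow> real^'n \<Rightarrow> real \<Rightarrow> real^'n) set" where
  "class_Fn I = {f. \<forall>i. (\<lambda>t x u. f t x u $ i) \<in> class_F I}"

text \<open>The support is taken relative to the domain $I\times\mathbb R^n$ and has to be compact; if
  $0\in I$, the function need not vanish at $t=0$.\<close>

definition compactly_supported_on :: "'a::topological_space set \<Rightarrow> ('a \<Rightarrow> real) \<Rightarrow> bool" where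
  "compactly_supported_on S \<phi> \<longleftrightarrow> compact (S \<inter> closure {p \<in> S. \<phi> p \<noteq> 0})"

definition C1c :: "real set \<Rightarrow> (real \<Rightarrow> real^'n \<Rightarrow> real) set" where
  "C1c I = {\<phi>. Ck_on 1 (I \<times> UNIV) (\<lambda>(t, x). \<phi> t x) \<and>
                compactly_supported_on (I \<times> UNIV) (\<lambda>(t, x). \<phi> t x)}"

definition test_functions :: "real set \<Rightarrow> (real \<Rightarrow> real^'n \<Rightarrow> real) set" where
  "test_functions I = {\<phi>. (\<forall>k. Ck_on k (I \<times> UNIV) (\<lambda>(t, x). \<phi> t x)) \<and>
                           compactly_supported_on (I \<times> UNIV) (\<lambda>(t, x). \<phi> t x)}"


section \<open>Bounded measurable functions and distributional solutions\<close>

text \<open>Elements of $L^\infty$ are given by arbitrary representatives.\<close>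

definition Linfty :: "'a measure \<Rightarrow> ('a \<Rightarrow> real) set" where
  "Linfty M = {h. h \<in> borel_measurable M \<and> (\<exists>C. AE p in M. \<bar>h p\<bar> \<le> C)}"

definition strip_measure :: "real set \<Rightarrow> (real \<times> (real^'n)) measure" where
  "strip_measure I = lebesgue_on (I \<times> UNIV)"

definition ess_sup_strip :: "real set \<Rightarrow> (real \<Rightarrow> real^'n \<Rightarrow> real) \<Rightarrow> ereal" where
  "ess_sup_strip I u = esssup (strip_measure I) (\<lambda>(t, x). ereal (u t x))"

definition ess_inf_strip :: "real set \<Rightarrow> (real \<Rightarrow> real^'n \<Rightarrow> real) \<Rightarrow> ereal" where
  "ess_inf_strip I u = - esssup (strip_measure I) (\<lambda>(t, x). - ereal (u t x))"

definition int_strip :: "real set \<Rightarrow> (real \<Rightarrow> real^'n \<Rightarrow> real) \<Rightarrow> real" where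
  "int_strip I h = (LINT t:I|lebesgue. (LINT x|lebesgue. h t x))"

definition distributional_solution ::
  "real set \<Rightarrow> (real \<Rightarrow> real^'n \<Rightarrow> real \<Rightarrow> real^'n) \<Rightarrow> (real \<Rightarrow> real^'n \<Rightarrow> real \<Rightarrow> real) \<Rightarrow>
   (real^'n \<Rightarrow> real) \<Rightarrow> (real \<Rightarrow> real^'n \<Rightarrow> real) \<Rightarrow> bool" where
  "distributional_solution I f g u\<^sub>o u \<longleftrightarrow> (\<forall>\<phi>\<in>C1c I.
     int_strip I (\<lambda>t x. u t x * d_t I \<phi> t x + f t x (u t x) \<bullet> grad (\<phi> t) x)
     + int_strip I (\<lambda>t x. g t x (u t x) * \<phi> t x)
     + (LINT x|lebesgue. u\<^sub>o x * \<phi> 0 x) = 0)"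


section \<open>Entropies and entropy production\<close>

definition regulated :: "(real \<Rightarrow> real) \<Rightarrow> bool" where
  "regulated \<Psi> \<longleftrightarrow> (\<forall>x. (\<exists>l. (\<Psi> \<longlongrightarrow> l) (at_left x)) \<and> (\<exists>r. (\<Psi> \<longlongrightarrow> r) (at_right x)))"

text \<open>A finite family of non-overlapping intervals $[c,d]$ is a finite set of pairs $(c,d)$.\<close>

definition abs_continuous_on_interval :: "real \<Rightarrow> real \<Rightarrow> (real \<Rightarrow> real) \<Rightarrow> bool" where
  "abs_continuous_on_interval a b E \<longleftrightarrow> (\<forall>\<epsilon>>0. \<exists>\<delta>>0. \<forall>P.
     finite P \<and> (\<forall>(c, d)\<in>P. a \<le> c \<and> c \<le> d \<and> d \<le> b) \<and>
     pairwise (\<lambda>(c, d) (c', d'). {c<..<d} \<inter> {c'<..<d'} = {}) P \<and>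
     (\<Sum>(c, d)\<in>P. d - c) < \<delta>
     \<longrightarrow> (\<Sum>(c, d)\<in>P. \<bar>E d - E c\<bar>) < \<epsilon>)"

definition normalised_derivative :: "(real \<Rightarrow> real) \<Rightarrow> (real \<Rightarrow> real) \<Rightarrow> bool" where
  "normalised_derivative E e \<longleftrightarrow>
     (AE w in lebesgue. (E has_real_derivative e w) (at w)) \<and> regulated e \<and>
     (\<forall>w. e w = (Lim (at_left w) e + Lim (at_right w) e) / 2)"

definition ACR :: "(real \<Rightarrow> real) set" where
  "ACR = {E. (\<forall>a b. abs_continuous_on_interval a b E) \<and> (\<exists>e. normalised_derivative E e)}"

text \<open>The representative is unique: two regulated functions that agree almost everywhere have the
  same one-sided limits.\<close>

definition acr_deriv :: "(real \<Rightarrow> real) \<Rightarrow> real \<Rightarrow> real" where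
  "acr_deriv E = (THE e. normalised_derivative E e)"

definition entropy_flux ::
  "(real \<Rightarrow> real^'n \<Rightarrow> real \<Rightarrow> real^'n) \<Rightarrow> (real \<Rightarrow> real) \<Rightarrow> real \<Rightarrow> real^'n \<Rightarrow> real \<Rightarrow> real^'n" where
  "entropy_flux f E t x u = (LBINT w=ereal 0..ereal u. acr_deriv E w *\<^sub>R d_u f t x w)"

definition entropy_production ::
  "real set \<Rightarrow> (real \<Rightarrow> real^'n \<Rightarrow> real \<Rightarrow> real^'n) \<Rightarrow> (real \<Rightarrow> real^'n \<Rightarrow> real \<Rightarrow> real) \<Rightarrow>
   (real^'n \<Rightarrow> real) \<Rightarrow> (real \<Rightarrow> real^'n \<Rightarrow> real) \<Rightarrow> (real \<Rightarrow> real) \<Rightarrow> (real \<Rightarrow> real^'n \<Rightarrow> real) \<Rightarrow> real" where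
  "entropy_production I f g u\<^sub>o u E \<phi> =
     int_strip I (\<lambda>t x. E (u t x) * d_t I \<phi> t x + entropy_flux f E t x (u t x) \<bullet> grad (\<phi> t) x)
     - int_strip I (\<lambda>t x. acr_deriv E (u t x) * dvg (\<lambda>y. f t y (u t x)) x * \<phi> t x)
     + int_strip I (\<lambda>t x. dvg (\<lambda>y. entropy_flux f E t y (u t x)) x * \<phi> t x)
     + int_strip I (\<lambda>t x. acr_deriv E (u t x) * g t x (u t x) * \<phi> t x)
     + (LINT x|lebesgue. E (u\<^sub>o x) * \<phi> 0 x)"

definition kruzhkov_flux ::
  "(real \<Rightarrow> real^'n \<Rightarrow> real \<Rightarrow> real^'n) \<Rightarrow> real \<Rightarrow> real^'n \<Rightarrow> real \<Rightarrow> real \<Rightarrow> real^'n" where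
  "kruzhkov_flux f t x u k = sgn (u - k) *\<^sub>R (f t x u - f t x k)"

definition kruzhkov_production ::
  "real set \<Rightarrow> (real \<Rightarrow> real^'n \<Rightarrow> real \<Rightarrow> real^'n) \<Rightarrow> (real \<Rightarrow> real^'n \<Rightarrow> real \<Rightarrow> real) \<Rightarrow>
   (real^'n \<Rightarrow> real) \<Rightarrow> (real \<Rightarrow> real^'n \<Rightarrow> real) \<Rightarrow> real \<Rightarrow> (real \<Rightarrow> real^'n \<Rightarrow> real) \<Rightarrow> real" where
  "kruzhkov_production I f g u\<^sub>o u k \<phi> =
     int_strip I (\<lambda>t x. \<bar>u t x - k\<bar> * d_t I \<phi> t x + kruzhkov_flux f t x (u t x) k \<bullet> grad (\<phi> t) x)
     - int_strip I (\<lambda>t x. sgn (u t x - k) * dvg (\<lambda>y. f t y k) x * \<phi> t x)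
     + int_strip I (\<lambda>t x. sgn (u t x - k) * g t x (u t x) * \<phi> t x)
     + (LINT x|lebesgue. \<bar>u\<^sub>o x - k\<bar> * \<phi> 0 x)"


section \<open>The Kurzweil--Stieltjes integral\<close>

text \<open>Tagged divisions in the library are sets of pairs of a tag and a compact interval, whose
  endpoints are \<open>Inf K\<close> and \<open>Sup K\<close>. Degenerate intervals are allowed there,
  but contribute zero to the Stieltjes sum.\<close>

definition has_ks_integral ::
  "(real \<Rightarrow> real) \<Rightarrow> (real \<Rightarrow> real) \<Rightarrow> real \<Rightarrow> real \<Rightarrow> real \<Rightarrow> bool" where
  "has_ks_integral h G a b J \<longleftrightarrow> (\<forall>\<epsilon>>0. \<exists>\<gamma>. gauge \<gamma> \<and>
     (\<forall>P. P tagged_division_of {a..b} \<and> \<gamma> fine P \<longrightarrow>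
        \<bar>(\<Sum>(\<xi>, K)\<in>P. h \<xi> * (G (Sup K) - G (Inf K))) - J\<bar> < \<epsilon>))"

definition ks_integrable :: "(real \<Rightarrow> real) \<Rightarrow> (real \<Rightarrow> real) \<Rightarrow> real \<Rightarrow> real \<Rightarrow> bool" where
  "ks_integrable h G a b \<longleftrightarrow> (\<exists>J. has_ks_integral h G a b J)"

definition ks_integral :: "(real \<Rightarrow> real) \<Rightarrow> (real \<Rightarrow> real) \<Rightarrow> real \<Rightarrow> real \<Rightarrow> real" where
  "ks_integral h G a b = (THE J. has_ks_integral h G a b J)"

text \<open>The intervals $[a,b]$ over which the integral over $\mathbb R$ of \<open>h\<close> (namely
  $h(k)=\mu_k(\varphi)$) may be taken: those with $a<b$ that contain $[\operatorname{ess\,inf}u,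
  \operatorname{ess\,sup}u]$. No condition on \<open>h\<close> is imposed when the containment is in the
  interior. An endpoint may also coincide with $\operatorname{ess\,inf}u$ or
  $\operatorname{ess\,sup}u$, provided that \<open>h\<close> vanishes there. This proviso cannot be
  dropped: if $\{u=a\}$, $a=\operatorname{ess\,inf}u$, has positive measure and
  $g-\operatorname{div}_xf$ is non-zero there, as may happen for distributional solutions that are
  not entropy solutions, then $\mu_a\neq0$, and a jump of the integrator at $a$ would be counted
  only in part by the integral over $[a,b]$.\<close>

definition admissible_interval ::
  "real set \<Rightarrow> (real \<Rightarrow> real^'n \<Rightarrow> real) \<Rightarrow> (real \<Rightarrow> real) \<Rightarrow> real \<Rightarrow> real \<Rightarrow> bool" where
  "admissible_interval I u h a b \<longleftrightarrow> a < b \<and>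
     (ereal a < ess_inf_strip I u \<or> ereal a = ess_inf_strip I u \<and> h a = 0) \<and>
     (ess_sup_strip I u < ereal b \<or> ess_sup_strip I u = ereal b \<and> h b = 0)"

end

theory Submission
  imports Defs
begin

text \<open>
  Both sides of the formula are values of one linear functional. For a locally bounded Borel
  function $e$ let $N(e)$ be the entropy production of the primitive $\int_0^u e$. Adding a constant
  to an entropy does not change its production, hence
  $\overline{\mathcal M}_u(E)=N(E')$. The functional is bounded by the supremum of $|e|$ over an
  interval $[-R,R]$ that contains the values of $u$ and $u_o$. The derivative of
  $|u-k|$ is $\mathrm{sgn}(\cdot-k)$, hence $\mu_k=N(\mathrm{sgn}(\cdot-k))$, and $N(1)=0$ is the
  weak formulation of the equation.

  A regulated function that is the mean of its one-sided limits is a uniform limit on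
  compact intervals of linear combinations of $1$ and functions $\mathrm{sgn}(\cdot-c)$
  (\<open>balanced_uniform_approx\<close>). For such combinations the formula is immediate, because
  integration against $\mathrm{sgn}(\cdot-c)$ doubles the value of the integrand at $c$
  if $a<c<b$ (\<open>has_ks_integral_sgn\<close>). The passage to the limit rests on the identity
  $$\sum_{(\xi,[c,d])}\mu_\xi\,(G(d)-G(c))
    =N\Big(\sum_{(\xi,[c,d])}\mathrm{sgn}(\cdot-\xi)\,(G(d)-G(c))\Big)$$
  for Stieltjes sums: at each point $w$ the sum on the right telescopes separately on the two sides of
  $w$, so it is at most $10\sup|G|$ (\<open>sgn_ks_sum_bound\<close>). Uniform smallness of $G$ therefore
  makes all Stieltjes sums small, whatever the tagged division, which gives existence and value of the
  integral together (\<open>bounded_functional_ks_representation\<close>).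

  Jumps of $E'$ at the endpoints of $[a,b]$ or outside are harmless since $\mu_c=0$ there. For
  $c$ outside the range of $u$ this is again the weak formulation, provided that $u_o$ takes its
  values in the same range as $u$. The latter is a property of distributional solutions, obtained
  from test functions that concentrate at $t=0$ (\<open>initial_datum_le\<close>).

  The analytic groundwork consists of the fundamental theorem of calculus for absolutely continuous
  functions, which gives $E(u)=E(0)+\int_0^uE'$, differentiation under the integral sign against
  the discontinuous weight $E'$ (\<open>prim_has_derivative\<close>), and the identities
  $\int\!\!\int\partial_t\varphi+\int\varphi(0,\cdot)=0$ and
  $\int\!\!\int(v\,\partial_i\varphi+\partial_iv\,\varphi)=0$.
\<close>

section \<open>Normalised step functions\<close>

text \<open>The pointwise form of ``regulated and equal to the mean of the one-sided limits''. Naming both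
  limits avoids \<open>Lim\<close>, whose value carries information only if the limit exists.\<close>

definition balanced :: "(real \<Rightarrow> real) \<Rightarrow> bool" where
  "balanced e \<longleftrightarrow> (\<forall>x. \<exists>l r. (e \<longlongrightarrow> l) (at_left x) \<and> (e \<longlongrightarrow> r) (at_right x) \<and> e x = (l + r) / 2)"

text \<open>The linear span of the constants and of the functions $\mathrm{sgn}(\cdot-c)$, that is, the
  balanced step functions. Statements that are linear in the derivative of the entropy are proved
  for it by induction.\<close>

inductive_set nstep :: "(real \<Rightarrow> real) set" where
  const: "(\<lambda>_. r) \<in> nstep"
| jump: "(\<lambda>w. r * sgn (w - c)) \<in> nstep"
| add: "s \<in> nstep \<Longrightarrow> s' \<in> nstep \<Longrightarrow> (\<lambda>w. s w + s' w) \<in> nstep"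

lemma nstep_scale: "s \<in> nstep \<Longrightarrow> (\<lambda>w. r * s w) \<in> nstep"
proof (induction rule: nstep.induct)
  case (const r') then show ?case by (rule nstep.const)
next
  case (jump r' c) then show ?case using nstep.jump[of "r * r'" c] by (simp add: mult.assoc)
next
  case (add s s') then show ?case using nstep.add[OF add.IH] by (simp add: distrib_left)
qed

lemma tendsto_sgn_left: "((\<lambda>w::real. sgn (w - c)) \<longlongrightarrow> (if x \<le> c then -1 else 1)) (at_left x)"
proof (rule tendsto_eventually)
  show "\<forall>\<^sub>F w in at_left x. sgn (w - c) = (if x \<le> c then - 1 else 1)"
  proof (cases "x \<le> c")
    case True
    then show ?thesis by (auto simp: eventually_at_left_field intro!: exI[of _ "x-1"])
  next
    case False
    then show ?thesis by (auto simp: eventually_at_left_field intro!: exI[of _ c])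
  qed
qed

lemma tendsto_sgn_right: "((\<lambda>w::real. sgn (w - c)) \<longlongrightarrow> (if x < c then -1 else 1)) (at_right x)"
proof (rule tendsto_eventually)
  show "\<forall>\<^sub>F w in at_right x. sgn (w - c) = (if x < c then - 1 else 1)"
  proof (cases "x < c")
    case True
    then show ?thesis by (auto simp: eventually_at_right_field intro!: exI[of _ "c"])
  next
    case False
    then show ?thesis by (auto simp: eventually_at_right_field intro!: exI[of _ "x+1"])
  qed
qed

lemma nstep_balanced: "s \<in> nstep \<Longrightarrow> balanced s"
proof (induction rule: nstep.induct)
  case (const r) then show ?case unfolding balanced_def by force
next
  case (jump r c)
  have "\<exists>l ra. ((\<lambda>w. r * sgn (w - c)) \<longlongrightarrow> l) (at_left x) \<and>
      ((\<lambda>w. r * sgn (w - c)) \<longlongrightarrow> ra) (at_right x) \<and> r * sgn (x - c) = (l + ra) / 2" for x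
    using tendsto_mult_left[OF tendsto_sgn_left[of c x], of r]
      tendsto_mult_left[OF tendsto_sgn_right[of c x], of r]
    by (cases x c rule: linorder_cases) (fastforce simp: sgn_if)+
  then show ?case unfolding balanced_def by blast
next
  case (add s s')
  show ?case unfolding balanced_def
  proof
    fix x
    obtain l r where 1: "(s \<longlongrightarrow> l) (at_left x)" "(s \<longlongrightarrow> r) (at_right x)" "s x = (l + r) / 2"
      using add.IH(1) unfolding balanced_def by blast
    obtain l' r' where 2: "(s' \<longlongrightarrow> l') (at_left x)" "(s' \<longlongrightarrow> r') (at_right x)" "s' x = (l' + r') / 2"
      using add.IH(2) unfolding balanced_def by blast
    show "\<exists>l r. ((\<lambda>w. s w + s' w) \<longlongrightarrow> l) (at_left x) \<and> ((\<lambda>w. s w + s' w) \<longlongrightarrow> r) (at_right x) \<and> s x + s' x = (l + r) / 2"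
      using tendsto_add[OF 1(1) 2(1)] tendsto_add[OF 1(2) 2(2)] 1(3) 2(3)
      by (intro exI[of _ "l+l'"] exI[of _ "r+r'"]) (auto simp: field_simps)
  qed
qed

text \<open>The value of the truncation at $b$ is left open: it is forced by balancedness.\<close>

lemma nstep_truncate:
  assumes "s \<in> nstep"
  shows "\<exists>s'\<in>nstep. (\<forall>w<b. s' w = s w) \<and> (\<forall>w>b. s' w = 0)"
  using assms
proof (induction rule: nstep.induct)
  case (const r)
  show ?case
    by (intro bexI[of _ "\<lambda>w. r / 2 + (- r / 2) * sgn (w - b)"] nstep.intros) auto
next
  case (jump r c)
  show ?case
  proof (cases "c < b")
    case True
    have "(\<lambda>w. (- r / 2 + r * sgn (w - c)) + (- r / 2) * sgn (w - b)) \<in> nstep"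
      by (intro nstep.add nstep.const nstep.jump)
    then show ?thesis using True by (rule_tac bexI, auto)
  next
    case False
    have "(\<lambda>w. - r / 2 + (r / 2) * sgn (w - b)) \<in> nstep"
      by (intro nstep.add nstep.const nstep.jump)
    then show ?thesis using False by (rule_tac bexI, auto)
  qed
next
  case (add s s')
  then obtain t t' where "t \<in> nstep" "\<forall>w<b. t w = s w" "\<forall>w>b. t w = 0"
     "t' \<in> nstep" "\<forall>w<b. t' w = s' w" "\<forall>w>b. t' w = 0" by blast
  then show ?case by (intro bexI[OF _ nstep.add[of t t']]) auto
qed

lemma nstep_glue:
  assumes "s \<in> nstep" "s' \<in> nstep"
  obtains t where "t \<in> nstep" "\<And>w. w < b \<Longrightarrow> t w = s w" "\<And>w. w > b \<Longrightarrow> t w = s' w"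
proof -
  obtain p where p: "p \<in> nstep" "\<forall>w<b. p w = s w" "\<forall>w>b. p w = 0"
    using nstep_truncate[OF assms(1)] by blast
  obtain q where q: "q \<in> nstep" "\<forall>w<b. q w = s' w" "\<forall>w>b. q w = 0"
    using nstep_truncate[OF assms(2)] by blast
  have "(\<lambda>w. p w + (s' w + (-1) * q w)) \<in> nstep"
    by (intro nstep.add p assms nstep_scale q)
  then show ?thesis by (rule that) (use p q in auto)
qed

text \<open>Bolzano's principle on open intervals: near each point one jump function suffices. Two
  approximations on adjacent open intervals are glued, and at the common endpoint the glued function is
  automatically close, because there both it and $e$ are the mean of one-sided limits
  that are close to each other.\<close>

lemma balanced_uniform_approx:
  assumes "balanced e" "\<epsilon> > 0"
  obtains s where "s \<in> nstep" "\<And>w. w \<in> {a..b} \<Longrightarrow> \<bar>e w - s w\<bar> \<le> \<epsilon>"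
proof (cases "a \<le> b")
  case False
  then show ?thesis using that[OF nstep.const] by auto
next
  case True
  have lim: "\<exists>l r. (e \<longlongrightarrow> l) (at_left x) \<and> (e \<longlongrightarrow> r) (at_right x) \<and> e x = (l + r) / 2" for x
    using assms(1) by (simp add: balanced_def)
  define P where "P c d \<longleftrightarrow> (\<exists>s\<in>nstep. \<forall>w\<in>{c<..<d}. \<bar>e w - s w\<bar> \<le> \<epsilon>)" for c d
  \<comment> \<open>The larger interval turns closeness on an open interval into closeness on $[a,b]$.\<close>
  have "a - 1 \<le> b + 1" using True by simp
  then have "P (a - 1) (b + 1)"
  proof (induction rule: Bolzano)
    case (trans c x d)
    show ?case
    proof (cases "c < x \<and> x < d")
      case False
      then show ?thesis using trans by auto
    next
      case True
      obtain s where s: "s \<in> nstep" "\<forall>w\<in>{c<..<x}. \<bar>e w - s w\<bar> \<le> \<epsilon>" using trans(1) unfolding P_def by blast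
      obtain s' where s': "s' \<in> nstep" "\<forall>w\<in>{x<..<d}. \<bar>e w - s' w\<bar> \<le> \<epsilon>" using trans(2) unfolding P_def by blast
      obtain t where t: "t \<in> nstep" "\<And>w. w < x \<Longrightarrow> t w = s w" "\<And>w. w > x \<Longrightarrow> t w = s' w"
        using nstep_glue[OF s(1) s'(1)] by blast
      obtain l r where e: "(e \<longlongrightarrow> l) (at_left x)" "(e \<longlongrightarrow> r) (at_right x)" "e x = (l + r) / 2"
        using lim by blast
      obtain l' r' where t': "(t \<longlongrightarrow> l') (at_left x)" "(t \<longlongrightarrow> r') (at_right x)" "t x = (l' + r') / 2"
        using nstep_balanced[OF t(1)] unfolding balanced_def by blast
      have "\<bar>l - l'\<bar> \<le> \<epsilon>"
      proof (rule tendsto_upperbound)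
        show "((\<lambda>w. \<bar>e w - t w\<bar>) \<longlongrightarrow> \<bar>l - l'\<bar>) (at_left x)"
          by (intro tendsto_intros e t')
        show "\<forall>\<^sub>F w in at_left x. \<bar>e w - t w\<bar> \<le> \<epsilon>"
          using True s t by (auto simp: eventually_at_left_field intro!: exI[of _ c])
      qed auto
      moreover have "\<bar>r - r'\<bar> \<le> \<epsilon>"
      proof (rule tendsto_upperbound)
        show "((\<lambda>w. \<bar>e w - t w\<bar>) \<longlongrightarrow> \<bar>r - r'\<bar>) (at_right x)"
          by (intro tendsto_intros e t')
        show "\<forall>\<^sub>F w in at_right x. \<bar>e w - t w\<bar> \<le> \<epsilon>"
          using True s' t by (auto simp: eventually_at_right_field intro!: exI[of _ d])
      qed auto
      ultimately have "\<bar>e x - t x\<bar> \<le> \<epsilon>" using e t' by (simp add: abs_if field_simps split: if_splits)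
      moreover have "\<bar>e w - t w\<bar> \<le> \<epsilon>" if "w \<in> {c<..<d}" "w \<noteq> x" for w
        using that s s' t by (cases w x rule: linorder_cases) auto
      ultimately show ?thesis unfolding P_def using t(1) by blast
    qed
  next
    case (local x)
    obtain l r where e: "(e \<longlongrightarrow> l) (at_left x)" "(e \<longlongrightarrow> r) (at_right x)" "e x = (l + r) / 2"
      using lim by blast
    have "\<forall>\<^sub>F w in at_left x. dist (e w) l < \<epsilon>" "\<forall>\<^sub>F w in at_right x. dist (e w) r < \<epsilon>"
      using e assms(2) by (auto simp: tendsto_iff)
    then obtain c d where cd: "c < x" "x < d" "\<And>w. c < w \<Longrightarrow> w < x \<Longrightarrow> dist (e w) l < \<epsilon>"
        "\<And>w. x < w \<Longrightarrow> w < d \<Longrightarrow> dist (e w) r < \<epsilon>"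
      by (auto simp: eventually_at_left_field eventually_at_right_field)
    let ?s = "\<lambda>w. (l + r) / 2 + (r - l) / 2 * sgn (w - x)"
    have s: "?s \<in> nstep" by (intro nstep.intros)
    have "\<bar>e w - ?s w\<bar> \<le> \<epsilon>" if "c < w" "w < d" for w
    proof (cases w x rule: linorder_cases)
      case less
      then have "?s w = l" by (simp add: field_simps)
      then show ?thesis using cd(3)[OF that(1) less] by (simp add: dist_real_def)
    next
      case equal
      then show ?thesis unfolding equal using e(3) assms(2) by (simp del: eq_divide_eq_numeral1)
    next
      case greater
      then have "?s w = r" by (simp add: field_simps)
      then show ?thesis using cd(4)[OF greater that(2)] by (simp add: dist_real_def)
    qed
    then have loc: "P c' d'" if "c' \<le> x \<and> x \<le> d' \<and> d' - c' < min (x - c) (d - x)" for c' d'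
      unfolding P_def using that by (intro bexI[OF _ s]) auto
    show ?case using cd(1,2) loc by (intro exI[of _ "min (x - c) (d - x)"] conjI allI impI) simp_all
  qed
  then obtain s where "s \<in> nstep" "\<forall>w\<in>{a-1<..<b+1}. \<bar>e w - s w\<bar> \<le> \<epsilon>" unfolding P_def by blast
  then show ?thesis by (intro that) auto
qed

lemma nstep_bounded: "s \<in> nstep \<Longrightarrow> \<exists>B. \<forall>w. \<bar>s w\<bar> \<le> B"
proof (induction rule: nstep.induct)
  case (const r)
  then show ?case by blast
next
  case (jump r c)
  then show ?case by (intro exI[of _ "\<bar>r\<bar>"]) (auto simp: abs_mult sgn_if)
next
  case (add s s')
  then obtain B B' where "\<forall>w. \<bar>s w\<bar> \<le> B" "\<forall>w. \<bar>s' w\<bar> \<le> B'" by blast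
  then show ?case by (intro exI[of _ "B + B'"] allI order_trans[OF abs_triangle_ineq] add_mono) auto
qed

lemma nstep_borel: "s \<in> nstep \<Longrightarrow> s \<in> borel_measurable borel"
  by (induction rule: nstep.induct) auto

lemma balanced_bounded:
  assumes "balanced e"
  obtains B where "B \<ge> 0" "\<And>w. w \<in> {a..b} \<Longrightarrow> \<bar>e w\<bar> \<le> B"
proof -
  obtain s where s: "s \<in> nstep" "\<And>w. w \<in> {a..b} \<Longrightarrow> \<bar>e w - s w\<bar> \<le> 1"
    using balanced_uniform_approx[OF assms, of 1] by auto
  obtain B where B: "\<forall>w. \<bar>s w\<bar> \<le> B" using nstep_bounded[OF s(1)] by blast
  have "\<bar>e w\<bar> \<le> B + 1" if "w \<in> {a..b}" for w
    using s(2)[OF that] spec[OF B, of w] by linarith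
  moreover have "B \<ge> 0" using spec[OF B, of 0] by linarith
  ultimately show ?thesis using that[of "B+1"] by auto
qed

lemma balanced_borel:
  assumes "balanced e"
  shows "e \<in> borel_measurable borel"
proof -
  have "\<exists>s. s \<in> nstep \<and> (\<forall>w\<in>{-real n..real n}. \<bar>e w - s w\<bar> \<le> 1 / real (Suc n))" for n
    using balanced_uniform_approx[OF assms, of "1 / real (Suc n)"] by (metis of_nat_0_less_iff zero_less_Suc zero_less_divide_1_iff)
  then obtain s where s: "\<And>n. s n \<in> nstep" "\<And>n w. w \<in> {-real n..real n} \<Longrightarrow> \<bar>e w - s n w\<bar> \<le> 1 / real (Suc n)"
    by metis
  show ?thesis
  proof (rule borel_measurable_LIMSEQ_real)
    fix w :: real
    show "(\<lambda>n. s n w) \<longlonglongrightarrow> e w"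
    proof (rule LIMSEQ_I)
      fix r :: real assume "r > 0"
      obtain n1 where n1: "\<bar>w\<bar> \<le> real n1" using real_arch_simple by blast
      obtain n2 where n2: "inverse (real (Suc n2)) < r" using reals_Archimedean[OF \<open>r > 0\<close>] by auto
      have "norm (s n w - e w) < r" if "n \<ge> max n1 n2" for n
      proof -
        have "\<bar>e w - s n w\<bar> \<le> 1 / real (Suc n)" using that n1 by (intro s(2)) auto
        also have "\<dots> \<le> inverse (real (Suc n2))" using that by (simp add: field_simps)
        finally show ?thesis using n2 by (simp add: abs_minus_commute)
      qed
      then show "\<exists>no. \<forall>n\<ge>no. norm (s n w - e w) < r" by blast
    qed
  qed (use s nstep_borel in auto)
qed

section \<open>Kurzweil--Stieltjes sums\<close>

lemma ks_sum_telescope: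
  assumes "a \<le> b" "P tagged_division_of {a..b::real}"
  shows "(\<Sum>(\<xi>, K)\<in>P. G (Sup K) - G (Inf K)) = G b - (G a :: real)"
  using additive_tagged_division_1[OF assms] by blast

lemma tagged_division_interval:
  assumes "P tagged_division_of {a..b::real}" "(\<xi>, K) \<in> P"
  obtains c d where "K = {c..d}" "c \<le> \<xi>" "\<xi> \<le> d" "a \<le> c" "d \<le> b" "Inf K = c" "Sup K = d"
proof -
  obtain c d where "K = cbox c d" using tagged_division_ofD(4)[OF assms] by blast
  moreover have "\<xi> \<in> K" "K \<subseteq> {a..b}" using tagged_division_ofD(2,3)[OF assms] by auto
  ultimately show ?thesis using that[of c d] by auto
qed

text \<open>To the left of $w$ the weight is $1$ and the sum telescopes; to the right it is $-1$ and the sum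
  telescopes again. At most two pieces of positive length contain $w$, one extending to its left and one
  to its right, and each contributes an error of at most $4M$. Their number is bounded by
  another telescoping sum, that of the increments of $x\mapsto[w\le x]+[w<x]$.\<close>

lemma sgn_ks_sum_bound:
  assumes P: "P tagged_division_of {a..b::real}" and ab: "a \<le> b"
    and G: "\<And>x. x \<in> {a..b} \<Longrightarrow> \<bar>G x\<bar> \<le> M"
  shows "\<bar>\<Sum>(\<xi>, K)\<in>P. sgn (w - \<xi>) * (G (Sup K) - G (Inf K))\<bar> \<le> 10 * M"
proof -
  have M: "M \<ge> 0" using G[of a] ab by auto
  define H where "H x = sgn (w - x) * G x" for x
  have H: "\<bar>H x\<bar> \<le> M" if "x \<in> {a..b}" for x
    using G[OF that] M by (auto simp: H_def abs_mult sgn_if)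
  define J :: "real \<Rightarrow> real" where "J x = of_bool (w \<le> x) + of_bool (w < x)" for x
  let ?d = "\<lambda>(\<xi>, K). sgn (w - \<xi>) * (G (Sup K) - G (Inf K)) - (H (Sup K) - H (Inf K))"
  have d: "\<bar>?d p\<bar> \<le> (\<lambda>(\<xi>, K). 4 * M * J (Sup K) - 4 * M * J (Inf K)) p" if "p \<in> P" for p
  proof -
    obtain x K where p: "p = (x, K)" by force
    obtain c d where K: "K = {c..d}" "c \<le> x" "x \<le> d" "a \<le> c" "d \<le> b" "Inf K = c" "Sup K = d"
      by (rule tagged_division_interval[OF P \<open>p \<in> P\<close>[unfolded p]])
    have cd: "c \<in> {a..b}" "d \<in> {a..b}" using K by auto
    consider "d < w" | "w < c" | "c = d" | "c < d" "c \<le> w" "w \<le> d" using K by linarith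
    then show ?thesis
    proof cases
      case 4
      have "\<bar>sgn (w - x) * (G d - G c)\<bar> \<le> \<bar>G d - G c\<bar>" by (auto simp: abs_mult sgn_if)
      then have "\<bar>?d p\<bar> \<le> 4 * M" unfolding p prod.case K(6,7)
        using G[OF cd(1)] G[OF cd(2)] H[OF cd(1)] H[OF cd(2)] by linarith
      moreover have "1 \<le> J d - J c" using 4 by (auto simp: J_def)
      then have "4 * M * 1 \<le> 4 * M * (J d - J c)" using M by (intro mult_left_mono) auto
      ultimately show ?thesis unfolding p prod.case K(6,7) by (simp add: right_diff_distrib)
    qed (use K in \<open>auto simp: p H_def J_def\<close>)
  qed
  have "(\<Sum>(\<xi>, K)\<in>P. sgn (w - \<xi>) * (G (Sup K) - G (Inf K)))
      = (\<Sum>p\<in>P. ?d p) + (\<Sum>(\<xi>, K)\<in>P. H (Sup K) - H (Inf K))"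
    unfolding sum.distrib[symmetric] by (intro sum.cong) auto
  also have "\<dots> = (\<Sum>p\<in>P. ?d p) + (H b - H a)"
    using ks_sum_telescope[OF ab P, of H] by simp
  finally have eq: "(\<Sum>(\<xi>, K)\<in>P. sgn (w - \<xi>) * (G (Sup K) - G (Inf K))) = (\<Sum>p\<in>P. ?d p) + (H b - H a)" .
  have "\<bar>\<Sum>p\<in>P. ?d p\<bar> \<le> (\<Sum>(\<xi>, K)\<in>P. 4 * M * J (Sup K) - 4 * M * J (Inf K))"
    by (rule order_trans[OF sum_abs]) (intro sum_mono d)
  also have "\<dots> = 4 * M * (J b - J a)"
    using ks_sum_telescope[OF ab P, of "\<lambda>x. 4 * M * J x"] by (simp add: right_diff_distrib)
  also have "\<dots> \<le> 4 * M * 2" using M by (intro mult_left_mono) (auto simp: J_def)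
  finally show ?thesis using eq H[of a] H[of b] ab by auto
qed

abbreviation ks_sum :: "(real \<Rightarrow> real) \<Rightarrow> (real \<Rightarrow> real) \<Rightarrow> (real \<times> real set) set \<Rightarrow> real" where
  "ks_sum h G P \<equiv> (\<Sum>(\<xi>, K)\<in>P. h \<xi> * (G (Sup K) - G (Inf K)))"

lemma has_ks_integral_unique:
  assumes "has_ks_integral h G a b J" "has_ks_integral h G a b J'" "a \<le> b"
  shows "J = J'"
proof (rule ccontr)
  assume "J \<noteq> J'"
  then have e: "\<bar>J - J'\<bar> / 2 > 0" by simp
  obtain g1 where g1: "gauge g1" "\<And>P. P tagged_division_of {a..b} \<and> g1 fine P \<Longrightarrow>
      \<bar>ks_sum h G P - J\<bar> < \<bar>J - J'\<bar> / 2"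
    using assms(1) e unfolding has_ks_integral_def by meson
  obtain g2 where g2: "gauge g2" "\<And>P. P tagged_division_of {a..b} \<and> g2 fine P \<Longrightarrow>
      \<bar>ks_sum h G P - J'\<bar> < \<bar>J - J'\<bar> / 2"
    using assms(2) e unfolding has_ks_integral_def by meson
  obtain P where P: "P tagged_division_of {a..b}" "(\<lambda>x. g1 x \<inter> g2 x) fine P"
    using fine_division_exists_real[OF gauge_Int[OF g1(1) g2(1)]] by blast
  from P have "g1 fine P" "g2 fine P" by (auto simp: fine_Int)
  then have "\<bar>ks_sum h G P - J\<bar> < \<bar>J - J'\<bar> / 2" "\<bar>ks_sum h G P - J'\<bar> < \<bar>J - J'\<bar> / 2" using g1(2)[of P] g2(2)[of P] P(1) by auto
  then show False by argo
qed

lemma ks_integral_eq: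
  assumes "has_ks_integral h G a b J" "a \<le> b"
  shows "ks_integrable h G a b" "ks_integral h G a b = J"
proof -
  show "ks_integrable h G a b" using assms(1) by (auto simp: ks_integrable_def)
  show "ks_integral h G a b = J"
    unfolding ks_integral_def
    using assms(1) by (rule the_equality) (rule has_ks_integral_unique[OF _ assms])
qed

lemma has_ks_integral_add:
  assumes "has_ks_integral h G a b J" "has_ks_integral h G' a b J'"
  shows "has_ks_integral h (\<lambda>x. G x + G' x) a b (J + J')"
  unfolding has_ks_integral_def
proof (intro allI impI)
  fix \<epsilon> :: real assume e: "\<epsilon> > 0"
  then have e: "\<epsilon> / 2 > 0" by simp
  obtain g1 where g1: "gauge g1" "\<And>P. P tagged_division_of {a..b} \<and> g1 fine P \<Longrightarrow>
      \<bar>ks_sum h G P - J\<bar> < \<epsilon> / 2"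
    using assms(1) e unfolding has_ks_integral_def by meson
  obtain g2 where g2: "gauge g2" "\<And>P. P tagged_division_of {a..b} \<and> g2 fine P \<Longrightarrow>
      \<bar>ks_sum h G' P - J'\<bar> < \<epsilon> / 2"
    using assms(2) e unfolding has_ks_integral_def by meson
  show "\<exists>\<gamma>. gauge \<gamma> \<and> (\<forall>P. P tagged_division_of {a..b} \<and> \<gamma> fine P \<longrightarrow>
           \<bar>(\<Sum>(\<xi>, K)\<in>P. h \<xi> * (G (Sup K) + G' (Sup K) - (G (Inf K) + G' (Inf K)))) - (J + J')\<bar> < \<epsilon>)"
  proof (intro exI[of _ "\<lambda>x. g1 x \<inter> g2 x"] conjI allI impI)
    show "gauge (\<lambda>x. g1 x \<inter> g2 x)" using g1 g2 by (intro gauge_Int)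
    fix P assume P: "P tagged_division_of {a..b} \<and> (\<lambda>x. g1 x \<inter> g2 x) fine P"
    then have "g1 fine P" "g2 fine P" by (auto simp: fine_Int)
    moreover have "(\<Sum>(\<xi>, K)\<in>P. h \<xi> * (G (Sup K) + G' (Sup K) - (G (Inf K) + G' (Inf K))))
       = ks_sum h G P + ks_sum h G' P"
      unfolding sum.distrib[symmetric] by (intro sum.cong) (auto simp: algebra_simps)
    moreover from calculation have "\<bar>ks_sum h G P - J\<bar> < \<epsilon> / 2"
      "\<bar>ks_sum h G' P - J'\<bar> < \<epsilon> / 2"
      using g1(2)[of P] g2(2)[of P] P by auto
    ultimately show "\<bar>(\<Sum>(\<xi>, K)\<in>P. h \<xi> * (G (Sup K) + G' (Sup K) - (G (Inf K) + G' (Inf K)))) - (J + J')\<bar> < \<epsilon>"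
      by argo
  qed
qed

lemma has_ks_integral_const: "has_ks_integral h (\<lambda>_. r) a b 0"
  unfolding has_ks_integral_def by (auto intro!: exI[of _ "\<lambda>x. ball x 1"])

text \<open>A gauge at $x\ne c$ that is smaller than $|x-c|$ forces the piece containing $c$ to have the tag
  $c$. If $c$ is an endpoint of $[a,b]$ only half of the jump is seen.\<close>

lemma has_ks_integral_sgn:
  assumes "a \<le> b"
  shows "has_ks_integral h (\<lambda>x. r * sgn (x - c)) a b (r * h c * (sgn (b - c) - sgn (a - c)))"
  unfolding has_ks_integral_def
proof (intro allI impI)
  fix \<epsilon> :: real assume "\<epsilon> > 0"
  define \<gamma> where "\<gamma> x = (if x = c then ball c 1 else ball x \<bar>x - c\<bar>)" for x
  have "gauge \<gamma>" by (auto simp: gauge_def \<gamma>_def)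
  moreover have "(\<Sum>(\<xi>, K)\<in>P. h \<xi> * (r * sgn (Sup K - c) - r * sgn (Inf K - c))) = r * h c * (sgn (b - c) - sgn (a - c))"
    if P: "P tagged_division_of {a..b}" and fine: "\<gamma> fine P" for P
  proof -
    have "h x * (r * sgn (Sup K - c) - r * sgn (Inf K - c)) = r * h c * (sgn (Sup K - c) - sgn (Inf K - c))"
      if xK: "(x, K) \<in> P" for x K
    proof (cases "x = c")
      case True then show ?thesis by (simp add: algebra_simps)
    next
      case False
      obtain p q where K: "K = {p..q}" "p \<le> x" "x \<le> q" "Inf K = p" "Sup K = q"
        by (rule tagged_division_interval[OF P xK])
      have "K \<subseteq> ball x \<bar>x - c\<bar>" using fineD[OF fine xK] False by (simp add: \<gamma>_def)
      moreover have "p \<in> K" "q \<in> K" using K by auto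
      ultimately have "\<bar>x - p\<bar> < \<bar>x - c\<bar>" "\<bar>x - q\<bar> < \<bar>x - c\<bar>" by (auto simp: dist_real_def)
      then have "sgn (q - c) = sgn (p - c)" using K by (auto simp: sgn_if)
      then show ?thesis using K by simp
    qed
    then have "(\<Sum>(\<xi>, K)\<in>P. h \<xi> * (r * sgn (Sup K - c) - r * sgn (Inf K - c)))
        = (\<Sum>(\<xi>, K)\<in>P. r * h c * (sgn (Sup K - c) - sgn (Inf K - c)))"
      by (intro sum.cong) auto
    also have "\<dots> = r * h c * (\<Sum>(\<xi>, K)\<in>P. (sgn (Sup K - c) - sgn (Inf K - c)))"
      by (simp add: sum_distrib_left split_def)
    also have "\<dots> = r * h c * (sgn (b - c) - sgn (a - c))"
      using ks_sum_telescope[OF assms P, of "\<lambda>x. sgn (x - c)"] by simp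
    finally show ?thesis .
  qed
  ultimately show "\<exists>\<gamma>. gauge \<gamma> \<and> (\<forall>P. P tagged_division_of {a..b} \<and> \<gamma> fine P \<longrightarrow>
           \<bar>(\<Sum>(\<xi>, K)\<in>P. h \<xi> * (r * sgn (Sup K - c) - r * sgn (Inf K - c))) - r * h c * (sgn (b - c) - sgn (a - c))\<bar> < \<epsilon>)"
    using \<open>\<epsilon> > 0\<close> by (intro exI[of _ \<gamma>] conjI allI impI) simp_all
qed

section \<open>Absolutely continuous functions\<close>

text \<open>At the points of differentiability the gauge comes from the straddle estimate. The pieces
  tagged in the exceptional null set lie in an open set of measure less than $\delta$, so absolute
  continuity makes their total increment small.\<close>

lemma abs_continuous_has_integral:
  fixes E e :: "real \<Rightarrow> real"
  assumes ab: "a < b" and ac: "abs_continuous_on_interval a b E"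
    and N: "negligible N" and der: "\<And>x. x \<in> {a..b} - N \<Longrightarrow> (E has_real_derivative e x) (at x)"
  shows "(e has_integral (E b - E a)) {a..b}"
proof -
  \<comment> \<open>On the null set the values of the derivative are arbitrary and might spoil the Riemann sums.\<close>
  define e0 where "e0 x = (if x \<in> N then 0 else e x)" for x
  have "(e0 has_integral (E b - E a)) {a..b}"
    unfolding has_integral_factor_content_real
  proof (intro allI impI)
    fix \<epsilon> :: real assume eps: "\<epsilon> > 0"
    then have "\<epsilon> * (b - a) / 2 > 0" using ab by simp
    with ac obtain \<delta> where \<delta>: "\<delta> > 0" "\<And>P. finite P \<Longrightarrow> (\<forall>(c, d)\<in>P. a \<le> c \<and> c \<le> d \<and> d \<le> b) \<Longrightarrow>
       pairwise (\<lambda>(c, d) (c', d'). {c<..<d} \<inter> {c'<..<d'} = {}) P \<Longrightarrow>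
       (\<Sum>(c, d)\<in>P. d - c) < \<delta> \<Longrightarrow> (\<Sum>(c, d)\<in>P. \<bar>E d - E c\<bar>) < \<epsilon> * (b - a) / 2"
      unfolding abs_continuous_on_interval_def by meson
    obtain G where G: "open G" "N \<subseteq> G" "G \<in> lmeasurable" "measure lebesgue G < \<delta>"
    proof -
      have Nn: "N \<in> null_sets lebesgue" using N by (simp add: negligible_iff_null_sets)
      then have Nl: "N \<in> lmeasurable" "measure lebesgue N = 0"
        using N by (auto simp: negligible_imp_measurable negligible_imp_measure0)
      obtain T where T: "open T" "N \<subseteq> T" "T - N \<in> lmeasurable" "emeasure lebesgue (T - N) < ennreal \<delta>"
        using sets_lebesgue_outer_open[of N \<delta>] Nl(1) \<delta>(1) by blast
      have eq: "T = N \<union> (T - N)" using T by blast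
      have "measure lebesgue T \<le> measure lebesgue N + measure lebesgue (T - N)"
        by (subst eq) (rule measure_Un_le; use T Nl in auto)
      moreover have "measure lebesgue (T - N) < \<delta>"
        using T(3,4) \<delta>(1) by (simp add: emeasure_eq_measure2 ennreal_less_iff)
      moreover have "T \<in> lmeasurable" using T Nl by (subst eq) (rule fmeasurable.Un)
      ultimately show ?thesis using Nl by (intro that[OF T(1,2)]) auto
    qed
    have "\<exists>r>0. \<forall>y. \<bar>y - x\<bar> < r \<longrightarrow> \<bar>E y - E x - e x * (y - x)\<bar> \<le> \<epsilon> / 2 * \<bar>y - x\<bar>" if "x \<in> {a..b} - N" for x
      using der[OF that] eps unfolding has_field_derivative_def has_derivative_at_alt
      by (metis half_gt_zero real_norm_def)
    then obtain r where r: "\<And>x. x \<in> {a..b} - N \<Longrightarrow> r x > 0"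
       "\<And>x y. x \<in> {a..b} - N \<Longrightarrow> \<bar>y - x\<bar> < r x \<Longrightarrow> \<bar>E y - E x - e x * (y - x)\<bar> \<le> \<epsilon> / 2 * \<bar>y - x\<bar>"
      by metis
    define \<gamma> where "\<gamma> x = (if x \<in> N then G else if x \<in> {a..b} then ball x (r x) else ball x 1)" for x
    have g: "gauge \<gamma>" using G r by (auto simp: gauge_def \<gamma>_def)
    have n: "norm ((\<Sum>(x, k)\<in>p. measure lborel k *\<^sub>R e0 x) - (E b - E a)) \<le> \<epsilon> * measure lborel {a..b}"
      if p: "p tagged_division_of {a..b}" and fine: "\<gamma> fine p" for p
    proof -
      have finp: "finite p" using tagged_division_ofD(1)[OF p] .
      have iv: "\<exists>c d. K = {c..d} \<and> c \<le> x \<and> x \<le> d \<and> a \<le> c \<and> d \<le> b \<and> Inf K = c \<and> Sup K = d \<and> measure lborel K = d - c"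
        if xK: "(x, K) \<in> p" for x K
      proof -
        obtain c d where "K = cbox c d" using tagged_division_ofD(4)[OF p xK] by blast
        moreover have "x \<in> K" "K \<subseteq> {a..b}" using tagged_division_ofD(2,3)[OF p xK] by auto
        ultimately show ?thesis by (intro exI[of _ c] exI[of _ d]) auto
      qed
      define pb where "pb = {q\<in>p. fst q \<in> N}"
      define D where "D = snd ` pb"
      have pb: "pb tagged_division_of \<Union>D"
        unfolding D_def by (rule tagged_partial_division_of_Union_self[OF tagged_partial_division_subset[of p "{a..b}"]])
          (use p in \<open>auto simp: tagged_division_of_def pb_def\<close>)
      have D: "D division_of \<Union>D" unfolding D_def by (rule division_of_tagged_division[OF pb[unfolded D_def]])
      have Div: "K = {Inf K..Sup K}" "Inf K \<le> Sup K" "a \<le> Inf K" "Sup K \<le> b"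
          "measure lborel K = Sup K - Inf K" "K \<subseteq> G" if KD: "K \<in> D" for K
      proof -
        obtain x where x: "(x, K) \<in> p" "x \<in> N" using KD by (auto simp: D_def pb_def)
        show "K \<subseteq> G" using fineD[OF fine x(1)] x(2) by (simp add: \<gamma>_def)
        show "K = {Inf K..Sup K}" "Inf K \<le> Sup K" "a \<le> Inf K" "Sup K \<le> b"
          "measure lborel K = Sup K - Inf K" using iv[OF x(1)] by force+
      qed
      let ?P = "(\<lambda>K. (Inf K, Sup K)) ` D"
      have finD: "finite D" using D by auto
      have inj: "inj_on (\<lambda>K. (Inf K, Sup K)) D"
        by (rule inj_onI) (metis Div(1) prod.inject)
      have "(\<Sum>(c, d)\<in>?P. \<bar>E d - E c\<bar>) < \<epsilon> * (b - a) / 2"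
      proof (rule \<delta>(2))
        show "finite ?P" using finD by simp
        show "\<forall>(c, d)\<in>?P. a \<le> c \<and> c \<le> d \<and> d \<le> b" using Div(2-4) by auto
        show "pairwise (\<lambda>(c, d) (c', d'). {c<..<d} \<inter> {c'<..<d'} = {}) ?P"
        proof (rule pairwiseI)
          fix q q' assume "q \<in> ?P" "q' \<in> ?P" "q \<noteq> q'"
          then obtain K L where KL: "K \<in> D" "L \<in> D" "K \<noteq> L" and q: "q = (Inf K, Sup K)" "q' = (Inf L, Sup L)"
            by blast
          have "interior K \<inter> interior L = {}" using division_ofD(5)[OF D KL] .
          moreover have "interior K = {Inf K<..<Sup K}" "interior L = {Inf L<..<Sup L}"
            using Div(1)[OF KL(1)] Div(1)[OF KL(2)] interior_atLeastAtMost_real by metis+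
          ultimately show "(\<lambda>(c, d) (c', d'). {c<..<d} \<inter> {c'<..<d'} = {}) q q'" by (simp add: q)
        qed
        have "(\<Sum>(c, d)\<in>?P. d - c) = (\<Sum>K\<in>D. Sup K - Inf K)"
          by (subst sum.reindex[OF inj]) (simp add: o_def)
        also have "\<dots> = (\<Sum>K\<in>D. measure lebesgue K)"
        proof (rule sum.cong[OF refl])
          fix K assume K: "K \<in> D"
          have "measure lebesgue {Inf K..Sup K} = Sup K - Inf K" using Div(2)[OF K] by simp
          then show "Sup K - Inf K = measure lebesgue K" using Div(1)[OF K] by metis
        qed
        also have "\<dots> = measure lebesgue (\<Union>D)" using content_division[OF D] by simp
        also have "\<dots> \<le> measure lebesgue G"
        proof (rule measure_mono_fmeasurable)
          show "\<Union>D \<subseteq> G" using Div(6) by blast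
          have "K \<in> sets lebesgue" if "K \<in> D" for K by (subst Div(1)[OF that]) simp
          then show "\<Union>D \<in> sets lebesgue" using finD by (intro sets.finite_Union) auto
        qed (use G in auto)
        finally show "(\<Sum>(c, d)\<in>?P. d - c) < \<delta>" using G by linarith
      qed
      moreover have "(\<Sum>(c, d)\<in>?P. \<bar>E d - E c\<bar>) = (\<Sum>K\<in>D. \<bar>E (Sup K) - E (Inf K)\<bar>)"
        by (subst sum.reindex[OF inj]) (simp add: o_def)
      moreover have "(\<Sum>(x, K)\<in>pb. \<bar>E (Sup K) - E (Inf K)\<bar>) = (\<Sum>K\<in>D. \<bar>E (Sup K) - E (Inf K)\<bar>)"
      proof -
        \<comment> \<open>The transfer of sums requires the summand to vanish on intervals with empty interior, including the
        empty one, whose \<open>Inf\<close> and \<open>Sup\<close> are unspecified.\<close>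
        let ?d = "\<lambda>K. if K = {} then 0 else \<bar>E (Sup K) - E (Inf K)\<bar>"
        have "(\<Sum>(x, K)\<in>pb. ?d K) = (\<Sum>K\<in>D. ?d K)"
          unfolding D_def by (rule sum.over_tagged_division_lemma[OF pb]) auto
        moreover have "K \<noteq> {}" if "K \<in> D" for K using Div(1,2)[OF that] by auto
        then have "(\<Sum>K\<in>D. ?d K) = (\<Sum>K\<in>D. \<bar>E (Sup K) - E (Inf K)\<bar>)"
          by (intro sum.cong) auto
        moreover have "(\<Sum>(x, K)\<in>pb. ?d K) = (\<Sum>(x, K)\<in>pb. \<bar>E (Sup K) - E (Inf K)\<bar>)"
          using \<open>\<And>K. K \<in> D \<Longrightarrow> K \<noteq> {}\<close> by (intro sum.cong) (force simp: D_def)+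
        ultimately show ?thesis by simp
      qed
      ultimately have bad: "(\<Sum>(x, K)\<in>pb. \<bar>E (Sup K) - E (Inf K)\<bar>) < \<epsilon> * (b - a) / 2" by simp
      have le: "\<bar>measure lborel K *\<^sub>R e0 x - (E (Sup K) - E (Inf K))\<bar> \<le>
          \<epsilon> / 2 * measure lborel K + (if x \<in> N then \<bar>E (Sup K) - E (Inf K)\<bar> else 0)" if xK: "(x, K) \<in> p" for x K
      proof (cases "x \<in> N")
        case True
        have "0 \<le> \<epsilon> / 2 * measure lborel K" using eps by simp
        then show ?thesis using True by (simp add: e0_def abs_minus_commute[of "E (Inf K)"])
      next
        case False
        obtain c d where K: "K = {c..d}" "c \<le> x" "x \<le> d" "a \<le> c" "d \<le> b" "Inf K = c" "Sup K = d" "measure lborel K = d - c"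
          using iv[OF xK] by blast
        have x: "x \<in> {a..b} - N" using K False by auto
        have "K \<subseteq> ball x (r x)" using fineD[OF fine xK] x by (simp add: \<gamma>_def)
        moreover have "c \<in> K" "d \<in> K" using K by auto
        ultimately have cd: "\<bar>c - x\<bar> < r x" "\<bar>d - x\<bar> < r x" by (auto simp: dist_real_def)
        have "\<bar>E d - E x - e x * (d - x)\<bar> \<le> \<epsilon> / 2 * (d - x)" "\<bar>E c - E x - e x * (c - x)\<bar> \<le> \<epsilon> / 2 * (x - c)"
          using r(2)[OF x cd(1)] r(2)[OF x cd(2)] K by auto
        moreover have "(d - c) * e x - (E d - E c) = (E c - E x - e x * (c - x)) - (E d - E x - e x * (d - x))"
          by (simp add: algebra_simps)
        ultimately have "\<bar>(d - c) * e x - (E d - E c)\<bar> \<le> \<epsilon> / 2 * (d - x) + \<epsilon> / 2 * (x - c)"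
          by linarith
        also have "\<dots> = \<epsilon> / 2 * (d - c)" by (simp add: field_simps)
        finally show ?thesis using False K(6-8) by (simp add: e0_def)
      qed
      have tel: "(\<Sum>(x, K)\<in>p. E (Sup K) - E (Inf K)) = E b - E a"
        using additive_tagged_division_1[of a b p E] ab p by simp
      have "(\<Sum>(x, k)\<in>p. measure lborel k *\<^sub>R e0 x) - (E b - E a) = (\<Sum>(x, K)\<in>p. measure lborel K *\<^sub>R e0 x - (E (Sup K) - E (Inf K)))"
        unfolding tel[symmetric] sum_subtractf[symmetric] by (intro sum.cong) auto
      also have "\<bar>\<dots>\<bar> \<le> (\<Sum>(x, K)\<in>p. \<epsilon> / 2 * measure lborel K + (if x \<in> N then \<bar>E (Sup K) - E (Inf K)\<bar> else 0))"
        by (rule order_trans[OF sum_abs]) (use le in \<open>auto intro!: sum_mono\<close>)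
      also have "\<dots> = \<epsilon> / 2 * (\<Sum>(x, K)\<in>p. measure lborel K) + (\<Sum>(x, K)\<in>pb. \<bar>E (Sup K) - E (Inf K)\<bar>)"
        unfolding sum_distrib_left pb_def split_def sum.distrib
        using finp by (simp add: sum.inter_filter)
      also have "(\<Sum>(x, K)\<in>p. measure lborel K) = b - a"
        using additive_content_tagged_division[of p a b] p ab by simp
      finally show ?thesis using bad ab by (simp add: field_simps)
    qed
    show "\<exists>d. gauge d \<and> (\<forall>p. p tagged_division_of {a..b} \<and> d fine p \<longrightarrow>
       norm ((\<Sum>(x, k)\<in>p. measure lborel k *\<^sub>R e0 x) - (E b - E a)) \<le> \<epsilon> * measure lborel {a..b})"
      by (intro exI[of _ \<gamma>] conjI allI impI) (rule g, elim conjE, rule n)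
  qed
  then show ?thesis
    by (rule has_integral_spike[OF N, rotated]) (auto simp: e0_def)
qed

lemma normalised_derivative_balanced:
  assumes "normalised_derivative E e"
  shows "balanced e"
  unfolding balanced_def
proof
  fix x
  obtain l r where lr: "(e \<longlongrightarrow> l) (at_left x)" "(e \<longlongrightarrow> r) (at_right x)"
    using assms unfolding normalised_derivative_def regulated_def by blast
  then have "Lim (at_left x) e = l" "Lim (at_right x) e = r"
    by (auto intro!: tendsto_Lim)
  then show "\<exists>l r. (e \<longlongrightarrow> l) (at_left x) \<and> (e \<longlongrightarrow> r) (at_right x) \<and> e x = (l + r) / 2"
    using lr assms unfolding normalised_derivative_def by metis
qed

text \<open>The assumption on the filter holds for \<open>at_left x\<close> and \<open>at_right x\<close>; it
  makes every event of the filter non-negligible.\<close>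

lemma AE_eq_imp_limit_eq:
  fixes e e' :: "real \<Rightarrow> real"
  assumes ae: "AE w in lebesgue. e w = e' w"
    and lim: "(e \<longlongrightarrow> l) F" "(e' \<longlongrightarrow> l') F"
    and F: "\<And>P. eventually P F \<Longrightarrow> \<exists>c d. c < d \<and> (\<forall>w\<in>{c<..<d}. P w)"
  shows "l = l'"
proof (rule ccontr)
  assume "l \<noteq> l'"
  moreover have "((\<lambda>w. e w - e' w) \<longlongrightarrow> l - l') F" by (intro tendsto_intros lim)
  ultimately have "\<forall>\<^sub>F w in F. e w - e' w \<noteq> 0" by (intro tendsto_imp_eventually_ne) auto
  from F[OF this] obtain c d where cd: "c < d" "\<forall>w\<in>{c<..<d}. e w - e' w \<noteq> 0" by blast
  have "AE w in lebesgue. w \<notin> {c<..<d}" using ae by eventually_elim (use cd(2) in auto)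
  then have "negligible {c<..<d}" by (simp add: AE_iff_null_sets negligible_iff_null_sets)
  then show False using open_not_negligible[of "{c<..<d}"] cd(1) by auto
qed

lemma normalised_derivative_unique:
  assumes "normalised_derivative E e" "normalised_derivative E e'"
  shows "e = e'"
proof
  fix x
  have ae: "AE w in lebesgue. e w = e' w"
  proof -
    have "AE w in lebesgue. (E has_real_derivative e w) (at w)" "AE w in lebesgue. (E has_real_derivative e' w) (at w)"
      using assms by (auto simp: normalised_derivative_def)
    then show ?thesis by eventually_elim (rule DERIV_unique)
  qed
  obtain l r where e: "(e \<longlongrightarrow> l) (at_left x)" "(e \<longlongrightarrow> r) (at_right x)" "e x = (l + r) / 2"
    using normalised_derivative_balanced[OF assms(1)] unfolding balanced_def by blast
  obtain l' r' where e': "(e' \<longlongrightarrow> l') (at_left x)" "(e' \<longlongrightarrow> r') (at_right x)" "e' x = (l' + r') / 2"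
    using normalised_derivative_balanced[OF assms(2)] unfolding balanced_def by blast
  have "l = l'"
    by (rule AE_eq_imp_limit_eq[OF ae e(1) e'(1)]) (metis eventually_at_left_field greaterThanLessThan_iff)
  moreover have "r = r'"
    by (rule AE_eq_imp_limit_eq[OF ae e(2) e'(2)]) (metis eventually_at_right_field greaterThanLessThan_iff)
  ultimately show "e x = e' x" using e e' by simp
qed

lemma acr_deriv_normalised:
  assumes "E \<in> ACR"
  shows "normalised_derivative E (acr_deriv E)"
proof -
  obtain e where e: "normalised_derivative E e" using assms by (auto simp: ACR_def)
  then have "acr_deriv E = e" unfolding acr_deriv_def
    by (intro the_equality normalised_derivative_unique)
  then show ?thesis using e by simp
qed

lemma bounded_borel_set_integrable:
  fixes e :: "real \<Rightarrow> real"
  assumes "e \<in> borel_measurable borel" "\<And>w. w \<in> {a..b} \<Longrightarrow> \<bar>e w\<bar> \<le> B"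
  shows "set_integrable lborel {a..b} e"
  unfolding set_integrable_def
proof (rule integrableI_bounded_set_indicator[where B=B])
  show "AE x in lborel. x \<in> {a..b} \<longrightarrow> norm (e x) \<le> B" using assms(2) by auto
qed (use assms(1) in \<open>auto simp: emeasure_lborel_Icc_eq\<close>)

lemma acr_primitive:
  assumes "E \<in> ACR"
  shows "E v = E 0 + (LBINT w=ereal 0..ereal v. acr_deriv E w)"
proof -
  let ?e = "acr_deriv E"
  have n: "normalised_derivative E ?e" using acr_deriv_normalised[OF assms] .
  have bal: "balanced ?e" using normalised_derivative_balanced[OF n] .
  have "AE w in lebesgue. (E has_real_derivative ?e w) (at w)"
    using n by (simp add: normalised_derivative_def)
  then obtain N where N: "N \<in> null_sets lebesgue" "{w. \<not> (E has_real_derivative ?e w) (at w)} \<subseteq> N"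
    by (auto simp: eventually_ae_filter)
  have ftc: "(LBINT w=ereal a..ereal b. ?e w) = E b - E a" if "a < b" for a b
  proof -
    have ac: "abs_continuous_on_interval a b E" using assms by (auto simp: ACR_def)
    have neg: "negligible N" using N(1) by (simp add: negligible_iff_null_sets)
    have "(?e has_integral (E b - E a)) {a..b}"
      by (rule abs_continuous_has_integral[OF that ac neg]) (use N(2) in auto)
    moreover obtain B where "\<And>w. w \<in> {a..b} \<Longrightarrow> \<bar>?e w\<bar> \<le> B"
      using balanced_bounded[OF bal] by blast
    then have "set_integrable lborel {a..b} ?e"
      using balanced_borel[OF bal] by (intro bounded_borel_set_integrable) auto
    ultimately show ?thesis using that
      by (subst interval_integral_eq_integral) (auto simp: integral_unique)
  qed
  show ?thesis
  proof (cases v "0::real" rule: linorder_cases)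
    case less
    then show ?thesis using ftc[OF less] by (subst interval_integral_endpoints_reverse) simp
  next
    case equal
    then show ?thesis by (simp add: interval_integral_endpoints_same)
  next
    case greater
    then show ?thesis using ftc[OF greater] by simp
  qed
qed

section \<open>Functionals of the derivative of the entropy\<close>

text \<open>The class of weights $e$ on which the production $N(e)$ is linear. It contains the derivatives of
  all entropies in $\mathbf{ACR}$.\<close>

definition locbdd :: "(real \<Rightarrow> real) \<Rightarrow> bool" where
  "locbdd e \<longleftrightarrow> e \<in> borel_measurable borel \<and> (\<forall>a b. \<exists>B. \<forall>w\<in>{a..b}. \<bar>e w\<bar> \<le> B)"

definition bounded_functional :: "real \<Rightarrow> ((real \<Rightarrow> real) \<Rightarrow> real) \<Rightarrow> bool" where
  "bounded_functional R L \<longleftrightarrow>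
     (\<forall>e e'. locbdd e \<longrightarrow> locbdd e' \<longrightarrow> L (\<lambda>w. e w + e' w) = L e + L e') \<and>
     (\<forall>e r. locbdd e \<longrightarrow> L (\<lambda>w. r * e w) = r * L e) \<and>
     (\<exists>C\<ge>0. \<forall>e \<delta>. locbdd e \<longrightarrow> 0 \<le> \<delta> \<longrightarrow> (\<forall>w\<in>{-R..R}. \<bar>e w\<bar> \<le> \<delta>) \<longrightarrow> \<bar>L e\<bar> \<le> C * \<delta>)"

lemma locbddI:
  assumes "e \<in> borel_measurable borel" "\<And>a b. \<exists>B. \<forall>w\<in>{a..b}. \<bar>e w\<bar> \<le> B"
  shows "locbdd e"
  using assms by (simp add: locbdd_def)

lemma locbdd_bound:
  assumes "locbdd e"
  obtains B where "B \<ge> 0" "\<And>w. w \<in> {a..b} \<Longrightarrow> \<bar>e w\<bar> \<le> B"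
proof -
  obtain B where "\<forall>w\<in>{a..b}. \<bar>e w\<bar> \<le> B" using assms unfolding locbdd_def by blast
  then show ?thesis by (intro that[of "max 0 B"]) (auto simp: le_max_iff_disj)
qed

lemma locbdd_borel: "locbdd e \<Longrightarrow> e \<in> borel_measurable borel"
  by (simp add: locbdd_def)

lemma locbdd_add:
  assumes "locbdd e" "locbdd e'"
  shows "locbdd (\<lambda>w. e w + e' w)"
proof (rule locbddI)
  show "(\<lambda>w. e w + e' w) \<in> borel_measurable borel"
    using assms[THEN locbdd_borel] by measurable
  fix a b
  obtain B where B: "\<And>w. w \<in> {a..b} \<Longrightarrow> \<bar>e w\<bar> \<le> B" using locbdd_bound[OF assms(1)] by blast
  obtain B' where B': "\<And>w. w \<in> {a..b} \<Longrightarrow> \<bar>e' w\<bar> \<le> B'" using locbdd_bound[OF assms(2)] by blast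
  show "\<exists>B. \<forall>w\<in>{a..b}. \<bar>e w + e' w\<bar> \<le> B"
    by (intro exI[of _ "B + B'"] ballI order_trans[OF abs_triangle_ineq] add_mono B B')
qed

lemma locbdd_scale:
  assumes "locbdd e"
  shows "locbdd (\<lambda>w. r * e w)"
proof (rule locbddI)
  show "(\<lambda>w. r * e w) \<in> borel_measurable borel"
    using locbdd_borel[OF assms] by measurable
  fix a b
  obtain B where B: "\<And>w. w \<in> {a..b} \<Longrightarrow> \<bar>e w\<bar> \<le> B" using locbdd_bound[OF assms(1)] by blast
  show "\<exists>B. \<forall>w\<in>{a..b}. \<bar>r * e w\<bar> \<le> B"
    by (intro exI[of _ "\<bar>r\<bar> * B"] ballI) (auto simp: abs_mult intro!: mult_left_mono B)
qed

lemma locbdd_sum: "finite A \<Longrightarrow> (\<And>i. i \<in> A \<Longrightarrow> locbdd (e i)) \<Longrightarrow> locbdd (\<lambda>w. \<Sum>i\<in>A. e i w)"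
proof (induction A rule: finite_induct)
  case empty
  then show ?case by (auto intro!: locbddI)
next
  case (insert i A)
  then show ?case by (simp add: locbdd_add)
qed

lemma balanced_locbdd:
  assumes "balanced e"
  shows "locbdd e"
proof (rule locbddI[OF balanced_borel[OF assms]])
  fix a b
  obtain B where "\<And>w. w \<in> {a..b} \<Longrightarrow> \<bar>e w\<bar> \<le> B" using balanced_bounded[OF assms] by blast
  then show "\<exists>B. \<forall>w\<in>{a..b}. \<bar>e w\<bar> \<le> B" by blast
qed

lemma nstep_locbdd: "s \<in> nstep \<Longrightarrow> locbdd s"
  by (intro balanced_locbdd nstep_balanced)

lemma locbdd_sgn: "locbdd (\<lambda>w. sgn (w - c))"
  using nstep_locbdd[OF nstep.jump[of 1 c]] by simp

lemma locbdd_const: "locbdd (\<lambda>w. r)"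
  using nstep_locbdd[OF nstep.const[of r]] by simp

lemma bounded_functionalI:
  assumes "\<And>e e'. locbdd e \<Longrightarrow> locbdd e' \<Longrightarrow> L (\<lambda>w. e w + e' w) = L e + L e'"
    "\<And>e r. locbdd e \<Longrightarrow> L (\<lambda>w. r * e w) = r * L e"
    "C \<ge> 0" "\<And>e \<delta>. locbdd e \<Longrightarrow> 0 \<le> \<delta> \<Longrightarrow> (\<And>w. w \<in> {-R..R} \<Longrightarrow> \<bar>e w\<bar> \<le> \<delta>) \<Longrightarrow> \<bar>L e\<bar> \<le> C * \<delta>"
  shows "bounded_functional R L"
  unfolding bounded_functional_def using assms by meson

lemma bounded_functional_add:
  assumes "bounded_functional R L" "bounded_functional R L'"
  shows "bounded_functional R (\<lambda>e. L e + L' e)"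
proof -
  obtain C where C: "C \<ge> 0" "\<And>e \<delta>. locbdd e \<Longrightarrow> 0 \<le> \<delta> \<Longrightarrow> (\<And>w. w \<in> {-R..R} \<Longrightarrow> \<bar>e w\<bar> \<le> \<delta>) \<Longrightarrow> \<bar>L e\<bar> \<le> C * \<delta>"
    using assms(1) unfolding bounded_functional_def by meson
  obtain C' where C': "C' \<ge> 0" "\<And>e \<delta>. locbdd e \<Longrightarrow> 0 \<le> \<delta> \<Longrightarrow> (\<And>w. w \<in> {-R..R} \<Longrightarrow> \<bar>e w\<bar> \<le> \<delta>) \<Longrightarrow> \<bar>L' e\<bar> \<le> C' * \<delta>"
    using assms(2) unfolding bounded_functional_def by meson
  show ?thesis
  proof (rule bounded_functionalI[where C="C + C'"])
    fix e \<delta> assume *: "locbdd e" "0 \<le> (\<delta>::real)" "\<And>w. w \<in> {-R..R} \<Longrightarrow> \<bar>e w\<bar> \<le> \<delta>"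
    have "\<bar>L e\<bar> \<le> C * \<delta>" "\<bar>L' e\<bar> \<le> C' * \<delta>" using C(2)[OF *] C'(2)[OF *] by auto
    then show "\<bar>L e + L' e\<bar> \<le> (C + C') * \<delta>" unfolding distrib_right by linarith
  qed (use assms C C' in \<open>auto simp: bounded_functional_def distrib_left\<close>)
qed

lemma bounded_functional_scale:
  assumes "bounded_functional R L"
  shows "bounded_functional R (\<lambda>e. r * L e)"
proof -
  obtain C where C: "C \<ge> 0" "\<And>e \<delta>. locbdd e \<Longrightarrow> 0 \<le> \<delta> \<Longrightarrow> (\<And>w. w \<in> {-R..R} \<Longrightarrow> \<bar>e w\<bar> \<le> \<delta>) \<Longrightarrow> \<bar>L e\<bar> \<le> C * \<delta>"
    using assms(1) unfolding bounded_functional_def by meson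
  show ?thesis
  proof (rule bounded_functionalI[where C="\<bar>r\<bar> * C"])
    fix e \<delta> assume *: "locbdd e" "0 \<le> (\<delta>::real)" "\<And>w. w \<in> {-R..R} \<Longrightarrow> \<bar>e w\<bar> \<le> \<delta>"
    show "\<bar>r * L e\<bar> \<le> \<bar>r\<bar> * C * \<delta>" using mult_left_mono[OF C(2)[OF *], of "\<bar>r\<bar>"] by (simp add: abs_mult mult.assoc)
  qed (use assms C in \<open>auto simp: bounded_functional_def distrib_left\<close>)
qed

lemma bounded_functional_sum:
  assumes "finite A" "\<And>i. i \<in> A \<Longrightarrow> bounded_functional R (L i)"
  shows "bounded_functional R (\<lambda>e. \<Sum>i\<in>A. L i e)"
  using assms
proof (induction A rule: finite_induct)
  case empty
  then show ?case by (auto intro: bounded_functionalI[where C=0])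
next
  case (insert i A)
  then show ?case by (simp add: bounded_functional_add)
qed

text \<open>This turns a Stieltjes sum of the numbers $\mu_\xi$ into the functional applied to one
  function.\<close>

lemma bounded_functional_finite_sum:
  assumes L: "bounded_functional R L" and "finite A" "\<And>i. i \<in> A \<Longrightarrow> locbdd (e i)"
  shows "L (\<lambda>w. \<Sum>i\<in>A. e i w) = (\<Sum>i\<in>A. L (e i))"
  using assms(2,3)
proof (induction A rule: finite_induct)
  case empty
  have "L (\<lambda>w. 0 * 0) = 0 * L (\<lambda>w. 0)"
    using L locbdd_const[of 0] unfolding bounded_functional_def by blast
  then show ?case by simp
next
  case (insert i A)
  have "L (\<lambda>w. e i w + (\<Sum>i\<in>A. e i w)) = L (e i) + L (\<lambda>w. \<Sum>i\<in>A. e i w)"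
    using L insert locbdd_sum[of A e] unfolding bounded_functional_def by blast
  then show ?case using insert by simp
qed

text \<open>The abstract form of the theorem. For $e=\mathrm{sgn}(\cdot-c)$ with $a<c<b$ both sides are
  $2h(c)$, and for the other $c$ both vanish. In general, $e$ is approximated
  uniformly by $s$ in \<open>nstep\<close>; the Stieltjes sums for $e-s$ are values of $L$ at
  functions bounded by $10\sup|e-s|$.\<close>

lemma bounded_functional_ks_representation:
  assumes L: "bounded_functional R L" and e: "balanced e" and ab: "a < b"
    and L1: "L (\<lambda>_. 1) = 0"
    and h: "\<And>c. h c = L (\<lambda>w. sgn (w - c))"
    and h0: "\<And>c. c \<le> a \<or> b \<le> c \<Longrightarrow> h c = 0"
  shows "has_ks_integral h e a b (2 * L e)"
proof -
  have Ladd: "L (\<lambda>w. s w + s' w) = L s + L s'" if "locbdd s" "locbdd s'" for s s'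
    using L that unfolding bounded_functional_def by blast
  have scale: "L (\<lambda>w. r * s w) = r * L s" if "locbdd s" for s r
    using L that unfolding bounded_functional_def by blast
  obtain C where C: "C \<ge> 0" "\<And>e \<delta>. locbdd e \<Longrightarrow> 0 \<le> \<delta> \<Longrightarrow> (\<And>w. w \<in> {-R..R} \<Longrightarrow> \<bar>e w\<bar> \<le> \<delta>) \<Longrightarrow> \<bar>L e\<bar> \<le> C * \<delta>"
    using L unfolding bounded_functional_def by meson
  have step: "has_ks_integral h s a b (2 * L s)" if "s \<in> nstep" for s
    using that
  proof (induction rule: nstep.induct)
    case (const r)
    have "L (\<lambda>_. r) = 0" using scale[OF locbdd_const, of r 1] L1 by simp
    then show ?case using has_ks_integral_const by simp
  next
    case (jump r c)
    have "L (\<lambda>w. r * sgn (w - c)) = r * h c" using scale[OF locbdd_sgn] h by simp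
    moreover have "r * h c * (sgn (b - c) - sgn (a - c)) = 2 * (r * h c)"
      using h0[of c] by (cases "c \<le> a \<or> b \<le> c") auto
    moreover have "has_ks_integral h (\<lambda>w. r * sgn (w - c)) a b (r * h c * (sgn (b - c) - sgn (a - c)))"
      by (rule has_ks_integral_sgn[OF less_imp_le[OF ab]])
    ultimately show ?case by metis
  next
    case (add s s')
    have "L (\<lambda>w. s w + s' w) = L s + L s'" by (intro Ladd nstep_locbdd add.hyps)
    then show ?case using has_ks_integral_add[OF add.IH] by (simp add: distrib_left)
  qed
  have sum_bound: "\<bar>ks_sum h G P\<bar> \<le> C * (10 * \<delta>)"
    if P: "P tagged_division_of {a..b}" and G: "\<And>x. x \<in> {a..b} \<Longrightarrow> \<bar>G x\<bar> \<le> \<delta>" for P G \<delta>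
  proof -
    let ?e = "\<lambda>(\<xi>, K) w. (G (Sup K) - G (Inf K)) * sgn (w - \<xi>)"
    have finP: "finite P" using tagged_division_ofD(1)[OF P] .
    have lb: "locbdd (?e p)" for p by (cases p) (auto intro!: locbdd_scale locbdd_sgn)
    have "ks_sum h G P = (\<Sum>p\<in>P. L (?e p))"
      using scale[OF locbdd_sgn] by (intro sum.cong) (auto simp: h)
    also have "\<dots> = L (\<lambda>w. \<Sum>p\<in>P. ?e p w)"
      using bounded_functional_finite_sum[OF L finP, of ?e] lb by simp
    also have "\<bar>\<dots>\<bar> \<le> C * (10 * \<delta>)"
    proof (rule C(2))
      show "locbdd (\<lambda>w. \<Sum>p\<in>P. ?e p w)" by (intro locbdd_sum finP lb)
      show "0 \<le> 10 * \<delta>" using G[of a] ab by auto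
      fix w
      have "(\<Sum>p\<in>P. ?e p w) = (\<Sum>(\<xi>, K)\<in>P. sgn (w - \<xi>) * (G (Sup K) - G (Inf K)))"
        by (intro sum.cong) auto
      then show "\<bar>\<Sum>p\<in>P. ?e p w\<bar> \<le> 10 * \<delta>"
        using sgn_ks_sum_bound[OF P less_imp_le[OF ab] G, where w=w] by simp
    qed
    finally show ?thesis .
  qed
  show ?thesis
    unfolding has_ks_integral_def
  proof (intro allI impI)
    fix \<epsilon> :: real assume eps: "\<epsilon> > 0"
    \<comment> \<open>Replacing $e$ by $s$ costs $10C\delta$ in the Stieltjes sum and $2C\delta$ in $2L(e)$.\<close>
    define \<delta> where "\<delta> = \<epsilon> / (2 * (12 * C + 1))"
    have \<delta>: "\<delta> > 0" "12 * C * \<delta> < \<epsilon> / 2" using eps C(1) by (auto simp: \<delta>_def field_simps)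
    obtain s where s: "s \<in> nstep" "\<And>w. w \<in> {min a (-R)..max b R} \<Longrightarrow> \<bar>e w - s w\<bar> \<le> \<delta>"
      using balanced_uniform_approx[OF e \<delta>(1)] by blast
    have lbs: "locbdd s" "locbdd e" using nstep_locbdd[OF s(1)] balanced_locbdd[OF e] by auto
    define r where "r w = e w - s w" for w
    have rr: "r = (\<lambda>w. e w + (-1) * s w)" by (auto simp: r_def)
    have lbr: "locbdd r" unfolding rr by (intro locbdd_add locbdd_scale lbs)
    have Lr: "L r = L e - L s" unfolding rr using Ladd[OF lbs(2) locbdd_scale[OF lbs(1)], of "-1"] scale[OF lbs(1), of "-1"] by simp
    have "\<bar>L r\<bar> \<le> C * \<delta>" by (rule C(2)[OF lbr less_imp_le[OF \<delta>(1)]]) (unfold r_def, rule s(2), auto)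
    obtain \<gamma> where \<gamma>: "gauge \<gamma>" "\<And>P. P tagged_division_of {a..b} \<and> \<gamma> fine P \<Longrightarrow>
        \<bar>ks_sum h s P - 2 * L s\<bar> < \<epsilon> / 2"
      using step[OF s(1)] half_gt_zero[OF eps] unfolding has_ks_integral_def by meson
    show "\<exists>\<gamma>. gauge \<gamma> \<and> (\<forall>P. P tagged_division_of {a..b} \<and> \<gamma> fine P \<longrightarrow>
             \<bar>ks_sum h e P - 2 * L e\<bar> < \<epsilon>)"
    proof (intro exI[of _ \<gamma>] conjI allI impI)
      show "gauge \<gamma>" by fact
      fix P assume P: "P tagged_division_of {a..b} \<and> \<gamma> fine P"
      have "\<bar>ks_sum h r P\<bar> \<le> C * (10 * \<delta>)"
        by (rule sum_bound, use P in blast) (unfold r_def, rule s(2), auto)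
      moreover have "ks_sum h e P =
          ks_sum h s P + ks_sum h r P"
        unfolding sum.distrib[symmetric] by (intro sum.cong) (auto simp: r_def algebra_simps)
      moreover have "\<bar>ks_sum h s P - 2 * L s\<bar> < \<epsilon> / 2"
        using \<gamma>(2)[OF P] .
      ultimately show "\<bar>ks_sum h e P - 2 * L e\<bar> < \<epsilon>"
        using Lr \<open>\<bar>L r\<bar> \<le> C * \<delta>\<close> \<delta>(2) by linarith
    qed
  qed
qed

section \<open>Integration over the strip\<close>

text \<open>The product theorem holds for Borel measure, and Lebesgue measure on the product is its completion.
  A Borel representative agrees with $h$ on almost every slice almost everywhere, and the slices and
  the inner integral are measurable because Lebesgue measure is complete.\<close>

lemma lebesgue_Fubini:
  fixes h :: "real \<times> 'a::euclidean_space \<Rightarrow> real"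
  assumes h: "integrable lebesgue h"
  shows "(LINT t|lebesgue. LINT x|lebesgue. h (t, x)) = (LINT p|lebesgue. h p)"
proof -
  have "h \<in> borel_measurable lebesgue" using h by auto
  then obtain h' where h': "h' \<in> borel_measurable lborel" and ae: "AE p in lborel. h p = h' p"
    using completion_ex_borel_measurable_real[of h lborel] by auto
  have h'l: "h' \<in> borel_measurable lebesgue" using h' by (rule measurable_completion)
  have ae': "AE p in lebesgue. h p = h' p" using AE_completion[OF ae] .
  have "integrable lebesgue h'"
    using h h'l ae' integrable_cong_AE[of h lebesgue h'] by auto
  then have int: "integrable lborel h'" using integrable_completion[OF h'] by blast
  then have int2: "integrable (lborel \<Otimes>\<^sub>M lborel) h'" by (simp add: lborel_prod)
  have "AE p in lborel \<Otimes>\<^sub>M lborel. h p = h' p" by (subst lborel_prod) (rule ae)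
  from lborel_pair.AE_pair[OF this]
  have ae2: "AE t in lborel. AE x in lborel. h (t, x) = h' (t, x)" .
  have inner: "(LINT x|lebesgue. h (t, x)) = (LINT x|lborel. h' (t, x))"
    if t: "AE x in lborel. h (t, x) = h' (t, x)" for t
  proof -
    have m: "(\<lambda>x. h' (t, x)) \<in> borel_measurable lborel" using h' by measurable
    have ml: "(\<lambda>x. h' (t, x)) \<in> borel_measurable lebesgue" using m by (rule measurable_completion)
    have ae3: "AE x in lebesgue. h' (t, x) = h (t, x)" using AE_completion[OF t] by (auto elim: eventually_mono)
    have "(LINT x|lebesgue. h (t, x)) = (LINT x|lebesgue. h' (t, x))"
      by (rule integral_cong_AE[OF borel_measurable_AE[OF ml ae3] ml]) (use ae3 in \<open>auto elim: eventually_mono\<close>)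
    also have "\<dots> = (LINT x|lborel. h' (t, x))" by (rule integral_completion[OF m])
    finally show ?thesis .
  qed
  have mo: "(\<lambda>t. LINT x|lborel. h' (t, x)) \<in> borel_measurable lborel" using h' by measurable
  then have mol: "(\<lambda>t. LINT x|lborel. h' (t, x)) \<in> borel_measurable lebesgue" by (rule measurable_completion)
  have aeo: "AE t in lebesgue. (LINT x|lborel. h' (t, x)) = (LINT x|lebesgue. h (t, x))"
    using AE_completion[OF ae2] by eventually_elim (simp add: inner)
  have "(LINT t|lebesgue. LINT x|lebesgue. h (t, x)) = (LINT t|lebesgue. LINT x|lborel. h' (t, x))"
    by (rule integral_cong_AE[OF borel_measurable_AE[OF mol aeo] mol]) (use aeo in \<open>auto elim: eventually_mono\<close>)
  also have "\<dots> = (LINT t|lborel. LINT x|lborel. h' (t, x))" by (rule integral_completion[OF mo])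
  also have "\<dots> = (LINT p|lborel. h' p)" using lborel_pair.integral_fst'[OF int2] by (simp add: lborel_prod)
  also have "\<dots> = (LINT p|lebesgue. h' p)" by (rule integral_completion[OF h', symmetric])
  also have "\<dots> = (LINT p|lebesgue. h p)"
    by (rule integral_cong_AE) (use h h'l ae' in \<open>auto elim: eventually_mono\<close>)
  finally show ?thesis .
qed

lemma int_strip_eq_integral:
  fixes h :: "real \<Rightarrow> real^'n \<Rightarrow> real"
  assumes I: "I \<in> sets borel" and h: "integrable (strip_measure I) (\<lambda>(t, x). h t x)"
  shows "int_strip I h = (LINT p|strip_measure I. h (fst p) (snd p))"
proof -
  have "I \<times> (UNIV :: (real^'n) set) \<in> sets borel"
    using I by (metis borel_prod pair_measureI sets.top space_borel)
  then have S: "(I \<times> (UNIV :: (real^'n) set)) \<inter> space lebesgue \<in> sets lebesgue" by simp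
  let ?H = "\<lambda>p. indicator (I \<times> UNIV) p *\<^sub>R h (fst p) (snd p)"
  have "integrable lebesgue ?H"
    using h unfolding strip_measure_def integrable_restrict_space[OF S] by (simp add: split_def)
  from lebesgue_Fubini[OF this]
  have "(LINT p|lebesgue. ?H p) = (LINT t|lebesgue. LINT x|lebesgue. ?H (t, x))" by simp
  also have "\<dots> = int_strip I h"
    unfolding int_strip_def set_lebesgue_integral_def
    by (intro Bochner_Integration.integral_cong refl) (auto simp: indicator_def)
  finally show ?thesis
    unfolding strip_measure_def integral_restrict_space[OF S] by simp
qed

section \<open>Integrals of derivatives of compactly supported functions\<close>

text \<open>The integral of $h(\cdot+sv)$ does not depend on $s$, by translation invariance. Its derivative at
  $s=0$ is the integral in question; the difference quotients are dominated with the
  help of the mean value theorem.\<close>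

lemma integral_derivative_compact_support:
  fixes h :: "'a::euclidean_space \<Rightarrow> real"
  assumes der: "\<And>x. (h has_derivative h' x) (at x)"
    and cont: "continuous_on UNIV (\<lambda>x. h' x v)"
    and S: "compact S" "\<And>x. x \<notin> S \<Longrightarrow> h x = 0"
  shows "(LINT x|lborel. h' x v) = 0"
proof -
  have h'0: "h' x v = 0" if "x \<notin> S" for x
  proof -
    have "open (- S)" using S(1) by (simp add: compact_imp_closed open_Compl)
    then have "(h has_derivative (\<lambda>_. 0)) (at x)"
      using has_derivative_transform_within_open[OF has_derivative_const[of 0 "at x"], of "- S" h] that S(2) by auto
    then show ?thesis using has_derivative_unique[OF der] by metis
  qed
  have "compact ((\<lambda>x. h' x v) ` S)" using S(1) cont by (intro compact_continuous_image) (auto intro: continuous_on_subset)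
  then obtain M0 where M0: "\<And>x. x \<in> S \<Longrightarrow> \<bar>h' x v\<bar> \<le> M0"
    using compact_imp_bounded bounded_iff by (metis imageI real_norm_def)
  define M where "M = max 0 M0"
  have M: "\<bar>h' x v\<bar> \<le> M" for x using M0[of x] h'0[of x] by (cases "x \<in> S") (auto simp: M_def)
  \<comment> \<open>All difference quotients with step at most $1$ are supported in \<open>S'\<close>.\<close>
  define S' where "S' = (\<lambda>(x, t). x - t *\<^sub>R v) ` (S \<times> {0..1::real})"
  have "compact S'" unfolding S'_def
    by (intro compact_continuous_image compact_Times S(1)) (auto intro!: continuous_intros simp: split_def)
  have hc: "continuous_on UNIV h" using der by (meson has_derivative_continuous_on has_derivative_at_withinI)
  have hb: "h \<in> borel_measurable lborel" using hc by (simp add: borel_measurable_continuous_onI)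
  define q where "q n x = real (Suc n) * (h (x + (1 / real (Suc n)) *\<^sub>R v) - h x)" for n x
  have hint: "integrable lborel h"
  proof -
    have "integrable lborel (\<lambda>x. indicator S x *\<^sub>R h x)"
      using borel_integrable_compact[OF S(1), of h] continuous_on_subset[OF hc] by (auto simp: indicator_def if_distrib cong: if_cong)
    moreover have "(\<lambda>x. indicator S x *\<^sub>R h x) = h" using S(2) by (auto simp: indicator_def fun_eq_iff)
    ultimately show ?thesis by simp
  qed
  have tr: "integrable lborel (\<lambda>x. h (x + a))" "(LINT x|lborel. h (x + a)) = (LINT x|lborel. h x)" for a
  proof -
    have *: "distr lborel borel ((+) a) = (lborel :: 'a measure)" by (rule lborel_distr_plus)
    have "integrable (distr lborel borel ((+) a)) h" using hint * by simp
    then have "integrable lborel (\<lambda>x. h (a + x))" using hb by (subst (asm) integrable_distr_eq) auto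
    then show "integrable lborel (\<lambda>x. h (x + a))" by (simp add: add.commute)
    have "(LINT x|lborel. h x) = (LINT x|distr lborel borel ((+) a). h x)" using * by simp
    also have "\<dots> = (LINT x|lborel. h (a + x))" using hb by (subst integral_distr) auto
    finally show "(LINT x|lborel. h (x + a)) = (LINT x|lborel. h x)" by (simp add: add.commute)
  qed
  have "(\<lambda>n. LINT x|lborel. q n x) \<longlonglongrightarrow> (LINT x|lborel. h' x v)"
  proof (rule integral_dominated_convergence[where w="\<lambda>x. indicator S' x * M"])
    show "(\<lambda>x. h' x v) \<in> borel_measurable lborel" using cont by (simp add: borel_measurable_continuous_onI)
    show "q n \<in> borel_measurable lborel" for n unfolding q_def using tr(1) hint by (intro borel_measurable_integrable) auto
    show "integrable lborel (\<lambda>x. indicator S' x * M)"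
      using \<open>compact S'\<close> by (auto intro!: emeasure_compact_finite borel_compact integrable_mult_left)
    show "AE x in lborel. (\<lambda>n. q n x) \<longlonglongrightarrow> h' x v"
    proof (intro AE_I2)
      fix x
      have lin: "linear (h' x)" using der[of x] has_derivative_linear by blast
      have "((\<lambda>t. h (x + t *\<^sub>R v)) has_derivative (\<lambda>t. h' x (t *\<^sub>R v))) (at 0)"
        by (rule has_derivative_compose[of "\<lambda>t. x + t *\<^sub>R v" "\<lambda>t. t *\<^sub>R v" 0 UNIV h "h' x", simplified])
          (auto intro!: derivative_eq_intros simp: der)
      then have "((\<lambda>t. h (x + t *\<^sub>R v)) has_real_derivative h' x v) (at 0)"
        by (simp add: has_field_derivative_def linear_scale[OF lin] mult_commute_abs)
      then have "((\<lambda>t. (h (x + t *\<^sub>R v) - h x) / t) \<longlongrightarrow> h' x v) (at 0)"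
        by (simp add: DERIV_def)
      moreover have "filterlim (\<lambda>n. 1 / real (Suc n)) (at 0) sequentially"
        unfolding filterlim_at using LIMSEQ_inverse_real_of_nat by (auto simp: inverse_eq_divide)
      ultimately have "(\<lambda>n. (h (x + (1 / real (Suc n)) *\<^sub>R v) - h x) / (1 / real (Suc n))) \<longlonglongrightarrow> h' x v"
        by (rule filterlim_compose)
      then show "(\<lambda>n. q n x) \<longlonglongrightarrow> h' x v" by (simp add: q_def mult.commute)
    qed
    show "AE x in lborel. norm (q n x) \<le> indicator S' x * M" for n
    proof (intro AE_I2)
      fix x
      let ?s = "1 / real (Suc n)"
      have "\<exists>\<theta>\<in>{0..1}. h (x + ?s *\<^sub>R v) - h x = h' (x + (\<theta> * ?s) *\<^sub>R v) (?s *\<^sub>R v)"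
      proof -
        have d: "((\<lambda>t. h (x + (t * ?s) *\<^sub>R v)) has_derivative (\<lambda>t. h' (x + (\<theta> * ?s) *\<^sub>R v) ((t * ?s) *\<^sub>R v))) (at \<theta>)" for \<theta>
          by (rule has_derivative_compose[OF _ der]) (auto intro!: derivative_eq_intros)
        have "\<exists>\<theta>\<in>{0<..<1}. (\<lambda>t. h (x + (t * ?s) *\<^sub>R v)) 1 - (\<lambda>t. h (x + (t * ?s) *\<^sub>R v)) 0 = (\<lambda>t. h' (x + (\<theta> * ?s) *\<^sub>R v) ((t * ?s) *\<^sub>R v)) (1 - 0)"
          by (rule mvt_simple) (use d in \<open>auto intro: has_derivative_at_withinI\<close>)
        then show ?thesis by auto
      qed
      then obtain \<theta> where \<theta>: "\<theta> \<in> {0..1}" "h (x + ?s *\<^sub>R v) - h x = h' (x + (\<theta> * ?s) *\<^sub>R v) (?s *\<^sub>R v)" by blast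
      have lin: "linear (h' y)" for y using der[of y] has_derivative_linear by blast
      have qe: "q n x = h' (x + (\<theta> * ?s) *\<^sub>R v) v"
        unfolding q_def \<theta>(2) by (simp add: linear_scale[OF lin])
      show "norm (q n x) \<le> indicator S' x * M"
      proof (cases "x \<in> S'")
        case True
        then show ?thesis using M by (simp add: qe)
      next
        case False
        have "x + (\<theta> * ?s) *\<^sub>R v \<notin> S"
        proof
          assume a: "x + (\<theta> * ?s) *\<^sub>R v \<in> S"
          have "\<theta> * ?s \<in> {0..1}" using \<theta>(1) by (auto simp: field_simps intro: mult_le_one)
          with a have "x \<in> S'" unfolding S'_def
            by (intro image_eqI[of _ _ "(x + (\<theta> * ?s) *\<^sub>R v, \<theta> * ?s)"]) auto
          then show False using False by simp
        qed
        then show ?thesis using False h'0 by (simp add: qe)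
      qed
    qed
  qed
  moreover have "(LINT x|lborel. q n x) = 0" for n
    unfolding q_def using tr hint by simp
  ultimately show ?thesis by (simp add: LIMSEQ_const_iff)
qed

section \<open>Primitives weighted by the derivative of the entropy\<close>

text \<open>The primitive of $k$ with weight $e$ that vanishes at $0$. With $k=1$ it is the entropy with derivative $e$, up to
  a constant; with $k=\partial_uf_i$ it is a component of its flux.\<close>

definition prim :: "(real \<Rightarrow> real) \<Rightarrow> (real \<Rightarrow> real) \<Rightarrow> real \<Rightarrow> real" where
  "prim e k v = (LBINT w=ereal 0..ereal v. e w * k w)"

lemma continuous_compact_bound:
  fixes k :: "'a::topological_space \<Rightarrow> real"
  assumes "continuous_on S k" "compact S"
  obtains M where "M \<ge> 0" "\<And>x. x \<in> S \<Longrightarrow> \<bar>k x\<bar> \<le> M"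
proof -
  have "bounded (k ` S)" using assms by (intro compact_imp_bounded compact_continuous_image)
  then obtain M where M: "\<forall>y\<in>k ` S. norm y \<le> M" unfolding bounded_iff by blast
  show ?thesis
  proof (rule that[of "max 0 M"])
    show "\<bar>k x\<bar> \<le> max 0 M" if "x \<in> S" for x using bspec[OF M imageI[OF that]] by simp
  qed simp
qed

lemma locbdd_mult_integrable:
  assumes e: "locbdd e" and k: "continuous_on UNIV (k :: real \<Rightarrow> real)"
  shows "set_integrable lborel {a..b} (\<lambda>w. e w * k w)"
proof -
  obtain B where B: "B \<ge> 0" "\<And>w. w \<in> {a..b} \<Longrightarrow> \<bar>e w\<bar> \<le> B" using locbdd_bound[OF e] by blast
  obtain M where M: "\<And>w. w \<in> {a..b} \<Longrightarrow> \<bar>k w\<bar> \<le> M"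
    using continuous_compact_bound[OF continuous_on_subset[OF k subset_UNIV] compact_Icc] by blast
  show ?thesis
  proof (rule bounded_borel_set_integrable)
    show "(\<lambda>w. e w * k w) \<in> borel_measurable borel"
      using locbdd_borel[OF e] borel_measurable_continuous_onI[OF k] by measurable
    show "\<bar>e w * k w\<bar> \<le> B * M" if "w \<in> {a..b}" for w
      unfolding abs_mult using B(2)[OF that] M[OF that] B(1) by (intro mult_mono) auto
  qed
qed

lemma locbdd_mult_interval_integrable:
  assumes "locbdd e" "continuous_on UNIV (k :: real \<Rightarrow> real)"
  shows "interval_lebesgue_integrable lborel (ereal a) (ereal b) (\<lambda>w. e w * k w)"
proof -
  have "set_integrable lborel (einterval (ereal c) (ereal d)) (\<lambda>w. e w * k w)" for c d
    by (rule set_integrable_subset[OF locbdd_mult_integrable[OF assms, of c d]]) (auto simp: einterval_iff)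
  then show ?thesis unfolding interval_lebesgue_integrable_def by simp
qed

lemma interval_integral_norm_le:
  fixes F :: "real \<Rightarrow> real"
  assumes int: "interval_lebesgue_integrable lborel (ereal a) (ereal b) F"
    and bd: "\<And>w. w \<in> {min a b..max a b} \<Longrightarrow> \<bar>F w\<bar> \<le> M"
  shows "\<bar>LBINT w=ereal a..ereal b. F w\<bar> \<le> M * \<bar>b - a\<bar>"
proof -
  have *: "\<bar>LBINT w=ereal c..ereal d. F w\<bar> \<le> M * (d - c)"
    if cd: "c \<le> d" and i: "interval_lebesgue_integrable lborel (ereal c) (ereal d) F"
      and b: "\<And>w. w \<in> {c..d} \<Longrightarrow> \<bar>F w\<bar> \<le> M" for c d
  proof -
    have i': "set_integrable lborel (einterval c d) F" using i cd by (simp add: interval_lebesgue_integrable_def)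
    have "\<bar>LBINT w=ereal c..ereal d. F w\<bar> = norm (LINT w|lborel. indicator (einterval c d) w * F w)"
      using cd by (simp add: interval_lebesgue_integral_def set_lebesgue_integral_def)
    also have "\<dots> \<le> (LINT w|lborel. M * indicator {c..d} w)"
    proof (rule Bochner_Integration.integral_norm_bound_integral)
      show "integrable lborel (\<lambda>w. indicator (einterval c d) w * F w)" using i' by (simp add: set_integrable_def)
      show "integrable lborel (\<lambda>w. M * indicator {c..d} w)" by (auto intro!: integrable_mult_right integrable_real_indicator simp: emeasure_lborel_Icc_eq)
      show "norm (indicator (einterval (ereal c) (ereal d)) w * F w) \<le> M * indicator {c..d} w" for w
      proof (cases "w \<in> {c..d}")
        case True
        then show ?thesis using b[OF True] by (auto simp: indicator_def)
      next
        case False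
        then have "w \<notin> einterval c d" by (auto simp: einterval_iff)
        then show ?thesis using False by (auto simp: indicator_def)
      qed
    qed
    also have "\<dots> = M * (d - c)" using cd by simp
    finally show ?thesis .
  qed
  show ?thesis
  proof (cases "a \<le> b")
    case True
    then show ?thesis using *[OF True int] bd by auto
  next
    case False
    then have ba: "b \<le> a" by simp
    have "interval_lebesgue_integrable lborel (ereal b) (ereal a) F"
      using int False by (simp add: interval_lebesgue_integrable_def)
    then show ?thesis using *[OF ba] bd False by (subst interval_integral_endpoints_reverse) (auto simp: min_def max_def)
  qed
qed

lemma prim_add:
  assumes "locbdd e" "locbdd e'" "continuous_on UNIV k"
  shows "prim (\<lambda>w. e w + e' w) k v = prim e k v + prim e' k v"
  unfolding prim_def distrib_right
  by (intro interval_lebesgue_integral_add locbdd_mult_interval_integrable assms)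

lemma prim_scale: "prim (\<lambda>w. r * e w) k v = r * prim e k v"
  unfolding prim_def mult.assoc by simp

lemma prim_add_right:
  assumes "locbdd e" "continuous_on UNIV k" "continuous_on UNIV k'"
  shows "prim e (\<lambda>w. k w + k' w) v = prim e k v + prim e k' v"
  unfolding prim_def distrib_left
  by (intro interval_lebesgue_integral_add locbdd_mult_interval_integrable assms)

lemma prim_scale_right: "prim e (\<lambda>w. r * k w) v = r * prim e k v"
proof -
  have "prim e (\<lambda>w. r * k w) v = (LBINT w=ereal 0..ereal v. r * (e w * k w))"
    unfolding prim_def by (simp add: mult.left_commute)
  then show ?thesis by (simp add: prim_def)
qed

lemma prim_sum_right:
  assumes "locbdd e" "finite A" "\<And>i. i \<in> A \<Longrightarrow> continuous_on UNIV (k i)"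
  shows "prim e (\<lambda>w. \<Sum>i\<in>A. k i w) v = (\<Sum>i\<in>A. prim e (k i) v)"
  using assms(2,3)
proof (induction A rule: finite_induct)
  case empty
  then show ?case by (simp add: prim_def)
next
  case (insert i A)
  then show ?case by (simp add: prim_add_right[OF assms(1)] continuous_on_sum)
qed

lemma prim_le:
  assumes "locbdd e" "continuous_on UNIV k" "\<And>w. \<bar>w\<bar> \<le> R \<Longrightarrow> \<bar>e w * k w\<bar> \<le> M" "\<bar>v\<bar> \<le> R"
  shows "\<bar>prim e k v\<bar> \<le> M * R"
proof -
  have "0 \<le> M" using assms(3)[of v] assms(4) abs_ge_zero order_trans by blast
  have "\<bar>prim e k v\<bar> \<le> M * \<bar>v - 0\<bar>" unfolding prim_def
    by (rule interval_integral_norm_le[OF locbdd_mult_interval_integrable[OF assms(1,2)]]) (use assms in auto)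
  also have "\<dots> \<le> M * R" using assms(4) \<open>0 \<le> M\<close> by (intro mult_left_mono) auto
  finally show ?thesis .
qed

lemma prim_diff_le:
  assumes "locbdd e" "continuous_on UNIV k" "\<And>w. w \<in> {min v v'..max v v'} \<Longrightarrow> \<bar>e w * k w\<bar> \<le> M"
  shows "\<bar>prim e k v - prim e k v'\<bar> \<le> M * \<bar>v - v'\<bar>"
proof -
  have "prim e k v = prim e k v' + (LBINT w=ereal v'..ereal v. e w * k w)"
    unfolding prim_def
    by (rule interval_integral_sum[symmetric])
      (unfold ereal_min[symmetric] ereal_max[symmetric], rule locbdd_mult_interval_integrable[OF assms(1,2)])
  moreover have "\<bar>LBINT w=ereal v'..ereal v. e w * k w\<bar> \<le> M * \<bar>v - v'\<bar>"
    by (rule interval_integral_norm_le[OF locbdd_mult_interval_integrable[OF assms(1,2)]]) (use assms(3) in \<open>auto simp: min.commute max.commute\<close>)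
  ultimately show ?thesis by simp
qed

lemma prim_one_FTC:
  assumes "continuous_on UNIV k" "\<And>w. (K has_real_derivative k w) (at w)"
  shows "prim (\<lambda>_. 1) k v = K v - K 0"
proof -
  have "(LBINT w=ereal 0..ereal v. k w) = K v - K 0"
    by (rule interval_integral_FTC_finite)
      (use assms in \<open>auto intro: continuous_on_subset has_vector_derivative_at_within simp: has_real_derivative_iff_has_vector_derivative\<close>)
  then show ?thesis by (simp add: prim_def)
qed

text \<open>For the weight $\mathrm{sgn}(\cdot-c)$ one obtains Kruzhkov's formula up to a term that does not depend on $v$,
  since primitives start at $0$ and Kruzhkov's expressions start at $c$.\<close>

lemma prim_sgn:
  assumes k: "continuous_on UNIV k" and K: "\<And>v. prim (\<lambda>_. 1) k v = K v - K 0"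
  shows "prim (\<lambda>w. sgn (w - c)) k v = sgn (v - c) * (K v - K c) + sgn c * (K 0 - K c)"
proof -
  have ii: "interval_lebesgue_integrable lborel (ereal a) (ereal b) (\<lambda>w. 1 * k w)" for a b
    by (rule locbdd_mult_interval_integrable[OF locbdd_const k])
  have sum: "(LBINT w=ereal a..ereal b. e w * k w) + (LBINT w=ereal b..ereal d. e w * k w) = (LBINT w=ereal a..ereal d. e w * k w)"
    if "locbdd e" for a b d e
    by (rule interval_integral_sum)
      (unfold ereal_min[symmetric] ereal_max[symmetric], rule locbdd_mult_interval_integrable[OF that k])
  have from_c: "(LBINT w=ereal c..ereal v. sgn (w - c) * k w) = sgn (v - c) * (K v - K c)" for v
  proof -
    have "(LBINT w=ereal c..ereal v. sgn (w - c) * k w) = (LBINT w=ereal c..ereal v. sgn (v - c) * (1 * k w))"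
      by (rule interval_integral_cong) (auto simp: einterval_iff min_def max_def split: if_splits)
    also have "\<dots> = sgn (v - c) * (LBINT w=ereal c..ereal v. 1 * k w)" by simp
    also have "(LBINT w=ereal c..ereal v. 1 * k w) = prim (\<lambda>_. 1) k v - prim (\<lambda>_. 1) k c"
      using sum[OF locbdd_const, of 0 c 1 v] by (simp add: prim_def)
    finally show ?thesis by (simp add: K)
  qed
  have "prim (\<lambda>w. sgn (w - c)) k v = (LBINT w=ereal 0..ereal c. sgn (w - c) * k w) + (LBINT w=ereal c..ereal v. sgn (w - c) * k w)"
    unfolding prim_def by (rule sum[OF locbdd_sgn, symmetric])
  also have "(LBINT w=ereal 0..ereal c. sgn (w - c) * k w) = - (LBINT w=ereal c..ereal 0. sgn (w - c) * k w)"
    by (rule interval_integral_endpoints_reverse)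
  finally show ?thesis unfolding from_c by (simp add: sgn_minus)
qed

text \<open>The dependence on $p$ is controlled by uniform continuity of $k$ on compact sets of $w$, that on
  $v$ by boundedness of the integrand. Continuity of $e$ is not available.\<close>

lemma prim_continuous:
  fixes k :: "'p::metric_space \<times> real \<Rightarrow> real"
  assumes e: "locbdd e" and k: "continuous_on (P \<times> UNIV) k"
  shows "continuous_on (P \<times> UNIV) (\<lambda>(p, v). prim e (\<lambda>w. k (p, w)) v)"
  unfolding continuous_on_iff
proof (clarify)
  fix p0 and v0 \<epsilon> :: real assume p0: "p0 \<in> P" and eps: "\<epsilon> > 0"
  have kp: "continuous_on UNIV (\<lambda>w. k (p, w))" if "p \<in> P" for p
    by (rule continuous_on_compose2[OF k]) (use that in \<open>auto intro!: continuous_intros\<close>)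
  define R where "R = \<bar>v0\<bar> + 1"
  obtain B where B: "B \<ge> 0" "\<And>w. w \<in> {-R..R} \<Longrightarrow> \<bar>e w\<bar> \<le> B" using locbdd_bound[OF e] by blast
  obtain M where M0: "M \<ge> 0" and M: "\<And>w. w \<in> {-R..R} \<Longrightarrow> \<bar>k (p0, w)\<bar> \<le> M"
    using continuous_compact_bound[OF continuous_on_subset[OF kp[OF p0] subset_UNIV] compact_Icc] by blast
  define \<eta> where "\<eta> = \<epsilon> / (2 * (B * R + 1))"
  have R: "R > 0" by (simp add: R_def)
  have BR: "B * R \<ge> 0" using B R by simp
  then have \<eta>: "\<eta> > 0" "B * \<eta> * R < \<epsilon> / 2" using eps by (auto simp: \<eta>_def field_simps)
  have kc: "continuous_on (P \<times> {-R..R}) k" by (rule continuous_on_subset[OF k]) auto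
  obtain X0 where X0: "p0 \<in> X0" "open X0" "\<forall>p\<in>X0 \<inter> P. \<forall>w\<in>{-R..R}. dist (k (p, w)) (k (p0, w)) \<le> \<eta>"
    using continuous_on_prod_compactE[OF kc compact_Icc p0 \<eta>(1)] by blast
  obtain d1 where d1: "d1 > 0" "\<And>p. dist p p0 < d1 \<Longrightarrow> p \<in> X0"
    using X0(1,2) unfolding open_dist by blast
  define d2 where "d2 = \<epsilon> / (2 * (B * M + 1))"
  have BM: "B * M \<ge> 0" using B M0 by simp
  have d2: "d2 > 0" "B * M * d2 < \<epsilon> / 2" using eps BM by (auto simp: d2_def field_simps)
  have "dist (prim e (\<lambda>w. k (p, w)) v) (prim e (\<lambda>w. k (p0, w)) v0) < \<epsilon>"
    if p: "p \<in> P" and d: "dist (p, v) (p0, v0) < min 1 (min d1 d2)" for p v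
  proof -
    have dp: "dist p p0 < d1" and dv: "\<bar>v - v0\<bar> < d2" "\<bar>v - v0\<bar> < 1"
      using d dist_fst_le[of "(p, v)" "(p0, v0)"] dist_snd_le[of "(p, v)" "(p0, v0)"] by (auto simp: dist_real_def)
    have vR: "\<bar>v\<bar> \<le> R" "\<bar>v0\<bar> \<le> R" using dv by (auto simp: R_def)
    have 1: "prim e (\<lambda>w. k (p, w)) v = prim e (\<lambda>w. k (p, w) + (-1) * k (p0, w)) v + prim e (\<lambda>w. k (p0, w)) v"
      by (subst prim_add_right[OF e kp[OF p]])
        (auto simp: prim_scale_right[of _ "-1", simplified] intro!: continuous_intros kp p0)
    have 2: "\<bar>prim e (\<lambda>w. k (p, w) + (-1) * k (p0, w)) v\<bar> \<le> (B * \<eta>) * R"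
    proof (rule prim_le[OF e])
      show "continuous_on UNIV (\<lambda>w. k (p, w) + (-1) * k (p0, w))" by (intro continuous_intros kp p p0)
      show "\<bar>e w * (k (p, w) + - 1 * k (p0, w))\<bar> \<le> B * \<eta>" if "\<bar>w\<bar> \<le> R" for w
      proof -
        have w: "w \<in> {-R..R}" using that by auto
        have "dist (k (p, w)) (k (p0, w)) \<le> \<eta>" using X0(3) d1(2)[OF dp] p w by auto
        then show ?thesis unfolding abs_mult using B(2)[OF w] B(1) by (intro mult_mono) (auto simp: dist_real_def)
      qed
    qed (use vR in auto)
    have 3: "\<bar>prim e (\<lambda>w. k (p0, w)) v - prim e (\<lambda>w. k (p0, w)) v0\<bar> \<le> (B * M) * \<bar>v - v0\<bar>"
    proof (rule prim_diff_le[OF e kp[OF p0]])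
      fix w assume "w \<in> {min v v0..max v v0}"
      then have w: "w \<in> {-R..R}" using vR by auto
      show "\<bar>e w * k (p0, w)\<bar> \<le> B * M" unfolding abs_mult using B(2)[OF w] B(1) M[OF w]
        by (intro mult_mono) auto
    qed
    have "(B * M) * \<bar>v - v0\<bar> \<le> B * M * d2" using BM dv(1) by (intro mult_left_mono) auto
    then show ?thesis using 1 2 3 \<eta>(2) d2(2) unfolding dist_real_def by linarith
  qed
  then show "\<exists>d>0. \<forall>x'\<in>P \<times> UNIV. dist x' (p0, v0) < d \<longrightarrow>
     dist (case x' of (p, v) \<Rightarrow> prim e (\<lambda>w. k (p, w)) v) (prim e (\<lambda>w. k (p0, w)) v0) < \<epsilon>"
    using d1(1) d2(1) by (intro exI[of _ "min 1 (min d1 d2)"]) auto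
qed

text \<open>The weight $e$ may be discontinuous, so the estimate is done by hand: by the mean value theorem the
  error of the linear approximation of $k(\cdot,w)$ at $x$ is at most $\eta|y-x|$, uniformly for
  $|w|\le R$, because the gradient is continuous jointly in $(x,w)$.\<close>

lemma prim_has_derivative:
  fixes k :: "real^'n \<Rightarrow> real \<Rightarrow> real" and G :: "real^'n \<Rightarrow> real \<Rightarrow> real^'n"
  assumes e: "locbdd e"
    and der: "\<And>x w. ((\<lambda>y. k y w) has_derivative (\<lambda>h. G x w \<bullet> h)) (at x)"
    and cont: "continuous_on UNIV (\<lambda>(x, w). G x w)"
    and kc: "\<And>x. continuous_on UNIV (k x)"
  shows "((\<lambda>y. prim e (k y) v) has_derivative (\<lambda>h. prim e (\<lambda>w. G x w \<bullet> h) v)) (at x)"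
proof -
  have Gc: "continuous_on UNIV (\<lambda>w. G x w)" for x
  proof -
    have "continuous_on UNIV ((\<lambda>(x, w). G x w) \<circ> (\<lambda>w. (x, w)))"
      by (rule continuous_on_compose) (auto intro!: continuous_intros intro: continuous_on_subset[OF cont])
    then show ?thesis by (simp add: o_def)
  qed
  have Ghc: "continuous_on UNIV (\<lambda>w. G x w \<bullet> h)" for x h by (intro continuous_intros Gc)
  define R where "R = \<bar>v\<bar> + 1"
  have R: "R > 0" "\<bar>v\<bar> \<le> R" by (auto simp: R_def)
  obtain B where B: "B \<ge> 0" "\<And>w. w \<in> {-R..R} \<Longrightarrow> \<bar>e w\<bar> \<le> B" using locbdd_bound[OF e] by blast
  have lin: "linear (\<lambda>h. prim e (\<lambda>w. G x w \<bullet> h) v)"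
    by (rule linearI) (simp_all add: inner_add_right prim_add_right[OF e Ghc Ghc] prim_scale_right)
  show ?thesis
    unfolding has_derivative_at_alt
  proof (intro conjI allI impI)
    show "bounded_linear (\<lambda>h. prim e (\<lambda>w. G x w \<bullet> h) v)" using lin by (simp add: linear_conv_bounded_linear)
    fix \<epsilon> :: real assume eps: "\<epsilon> > 0"
    define \<eta> where "\<eta> = \<epsilon> / (B * R + 1)"
    have BR: "B * R \<ge> 0" using B R by simp
    have \<eta>: "\<eta> > 0" "B * \<eta> * R \<le> \<epsilon>" using eps BR by (auto simp: \<eta>_def field_simps)
    have cc: "continuous_on (UNIV \<times> {-R..R}) (\<lambda>(x, w). G x w)" by (rule continuous_on_subset[OF cont]) auto
    obtain X0 where X0: "x \<in> X0" "open X0" "\<forall>y\<in>X0 \<inter> UNIV. \<forall>w\<in>{-R..R}. dist (G y w) (G x w) \<le> \<eta>"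
      using continuous_on_prod_compactE[OF cc compact_Icc UNIV_I \<eta>(1), of x] by auto
    obtain d where d: "d > 0" "\<And>y. y \<in> ball x d \<Longrightarrow> y \<in> X0"
      using X0(1,2) unfolding open_contains_ball by blast
    have "norm (prim e (k y) v - prim e (k x) v - prim e (\<lambda>w. G x w \<bullet> (y - x)) v) \<le> \<epsilon> * norm (y - x)"
      if y: "norm (y - x) < d" for y
    proof -
      have yb: "y \<in> ball x d" "x \<in> ball x d" using y d(1) by (auto simp: dist_norm norm_minus_commute)
      have pw: "\<bar>k y w - k x w - G x w \<bullet> (y - x)\<bar> \<le> \<eta> * norm (y - x)" if w: "w \<in> {-R..R}" for w
      proof -
        have "norm ((k y w - G x w \<bullet> y) - (k x w - G x w \<bullet> x)) \<le> \<eta> * norm (y - x)"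
        proof (rule differentiable_bound[OF convex_ball _ _ yb])
          fix z assume z: "z \<in> ball x d"
          show "((\<lambda>z. k z w - G x w \<bullet> z) has_derivative (\<lambda>h. G z w \<bullet> h - G x w \<bullet> h)) (at z within ball x d)"
            by (intro derivative_intros has_derivative_at_withinI[OF der] has_derivative_inner_right)
          show "onorm (\<lambda>h. G z w \<bullet> h - G x w \<bullet> h) \<le> \<eta>"
          proof (rule onorm_le)
            fix h
            have "norm (G z w \<bullet> h - G x w \<bullet> h) \<le> norm (G z w - G x w) * norm h"
              by (simp add: inner_diff_left[symmetric] Cauchy_Schwarz_ineq2)
            also have "\<dots> \<le> \<eta> * norm h"
              using X0(3) d(2)[OF z] w by (intro mult_right_mono) (auto simp: dist_norm)
            finally show "norm (G z w \<bullet> h - G x w \<bullet> h) \<le> \<eta> * norm h" .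
          qed
        qed
        then show ?thesis by (simp add: inner_diff_right algebra_simps)
      qed
      have "prim e (k y) v - prim e (k x) v - prim e (\<lambda>w. G x w \<bullet> (y - x)) v
          = prim e (\<lambda>w. (k y w + (-1) * k x w) + (-1) * (G x w \<bullet> (y - x))) v"
        by (subst prim_add_right[OF e], (intro continuous_intros kc Ghc)+)
          (subst prim_add_right[OF e], (intro continuous_intros kc Ghc)+, subst prim_scale_right, subst prim_scale_right, simp)
      moreover have "\<bar>prim e (\<lambda>w. (k y w + (-1) * k x w) + (-1) * (G x w \<bullet> (y - x))) v\<bar> \<le> (B * (\<eta> * norm (y - x))) * R"
      proof (rule prim_le[OF e])
        show "continuous_on UNIV (\<lambda>w. (k y w + (-1) * k x w) + (-1) * (G x w \<bullet> (y - x)))"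
          by (intro continuous_intros kc Ghc)
        fix w assume "\<bar>w\<bar> \<le> R"
        then have w: "w \<in> {-R..R}" by auto
        show "\<bar>e w * (k y w + - 1 * k x w + - 1 * (G x w \<bullet> (y - x)))\<bar> \<le> B * (\<eta> * norm (y - x))"
          unfolding abs_mult using B(2)[OF w] B(1) pw[OF w] by (intro mult_mono) auto
      qed (use R in auto)
      moreover have "(B * (\<eta> * norm (y - x))) * R \<le> \<epsilon> * norm (y - x)"
        using mult_right_mono[OF \<eta>(2), of "norm (y - x)"] by (simp add: mult_ac)
      ultimately show ?thesis by simp
    qed
    then show "\<exists>d>0. \<forall>y. norm (y - x) < d \<longrightarrow>
       norm (prim e (k y) v - prim e (k x) v - prim e (\<lambda>w. G x w \<bullet> (y - x)) v) \<le> \<epsilon> * norm (y - x)"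
      using d(1) by blast
  qed
qed

section \<open>Integral functionals\<close>

text \<open>The properties shared by a test function and its first derivatives. As the support is compact in the
  strip, a test function may be non-zero at $t=0$, but it vanishes near the end of a bounded
  time interval.\<close>

definition cutoff :: "'a::topological_space set \<Rightarrow> ('a \<Rightarrow> real) \<Rightarrow> bool" where
  "cutoff S \<psi> \<longleftrightarrow> continuous_on S \<psi> \<and> (\<exists>K. compact K \<and> K \<subseteq> S \<and> (\<forall>p\<in>S - K. \<psi> p = 0))"

lemma cutoffE:
  assumes "cutoff S \<psi>"
  obtains K B where "compact K" "K \<subseteq> S" "B \<ge> 0" "\<And>p. p \<in> S \<Longrightarrow> \<bar>\<psi> p\<bar> \<le> B * indicator K p"
proof -
  obtain K where K: "compact K" "K \<subseteq> S" "\<forall>p\<in>S - K. \<psi> p = 0" and c: "continuous_on S \<psi>"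
    using assms unfolding cutoff_def by blast
  obtain B where "B \<ge> 0" "\<And>p. p \<in> K \<Longrightarrow> \<bar>\<psi> p\<bar> \<le> B"
    using continuous_compact_bound[OF continuous_on_subset[OF c K(2)] K(1)] by blast
  then show ?thesis using K by (intro that[of K B]) (auto simp: indicator_def)
qed

lemma lebesgue_on_id_borel: "(\<lambda>p::'a::euclidean_space. p) \<in> borel_measurable (lebesgue_on S)"
  by (rule measurable_restrict_space1) (simp add: measurable_completion)

lemma lebesgue_on_compose_continuous:
  fixes k :: "'a::euclidean_space \<times> real \<Rightarrow> real"
  assumes k: "continuous_on (S \<times> UNIV) k" and U: "U \<in> borel_measurable (lebesgue_on S)"
  shows "(\<lambda>p. k (p, U p)) \<in> borel_measurable (lebesgue_on S)"
proof -
  have "(\<lambda>p. (p, U p)) \<in> measurable (lebesgue_on S) (restrict_space borel (S \<times> UNIV))"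
    by (rule measurable_restrict_space2) (auto intro: borel_measurable_Pair lebesgue_on_id_borel U)
  from measurable_compose[OF this borel_measurable_continuous_on_restrict[OF k]] show ?thesis .
qed

lemma lebesgue_on_continuous:
  fixes k :: "'a::euclidean_space \<Rightarrow> real"
  assumes k: "continuous_on S k"
  shows "k \<in> borel_measurable (lebesgue_on S)"
proof -
  have "(\<lambda>p. p) \<in> measurable (lebesgue_on S) (restrict_space borel S)"
    by (rule measurable_restrict_space2) (auto intro: lebesgue_on_id_borel)
  from measurable_compose[OF this borel_measurable_continuous_on_restrict[OF k]] show ?thesis .
qed

lemma lebesgue_on_bounded_integrable:
  fixes h :: "'a::euclidean_space \<Rightarrow> real"
  assumes S: "S \<in> sets borel" and h: "h \<in> borel_measurable (lebesgue_on S)"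
    and K: "compact K" "K \<subseteq> S" and bd: "AE p in lebesgue_on S. \<bar>h p\<bar> \<le> C * indicator K p"
  shows "integrable (lebesgue_on S) h" "\<bar>LINT p|lebesgue_on S. h p\<bar> \<le> C * measure lebesgue K"
proof -
  have S': "S \<inter> space lebesgue \<in> sets lebesgue" using S by simp
  have eq: "(\<lambda>p. indicator S p *\<^sub>R (C * indicator K p)) = (\<lambda>p. C * indicator K p :: real)"
    using K(2) by (auto simp: fun_eq_iff indicator_def)
  have Km: "K \<in> sets lebesgue" "emeasure lebesgue K < \<infinity>"
    using lmeasurable_compact[OF K(1)] by (auto simp: fmeasurable_def)
  have "integrable lebesgue (\<lambda>p. C * indicator K p :: real)"
    using Km by (intro integrable_mult_right integrable_real_indicator)
  then have int: "integrable (lebesgue_on S) (\<lambda>p. C * indicator K p :: real)"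
    unfolding integrable_restrict_space[OF S'] eq .
  show "integrable (lebesgue_on S) h"
    by (rule Bochner_Integration.integrable_bound[OF int h]) (use bd in \<open>auto elim!: eventually_mono\<close>)
  have "\<bar>LINT p|lebesgue_on S. h p\<bar> \<le> (LINT p|lebesgue_on S. \<bar>h p\<bar>)" by (rule integral_abs_bound)
  also have "\<dots> \<le> (LINT p|lebesgue_on S. C * indicator K p)"
    by (rule integral_mono_AE) (use \<open>integrable (lebesgue_on S) h\<close> int bd in auto)
  also have "\<dots> = (LINT p|lebesgue. C * indicator K p)"
    unfolding integral_restrict_space[OF S'] eq ..
  also have "\<dots> = C * measure lebesgue K" using Km by simp
  finally show "\<bar>LINT p|lebesgue_on S. h p\<bar> \<le> C * measure lebesgue K" .
qed

text \<open>Pointwise bounds on compact sets suffice, since \<open>\<psi>\<close> confines the integral to one.\<close>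

lemma bounded_functional_integral:
  fixes T :: "(real \<Rightarrow> real) \<Rightarrow> 'a::euclidean_space \<Rightarrow> real"
  assumes S: "S \<in> sets borel" and \<psi>: "cutoff S \<psi>" and UR: "AE p in lebesgue_on S. \<bar>U p\<bar> \<le> R"
    and meas: "\<And>e. locbdd e \<Longrightarrow> T e \<in> borel_measurable (lebesgue_on S)"
    and add: "\<And>e e' p. locbdd e \<Longrightarrow> locbdd e' \<Longrightarrow> p \<in> S \<Longrightarrow> T (\<lambda>w. e w + e' w) p = T e p + T e' p"
    and scale: "\<And>e r p. T (\<lambda>w. r * e w) p = r * T e p"
    and bd: "\<And>K. compact K \<Longrightarrow> K \<subseteq> S \<Longrightarrow> \<exists>C\<ge>0. \<forall>e \<delta> p. locbdd e \<longrightarrow> 0 \<le> \<delta> \<longrightarrow> (\<forall>w\<in>{-R..R}. \<bar>e w\<bar> \<le> \<delta>) \<longrightarrow>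
        p \<in> K \<longrightarrow> \<bar>U p\<bar> \<le> R \<longrightarrow> \<bar>T e p\<bar> \<le> C * \<delta>"
  shows "\<And>e. locbdd e \<Longrightarrow> integrable (lebesgue_on S) (\<lambda>p. T e p * \<psi> p)"
    and "bounded_functional R (\<lambda>e. LINT p|lebesgue_on S. T e p * \<psi> p)"
proof -
  obtain K B where K: "compact K" "K \<subseteq> S" "B \<ge> 0" "\<And>p. p \<in> S \<Longrightarrow> \<bar>\<psi> p\<bar> \<le> B * indicator K p"
    using cutoffE[OF \<psi>] by blast
  obtain C where C: "C \<ge> 0" "\<forall>e \<delta> p. locbdd e \<longrightarrow> 0 \<le> \<delta> \<longrightarrow> (\<forall>w\<in>{-R..R}. \<bar>e w\<bar> \<le> \<delta>) \<longrightarrow>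
      p \<in> K \<longrightarrow> \<bar>U p\<bar> \<le> R \<longrightarrow> \<bar>T e p\<bar> \<le> C * \<delta>"
    using bd[OF K(1,2)] by blast
  have m: "(\<lambda>p. T e p * \<psi> p) \<in> borel_measurable (lebesgue_on S)" if "locbdd e" for e
    using meas[OF that] lebesgue_on_continuous[of S \<psi>] \<psi> by (auto simp: cutoff_def intro!: borel_measurable_times)
  have ae: "AE p in lebesgue_on S. \<bar>T e p * \<psi> p\<bar> \<le> C * \<delta> * B * indicator K p"
    if e: "locbdd e" "0 \<le> \<delta>" "\<And>w. w \<in> {-R..R} \<Longrightarrow> \<bar>e w\<bar> \<le> \<delta>" for e \<delta>
  proof -
    have "AE p in lebesgue_on S. p \<in> S" by (rule AE_I2) (simp add: space_restrict_space)
    with UR show ?thesis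
    proof eventually_elim
      fix p assume p: "\<bar>U p\<bar> \<le> R" "p \<in> S"
      show "\<bar>T e p * \<psi> p\<bar> \<le> C * \<delta> * B * indicator K p"
      proof (cases "p \<in> K")
        case True
        then have "\<bar>T e p\<bar> \<le> C * \<delta>" using C(2) e p by blast
        then have "\<bar>T e p\<bar> * \<bar>\<psi> p\<bar> \<le> C * \<delta> * B" using K(4)[OF p(2)] True C(1) e(2) by (intro mult_mono) auto
        then show ?thesis using True by (simp add: abs_mult)
      qed (use K(4)[OF p(2)] in simp)
    qed
  qed
  show int: "integrable (lebesgue_on S) (\<lambda>p. T e p * \<psi> p)" if e: "locbdd e" for e
  proof -
    obtain \<delta> where "\<delta> \<ge> 0" "\<And>w. w \<in> {-R..R} \<Longrightarrow> \<bar>e w\<bar> \<le> \<delta>" using locbdd_bound[OF e] by blast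
    from lebesgue_on_bounded_integrable(1)[OF S m[OF e] K(1,2) ae[OF e this]] show ?thesis .
  qed
  have cong: "(LINT p|lebesgue_on S. h p) = (LINT p|lebesgue_on S. h' p)"
    if "\<And>p. p \<in> S \<Longrightarrow> h p = h' p" for h h' :: "'a \<Rightarrow> real"
    by (rule Bochner_Integration.integral_cong) (auto simp: space_restrict_space that)
  show "bounded_functional R (\<lambda>e. LINT p|lebesgue_on S. T e p * \<psi> p)"
  proof (rule bounded_functionalI[where C="C * B * measure lebesgue K"])
    show "(LINT p|lebesgue_on S. T (\<lambda>w. e w + e' w) p * \<psi> p) =
        (LINT p|lebesgue_on S. T e p * \<psi> p) + (LINT p|lebesgue_on S. T e' p * \<psi> p)"
      if e: "locbdd e" "locbdd e'" for e e'
    proof -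
      have "(LINT p|lebesgue_on S. T (\<lambda>w. e w + e' w) p * \<psi> p) = (LINT p|lebesgue_on S. T e p * \<psi> p + T e' p * \<psi> p)"
        by (rule cong) (simp add: add[OF e] distrib_right)
      then show ?thesis using int e by simp
    qed
    show "(LINT p|lebesgue_on S. T (\<lambda>w. r * e w) p * \<psi> p) = r * (LINT p|lebesgue_on S. T e p * \<psi> p)" for e r
      by (simp add: scale mult.assoc)
    show "C * B * measure lebesgue K \<ge> 0" using C(1) K(3) by simp
    show "\<bar>LINT p|lebesgue_on S. T e p * \<psi> p\<bar> \<le> C * B * measure lebesgue K * \<delta>"
      if "locbdd e" "0 \<le> \<delta>" "\<And>w. w \<in> {-R..R} \<Longrightarrow> \<bar>e w\<bar> \<le> \<delta>" for e \<delta>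
      using lebesgue_on_bounded_integrable(2)[OF S m[OF that(1)] K(1,2) ae[OF that]] by (simp add: mult_ac)
  qed
qed

lemma slice_continuous:
  assumes "continuous_on (S \<times> UNIV) k" "p \<in> S"
  shows "continuous_on UNIV (\<lambda>w. k (p, w))"
  by (rule continuous_on_compose2[OF assms(1)]) (use assms(2) in \<open>auto intro!: continuous_intros\<close>)

lemma coefficient_bound:
  fixes k :: "'a::euclidean_space \<times> real \<Rightarrow> real"
  assumes k: "continuous_on (S \<times> UNIV) k" and K: "compact K" "K \<subseteq> S"
  obtains M where "M \<ge> 0" "\<And>p w. p \<in> K \<Longrightarrow> \<bar>w\<bar> \<le> R \<Longrightarrow> \<bar>k (p, w)\<bar> \<le> M"
proof -
  have "compact (K \<times> {-R..R})" "K \<times> {-R..R} \<subseteq> S \<times> UNIV" using K by (auto intro: compact_Times)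
  then obtain M where "M \<ge> 0" "\<And>q. q \<in> K \<times> {-R..R} \<Longrightarrow> \<bar>k q\<bar> \<le> M"
    using continuous_compact_bound[OF continuous_on_subset[OF k]] by blast
  then show ?thesis by (intro that[of M]) (auto simp: abs_le_iff)
qed

lemma prim_functional:
  fixes k :: "'a::euclidean_space \<times> real \<Rightarrow> real"
  assumes S: "S \<in> sets borel" and k: "continuous_on (S \<times> UNIV) k" and \<psi>: "cutoff S \<psi>"
    and U: "U \<in> borel_measurable (lebesgue_on S)" and UR: "AE p in lebesgue_on S. \<bar>U p\<bar> \<le> R" and R: "R \<ge> 0"
  shows "\<And>e. locbdd e \<Longrightarrow> integrable (lebesgue_on S) (\<lambda>p. prim e (\<lambda>w. k (p, w)) (U p) * \<psi> p)"
    and "bounded_functional R (\<lambda>e. LINT p|lebesgue_on S. prim e (\<lambda>w. k (p, w)) (U p) * \<psi> p)"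
proof -
  define T where "T e p = prim e (\<lambda>w. k (p, w)) (U p)" for e p
  have m: "T e \<in> borel_measurable (lebesgue_on S)" if "locbdd e" for e
    unfolding T_def using lebesgue_on_compose_continuous[OF prim_continuous[OF that k] U] by simp
  have a: "T (\<lambda>w. e w + e' w) p = T e p + T e' p" if "locbdd e" "locbdd e'" "p \<in> S" for e e' p
    unfolding T_def by (rule prim_add[OF that(1,2) slice_continuous[OF k that(3)]])
  have s: "T (\<lambda>w. r * e w) p = r * T e p" for r e p by (simp add: T_def prim_scale)
  have b: "\<exists>C\<ge>0. \<forall>e \<delta> p. locbdd e \<longrightarrow> 0 \<le> \<delta> \<longrightarrow> (\<forall>w\<in>{-R..R}. \<bar>e w\<bar> \<le> \<delta>) \<longrightarrow>
      p \<in> K \<longrightarrow> \<bar>U p\<bar> \<le> R \<longrightarrow> \<bar>T e p\<bar> \<le> C * \<delta>" if K: "compact K" "K \<subseteq> S" for K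
  proof -
    obtain M where M: "M \<ge> 0" "\<And>p w. p \<in> K \<Longrightarrow> \<bar>w\<bar> \<le> R \<Longrightarrow> \<bar>k (p, w)\<bar> \<le> M"
      using coefficient_bound[OF k K] by blast
    have "\<bar>T e p\<bar> \<le> M * R * \<delta>"
      if e: "locbdd e" "0 \<le> \<delta>" "\<forall>w\<in>{-R..R}. \<bar>e w\<bar> \<le> \<delta>" and p: "p \<in> K" "\<bar>U p\<bar> \<le> R" for e \<delta> p
    proof -
      have "\<bar>T e p\<bar> \<le> (\<delta> * M) * R" unfolding T_def
      proof (rule prim_le[OF e(1) slice_continuous[OF k subsetD[OF K(2) p(1)]] _ p(2)])
        show "\<bar>e w * k (p, w)\<bar> \<le> \<delta> * M" if "\<bar>w\<bar> \<le> R" for w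
          unfolding abs_mult using e(2,3) M p(1) that by (intro mult_mono) (auto simp: abs_le_iff)
      qed
      then show ?thesis by (simp add: mult_ac)
    qed
    then show ?thesis using M(1) R by (intro exI[of _ "M * R"]) auto
  qed
  show "integrable (lebesgue_on S) (\<lambda>p. prim e (\<lambda>w. k (p, w)) (U p) * \<psi> p)" if "locbdd e" for e
    using bounded_functional_integral(1)[OF S \<psi> UR m a s b that] unfolding T_def .
  show "bounded_functional R (\<lambda>e. LINT p|lebesgue_on S. prim e (\<lambda>w. k (p, w)) (U p) * \<psi> p)"
    using bounded_functional_integral(2)[OF S \<psi> UR m a s b] unfolding T_def .
qed

lemma eval_functional:
  fixes k :: "'a::euclidean_space \<times> real \<Rightarrow> real"
  assumes S: "S \<in> sets borel" and k: "continuous_on (S \<times> UNIV) k" and \<psi>: "cutoff S \<psi>"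
    and U: "U \<in> borel_measurable (lebesgue_on S)" and UR: "AE p in lebesgue_on S. \<bar>U p\<bar> \<le> R"
  shows "\<And>e. locbdd e \<Longrightarrow> integrable (lebesgue_on S) (\<lambda>p. e (U p) * k (p, U p) * \<psi> p)"
    and "bounded_functional R (\<lambda>e. LINT p|lebesgue_on S. e (U p) * k (p, U p) * \<psi> p)"
proof -
  define T where "T e p = e (U p) * k (p, U p)" for e :: "real \<Rightarrow> real" and p
  have m: "T e \<in> borel_measurable (lebesgue_on S)" if "locbdd e" for e
    unfolding T_def using lebesgue_on_compose_continuous[OF k U] measurable_compose[OF U locbdd_borel[OF that]]
    by (rule borel_measurable_times[rotated])
  have a: "T (\<lambda>w. e w + e' w) p = T e p + T e' p" for e e' p by (simp add: T_def distrib_right)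
  have s: "T (\<lambda>w. r * e w) p = r * T e p" for r e p by (simp add: T_def)
  have b: "\<exists>C\<ge>0. \<forall>e \<delta> p. locbdd e \<longrightarrow> 0 \<le> \<delta> \<longrightarrow> (\<forall>w\<in>{-R..R}. \<bar>e w\<bar> \<le> \<delta>) \<longrightarrow>
      p \<in> K \<longrightarrow> \<bar>U p\<bar> \<le> R \<longrightarrow> \<bar>T e p\<bar> \<le> C * \<delta>" if K: "compact K" "K \<subseteq> S" for K
  proof -
    obtain M where M: "M \<ge> 0" "\<And>p w. p \<in> K \<Longrightarrow> \<bar>w\<bar> \<le> R \<Longrightarrow> \<bar>k (p, w)\<bar> \<le> M"
      using coefficient_bound[OF k K] by blast
    have "\<bar>T e p\<bar> \<le> M * \<delta>"
      if "0 \<le> \<delta>" "\<forall>w\<in>{-R..R}. \<bar>e w\<bar> \<le> \<delta>" "p \<in> K" "\<bar>U p\<bar> \<le> R" for e \<delta> p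
      unfolding T_def abs_mult mult.commute[of M] using that M by (intro mult_mono) (auto simp: abs_le_iff)
    then show ?thesis using M(1) by blast
  qed
  show "integrable (lebesgue_on S) (\<lambda>p. e (U p) * k (p, U p) * \<psi> p)" if "locbdd e" for e
    using bounded_functional_integral(1)[OF S \<psi> UR m a s b that] unfolding T_def .
  show "bounded_functional R (\<lambda>e. LINT p|lebesgue_on S. e (U p) * k (p, U p) * \<psi> p)"
    using bounded_functional_integral(2)[OF S \<psi> UR m a s b] unfolding T_def .
qed

section \<open>Time intervals and test functions\<close>

definition time_interval :: "real set \<Rightarrow> bool" where
  "time_interval I \<longleftrightarrow> I = {0..} \<or> (\<exists>T>0. I = {0..<T})"

lemma time_interval_borel: "time_interval I \<Longrightarrow> I \<in> sets borel"
  by (auto simp: time_interval_def)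

lemma time_interval_zero: "time_interval I \<Longrightarrow> 0 \<in> I"
  by (auto simp: time_interval_def)

lemma time_interval_nonneg: "time_interval I \<Longrightarrow> t \<in> I \<Longrightarrow> 0 \<le> t"
  by (auto simp: time_interval_def)

lemma time_interval_down: "time_interval I \<Longrightarrow> t \<in> I \<Longrightarrow> {0..t} \<subseteq> I"
  by (auto simp: time_interval_def)

lemma time_interval_above: "time_interval I \<Longrightarrow> t \<in> I \<Longrightarrow> \<exists>b\<in>I. t < b"
proof -
  assume "time_interval I" "t \<in> I"
  then consider "I = {0..}" | T where "I = {0..<T}" by (auto simp: time_interval_def)
  then show ?thesis
  proof cases
    case 1 then show ?thesis using \<open>t \<in> I\<close> by (intro bexI[of _ "t+1"]) auto
  next
    case 2
    then show ?thesis using \<open>t \<in> I\<close> by (intro bexI[of _ "(t+T)/2"]) auto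
  qed
qed

lemma time_interval_at_within:
  assumes "time_interval I" "t \<in> I"
  shows "at t within I \<noteq> bot"
proof -
  obtain b where b: "b \<in> I" "t < b" using time_interval_above[OF assms] by blast
  have "t \<ge> 0" using time_interval_nonneg[OF assms] .
  have "{t<..<b} \<subseteq> I" using time_interval_down[OF assms(1) b(1)] \<open>t \<ge> 0\<close> by auto
  moreover have "t islimpt {t<..<b}" using b(2) by (simp add: islimpt_greaterThanLessThan1)
  ultimately have "t islimpt I" using islimpt_subset by blast
  then show ?thesis by (simp add: trivial_limit_within)
qed

lemma time_interval_compact_bound:
  assumes "time_interval I" "compact C" "C \<subseteq> I"
  obtains b where "b \<in> I" "\<And>t. t \<in> C \<Longrightarrow> t < b"
proof (cases "C = {}")
  case True
  then show ?thesis using that time_interval_zero[OF assms(1)] by auto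
next
  case False
  obtain m where "m \<in> C" "\<forall>t\<in>C. t \<le> m" using compact_attains_sup[OF assms(2) False] by blast
  moreover obtain b where "b \<in> I" "m < b" using time_interval_above[OF assms(1)] \<open>m \<in> C\<close> assms(3) by blast
  ultimately show ?thesis by (intro that[of b]) auto
qed

lemma strip_borel:
  assumes "time_interval I"
  shows "I \<times> (UNIV :: (real^'n) set) \<in> sets borel"
  using time_interval_borel[OF assms] by (metis borel_prod pair_measureI sets.top space_borel)

lemma has_derivative_vecI:
  fixes f :: "'a::real_normed_vector \<Rightarrow> real^'n"
  assumes "\<And>i. ((\<lambda>x. f x $ i) has_derivative (\<lambda>h. f' h $ i)) (at a within S)"
  shows "(f has_derivative f') (at a within S)"
  unfolding has_derivative_componentwise_within[of f f']
  using assms by (auto simp: Basis_vec_def inner_axis)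

lemma grad_eq:
  assumes "(h has_derivative D) (at x)"
  shows "grad h x \<bullet> k = D k" "(h has_derivative (\<lambda>k. grad h x \<bullet> k)) (at x)"
proof -
  have lin: "linear D" using assms by (rule has_derivative_linear)
  have g: "grad h x $ i = D (axis i 1)" for i
    unfolding grad_def using frechet_derivative_at[OF assms] by simp
  have *: "grad h x \<bullet> k = D k" for k
  proof -
    have "D k = D (\<Sum>i\<in>UNIV. k $ i *\<^sub>R axis i 1)" using basis_expansion[of k] by (simp add: scalar_mult_eq_scaleR)
    also have "\<dots> = (\<Sum>i\<in>UNIV. k $ i * D (axis i 1))" by (simp add: linear_sum[OF lin] linear_scale[OF lin])
    also have "\<dots> = grad h x \<bullet> k" by (simp add: inner_vec_def g mult.commute)
    finally show ?thesis ..
  qed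
  show "grad h x \<bullet> k = D k" by (rule *)
  show "(h has_derivative (\<lambda>k. grad h x \<bullet> k)) (at x)" unfolding * using assms .
qed

lemma grad_nth:
  assumes "(h has_derivative D) (at x)"
  shows "grad h x $ i = D (axis i 1)"
  using grad_eq(1)[OF assms, of "axis i 1"] by (simp add: inner_axis)

lemma dvg_eq:
  assumes "\<And>i. ((\<lambda>y. h y $ i) has_derivative (\<lambda>k. G i \<bullet> k)) (at x)"
  shows "dvg h x = (\<Sum>i\<in>UNIV. G i $ i)"
proof -
  have "(h has_derivative (\<lambda>k. \<chi> i. G i \<bullet> k)) (at x)"
    by (rule has_derivative_vecI) (simp add: assms)
  then have "frechet_derivative h (at x) = (\<lambda>k. \<chi> i. G i \<bullet> k)" by (rule frechet_derivative_at[symmetric])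
  then show ?thesis unfolding dvg_def jacobian_def trace_def matrix_def by (simp add: inner_axis)
qed

lemma Ck_on_1:
  "Ck_on 1 S f \<longleftrightarrow> (\<exists>f'. (\<forall>p\<in>S. (f has_derivative f' p) (at p within S)) \<and> (\<forall>v. continuous_on S (\<lambda>p. f' p v)))"
  unfolding One_nat_def by simp

lemma test_functions_C1c: "\<phi> \<in> test_functions I \<Longrightarrow> \<phi> \<in> C1c I"
  unfolding test_functions_def C1c_def by blast

lemma has_derivative_slice:
  assumes "(f has_derivative D) (at (c s) within S)" "(c has_derivative c') (at s within T)" "c ` T \<subseteq> S"
  shows "((\<lambda>s. f (c s)) has_derivative (\<lambda>h. D (c' h))) (at s within T)"
  using has_derivative_in_compose[OF assms(2) has_derivative_subset[OF assms(1,3)]] .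

lemma C1c_derivatives:
  fixes \<phi> :: "real \<Rightarrow> real^'n \<Rightarrow> real"
  assumes I: "time_interval I" and t: "t \<in> I"
    and der: "((\<lambda>(t, x). \<phi> t x) has_derivative D) (at (t, x) within I \<times> UNIV)"
  shows "((\<lambda>s. \<phi> s x) has_vector_derivative d_t I \<phi> t x) (at t within I)"
    "d_t I \<phi> t x = D (1, 0)"
    "(\<phi> t has_derivative (\<lambda>k. grad (\<phi> t) x \<bullet> k)) (at x)"
    "grad (\<phi> t) x $ i = D (0, axis i 1)"
proof -
  have lin: "linear D" using der by (rule has_derivative_linear)
  have vd: "((\<lambda>s. \<phi> s x) has_derivative (\<lambda>h. D (h, 0))) (at t within I)"
  proof -
    have c: "((\<lambda>s. (s, x)) has_derivative (\<lambda>h. (h, 0))) (at t within I)"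
      by (intro derivative_eq_intros) auto
    have "(\<lambda>s. (s, x)) ` I \<subseteq> I \<times> UNIV" by auto
    from has_derivative_slice[OF der c this] show ?thesis by simp
  qed
  have De: "(\<lambda>h. D (h, 0)) = (\<lambda>h. h *\<^sub>R D (1, 0))"
  proof
    show "D (h, 0) = h *\<^sub>R D (1, 0)" for h using linear_scale[OF lin, of h "(1, 0)"] by simp
  qed
  have v: "((\<lambda>s. \<phi> s x) has_vector_derivative D (1, 0)) (at t within I)"
    using vd unfolding has_vector_derivative_def De .
  then show eq: "d_t I \<phi> t x = D (1, 0)"
    unfolding d_t_def using vector_derivative_within[OF time_interval_at_within[OF I t]] by blast
  then show "((\<lambda>s. \<phi> s x) has_vector_derivative d_t I \<phi> t x) (at t within I)" using v by simp
  have "(\<phi> t has_derivative (\<lambda>h. D (0, h))) (at x)"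
  proof -
    have c: "((\<lambda>y. (t, y)) has_derivative (\<lambda>h. (0, h))) (at x)"
      by (intro derivative_eq_intros) auto
    have "range (\<lambda>y. (t, y)) \<subseteq> I \<times> UNIV" using t by auto
    from has_derivative_slice[OF der c this] show ?thesis by simp
  qed
  from grad_eq(2)[OF this] grad_nth[OF this]
  show "(\<phi> t has_derivative (\<lambda>k. grad (\<phi> t) x \<bullet> k)) (at x)" "grad (\<phi> t) x $ i = D (0, axis i 1)" by auto
qed

lemma C1c_properties:
  fixes \<phi> :: "real \<Rightarrow> real^'n \<Rightarrow> real"
  assumes I: "time_interval I" and \<phi>: "\<phi> \<in> C1c I"
  shows "cutoff (I \<times> UNIV) (\<lambda>p. \<phi> (fst p) (snd p))"
    "cutoff (I \<times> UNIV) (\<lambda>p. d_t I \<phi> (fst p) (snd p))"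
    "cutoff (I \<times> UNIV) (\<lambda>p. grad (\<phi> (fst p)) (snd p) $ i)"
    "\<And>t x. t \<in> I \<Longrightarrow> ((\<lambda>s. \<phi> s x) has_vector_derivative d_t I \<phi> t x) (at t within I)"
    "\<And>t x. t \<in> I \<Longrightarrow> (\<phi> t has_derivative (\<lambda>k. grad (\<phi> t) x \<bullet> k)) (at x)"
proof -
  let ?S = "I \<times> (UNIV :: (real^'n) set)"
  obtain D where D: "\<And>p. p \<in> ?S \<Longrightarrow> ((\<lambda>(t, x). \<phi> t x) has_derivative D p) (at p within ?S)"
    and Dc: "\<And>v. continuous_on ?S (\<lambda>p. D p v)"
    using \<phi> unfolding C1c_def Ck_on_1 by blast
  have D': "((\<lambda>(t, x). \<phi> t x) has_derivative D (t, x)) (at (t, x) within ?S)" if "t \<in> I" for t x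
    using D that by simp
  note d = C1c_derivatives[OF I _ D']
  show 4: "((\<lambda>s. \<phi> s x) has_vector_derivative d_t I \<phi> t x) (at t within I)" if "t \<in> I" for t x using d(1) that by blast
  show 5: "(\<phi> t has_derivative (\<lambda>k. grad (\<phi> t) x \<bullet> k)) (at x)" if "t \<in> I" for t x using d(3) that by blast
  define A where "A = {p \<in> ?S. (\<lambda>(t, x). \<phi> t x) p \<noteq> 0}"
  define K where "K = ?S \<inter> closure A"
  have K: "compact K" "K \<subseteq> ?S" using \<phi> by (auto simp: C1c_def compactly_supported_on_def K_def A_def)
  have zero: "\<phi> t x = 0 \<and> d_t I \<phi> t x = 0 \<and> grad (\<phi> t) x $ i = 0" if p: "(t, x) \<in> ?S - K" for t x i
  proof -
    have t: "t \<in> I" using p by auto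
    have "open (- closure A)" "(t, x) \<in> - closure A" using p by (auto simp: K_def)
    then obtain r where r: "r > 0" "ball (t, x) r \<subseteq> - closure A"
      by (meson open_contains_ball)
    have z: "\<phi> s y = 0" if "s \<in> I" "dist (t, x) (s, y) < r" for s y
    proof -
      have "(s, y) \<notin> closure A" using r(2) that(2) by auto
      then have "(s, y) \<notin> A" using subsetD[OF closure_subset[of A]] by metis
      then show ?thesis using that(1) by (simp add: A_def)
    qed
    have "((\<lambda>s. \<phi> s x) has_derivative (\<lambda>h. 0)) (at t within I)"
      by (rule has_derivative_transform_within[OF has_derivative_const[of 0] r(1) t]) (use z in \<open>auto simp: dist_Pair_Pair dist_commute\<close>)
    then have "((\<lambda>s. \<phi> s x) has_vector_derivative 0) (at t within I)" by (simp add: has_vector_derivative_def)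
    then have "d_t I \<phi> t x = 0"
      unfolding d_t_def using vector_derivative_within[OF time_interval_at_within[OF I t]] by blast
    moreover have "(\<phi> t has_derivative (\<lambda>h. 0)) (at x)"
      by (rule has_derivative_transform_within[OF has_derivative_const[of 0] r(1) UNIV_I]) (use z t in \<open>auto simp: dist_Pair_Pair dist_commute\<close>)
    then have "grad (\<phi> t) x $ i = 0" by (rule grad_nth)
    moreover have "\<phi> t x = 0" using z[OF t, of x] r(1) by simp
    ultimately show ?thesis by simp
  qed
  have "continuous_on ?S (\<lambda>(t, x). \<phi> t x)" using D by (rule has_derivative_continuous_on)
  then show "cutoff ?S (\<lambda>p. \<phi> (fst p) (snd p))"
    unfolding cutoff_def using K zero by (intro conjI exI[of _ K]) (auto simp: split_def)
  have "continuous_on ?S (\<lambda>p. d_t I \<phi> (fst p) (snd p))"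
    by (rule continuous_on_eq[OF Dc[of "(1, 0)"]]) (use d(2) in auto)
  then show "cutoff ?S (\<lambda>p. d_t I \<phi> (fst p) (snd p))"
    unfolding cutoff_def using K zero by (intro conjI exI[of _ K]) auto
  have "continuous_on ?S (\<lambda>p. grad (\<phi> (fst p)) (snd p) $ i)"
    by (rule continuous_on_eq[OF Dc[of "(0, axis i 1)"]]) (use d(4) in auto)
  then show "cutoff ?S (\<lambda>p. grad (\<phi> (fst p)) (snd p) $ i)"
    unfolding cutoff_def using K zero by (intro conjI exI[of _ K]) auto
qed

lemma cutoff_support:
  assumes "cutoff S \<psi>"
  obtains K where "compact K" "K \<subseteq> S" "\<forall>p\<in>S - K. \<psi> p = 0"
  using assms unfolding cutoff_def by blast

lemma cutoff_integrable:
  fixes \<psi> :: "'a::euclidean_space \<Rightarrow> real"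
  assumes S: "S \<in> sets borel" and \<psi>: "cutoff S \<psi>"
  shows "integrable (lebesgue_on S) \<psi>"
proof -
  obtain K B where K: "compact K" "K \<subseteq> S" "B \<ge> 0" "\<And>p. p \<in> S \<Longrightarrow> \<bar>\<psi> p\<bar> \<le> B * indicator K p"
    using cutoffE[OF \<psi>] by blast
  show ?thesis
    by (rule lebesgue_on_bounded_integrable(1)[OF S lebesgue_on_continuous K(1,2)])
      (use \<psi> K(4) in \<open>auto simp: cutoff_def space_restrict_space intro!: AE_I2\<close>)
qed

lemma cutoff_mult:
  assumes "cutoff S \<psi>" "continuous_on S v"
  shows "cutoff S (\<lambda>p. v p * \<psi> p)"
  using assms unfolding cutoff_def by (fastforce intro: continuous_on_mult)

text \<open>Integration in time comes first here, whereas \<open>int_strip\<close> integrates in space first;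
  the product theorem is used for the Borel function obtained by extending $\partial_t\varphi$
  by zero.\<close>

lemma integral_time_derivative:
  fixes \<phi> :: "real \<Rightarrow> real^'n \<Rightarrow> real"
  assumes I: "time_interval I" and \<phi>: "\<phi> \<in> C1c I"
  shows "(LINT p|strip_measure I. d_t I \<phi> (fst p) (snd p)) = - (LINT x|lebesgue. \<phi> 0 x)"
proof -
  let ?S = "I \<times> (UNIV :: (real^'n) set)"
  let ?H = "\<lambda>p. indicator ?S p * d_t I \<phi> (fst p) (snd p)"
  note pr = C1c_properties[OF I \<phi>]
  have S: "?S \<in> sets borel" by (rule strip_borel[OF I])
  then have S': "?S \<inter> space lebesgue \<in> sets lebesgue" by simp
  have Hb: "?H \<in> borel_measurable borel"
    using borel_measurable_continuous_on_indicator[OF S, of "\<lambda>p. d_t I \<phi> (fst p) (snd p)"] pr(2)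
    by (simp add: cutoff_def)
  have "integrable lebesgue ?H"
    using cutoff_integrable[OF S pr(2)] unfolding integrable_restrict_space[OF S'] by simp
  then have Hi: "integrable lborel ?H" using Hb by (simp add: integrable_completion)
  obtain K where K: "compact K" "K \<subseteq> ?S" "\<forall>p\<in>?S - K. \<phi> (fst p) (snd p) = 0"
    by (rule cutoff_support[OF pr(1)])
  obtain K' where K': "compact K'" "K' \<subseteq> ?S" "\<forall>p\<in>?S - K'. d_t I \<phi> (fst p) (snd p) = 0"
    by (rule cutoff_support[OF pr(2)])
  have "compact (fst ` (K \<union> K'))" using K K' by (intro compact_continuous_image compact_Un continuous_intros)
  moreover have "fst ` (K \<union> K') \<subseteq> I" using K K' by auto
  ultimately obtain b where b: "b \<in> I" "\<And>t. t \<in> fst ` (K \<union> K') \<Longrightarrow> t < b"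
    using time_interval_compact_bound[OF I] by blast
  have b0: "0 \<le> b" using time_interval_nonneg[OF I b(1)] .
  have sub: "{0..b} \<subseteq> I" by (rule time_interval_down[OF I b(1)])
  have inner: "(LINT t|lborel. ?H (t, x)) = - \<phi> 0 x" for x
  proof -
    have ftc: "((\<lambda>t. d_t I \<phi> t x) has_integral (\<phi> b x - \<phi> 0 x)) {0..b}"
      by (rule fundamental_theorem_of_calculus[OF b0])
        (rule has_vector_derivative_within_subset[OF pr(4) sub], use sub in auto)
    have "continuous_on {0..b} ((\<lambda>p. d_t I \<phi> (fst p) (snd p)) \<circ> (\<lambda>t. (t, x)))"
    proof (rule continuous_on_compose)
      show "continuous_on ((\<lambda>t. (t, x)) ` {0..b}) (\<lambda>p. d_t I \<phi> (fst p) (snd p))"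
        by (rule continuous_on_subset[of ?S]) (use pr(2) sub in \<open>auto simp: cutoff_def\<close>)
    qed (auto intro!: continuous_intros)
    then have cont: "continuous_on {0..b} (\<lambda>t. d_t I \<phi> t x)" by (simp add: o_def)
    then have si: "set_integrable lborel {0..b} (\<lambda>t. d_t I \<phi> t x)"
      unfolding set_integrable_def by (intro borel_integrable_compact) auto
    have eq: "?H (t, x) = indicator {0..b} t *\<^sub>R d_t I \<phi> t x" for t
    proof (cases "t \<in> {0..b}")
      case True
      then show ?thesis using sub by (auto simp: indicator_def)
    next
      case False
      show ?thesis
      proof (cases "t \<in> I")
        case True
        then have "t > b" using False time_interval_nonneg[OF I True] by auto
        then have "(t, x) \<notin> K'" using b(2) by fastforce
        then have "d_t I \<phi> t x = 0" using bspec[OF K'(3), of "(t, x)"] True by simp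
        then show ?thesis by simp
      next
        case False
        then show ?thesis using \<open>t \<notin> {0..b}\<close> by simp
      qed
    qed
    have "(LINT t|lborel. ?H (t, x)) = (LINT t:{0..b}|lborel. d_t I \<phi> t x)"
      unfolding eq set_lebesgue_integral_def ..
    also have "\<dots> = \<phi> b x - \<phi> 0 x"
      using set_borel_integral_eq_integral(2)[OF si] integral_unique[OF ftc] by simp
    also have "\<phi> b x = 0"
    proof -
      have "(b, x) \<notin> K" using b(2) by fastforce
      then show ?thesis using bspec[OF K(3), of "(b, x)"] b(1) by simp
    qed
    finally show ?thesis by simp
  qed
  have "continuous_on UNIV (\<phi> 0)"
    using pr(5)[OF time_interval_zero[OF I]] by (meson has_derivative_continuous_on has_derivative_at_withinI)
  then have m0: "\<phi> 0 \<in> borel_measurable lborel" by (simp add: borel_measurable_continuous_onI)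
  have "(LINT p|strip_measure I. d_t I \<phi> (fst p) (snd p)) = (LINT p|lebesgue. ?H p)"
    unfolding strip_measure_def integral_restrict_space[OF S'] by simp
  also have "\<dots> = (LINT p|lborel. ?H p)" using Hb by (simp add: integral_completion)
  also have "\<dots> = (LINT p|(lborel \<Otimes>\<^sub>M lborel). ?H p)" by (simp add: lborel_prod)
  also have "\<dots> = (LINT x|lborel. LINT t|lborel. ?H (t, x))"
    using lborel_pair.integral_snd[of "\<lambda>t x. ?H (t, x)"] Hi by (simp add: lborel_prod split_def)
  also have "\<dots> = - (LINT x|lborel. \<phi> 0 x)" unfolding inner by simp
  also have "(LINT x|lborel. \<phi> 0 x) = (LINT x|lebesgue. \<phi> 0 x)" by (rule integral_completion[OF m0, symmetric])
  finally show ?thesis .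
qed

text \<open>For each time the integrand is the $i$th partial derivative of $v\varphi$.\<close>

lemma integral_space_derivative:
  fixes \<phi> :: "real \<Rightarrow> real^'n \<Rightarrow> real" and v :: "real \<times> (real^'n) \<Rightarrow> real" and w :: "real \<times> (real^'n) \<Rightarrow> real^'n"
  assumes I: "time_interval I" and \<phi>: "\<phi> \<in> C1c I"
    and v: "continuous_on (I \<times> UNIV) v" and w: "continuous_on (I \<times> UNIV) (\<lambda>p. w p $ i)"
    and der: "\<And>t x. t \<in> I \<Longrightarrow> ((\<lambda>y. v (t, y)) has_derivative (\<lambda>h. w (t, x) \<bullet> h)) (at x)"
  shows "(LINT p|strip_measure I. v p * grad (\<phi> (fst p)) (snd p) $ i + w p $ i * \<phi> (fst p) (snd p)) = 0"
proof -
  let ?S = "I \<times> (UNIV :: (real^'n) set)"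
  let ?g = "\<lambda>p. v p * grad (\<phi> (fst p)) (snd p) $ i + w p $ i * \<phi> (fst p) (snd p)"
  note pr = C1c_properties[OF I \<phi>]
  have S: "?S \<in> sets borel" by (rule strip_borel[OF I])
  have int: "integrable (strip_measure I) ?g"
    unfolding strip_measure_def
    by (intro Bochner_Integration.integrable_add cutoff_integrable[OF S] cutoff_mult pr v w)
  have slice: "continuous_on UNIV (\<lambda>x. k (t, x))" if "t \<in> I" "continuous_on ?S k" for t and k :: "real \<times> (real^'n) \<Rightarrow> real"
    by (rule continuous_on_compose2[OF that(2)]) (use that(1) in \<open>auto intro!: continuous_intros\<close>)
  have inner: "(LINT x|lebesgue. ?g (t, x)) = 0" if t: "t \<in> I" for t
  proof -
    let ?h' = "\<lambda>x k. v (t, x) * (grad (\<phi> t) x \<bullet> k) + (w (t, x) \<bullet> k) * \<phi> t x"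
    obtain K where K: "compact K" "K \<subseteq> ?S" "\<forall>p\<in>?S - K. \<phi> (fst p) (snd p) = 0"
      by (rule cutoff_support[OF pr(1)])
    have gc: "continuous_on UNIV (\<lambda>x. ?g (t, x))"
      using slice[OF t v] slice[OF t w] slice[OF t, of "\<lambda>p. \<phi> (fst p) (snd p)"] slice[OF t, of "\<lambda>p. grad (\<phi> (fst p)) (snd p) $ i"] pr(1) pr(3)[of i]
      by (auto simp: cutoff_def intro!: continuous_intros)
    have eq: "?h' x (axis i 1) = ?g (t, x)" for x by (simp add: inner_axis)
    have "(LINT x|lborel. ?h' x (axis i 1)) = 0"
    proof (rule integral_derivative_compact_support[where h="\<lambda>x. v (t, x) * \<phi> t x" and S="snd ` K"])
      show "((\<lambda>x. v (t, x) * \<phi> t x) has_derivative ?h' x) (at x)" for x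
        by (rule derivative_eq_intros der[OF t] pr(5)[OF t] | simp)+
      show "continuous_on UNIV (\<lambda>x. ?h' x (axis i 1))" unfolding eq by (rule gc)
      show "compact (snd ` K)" using K by (intro compact_continuous_image continuous_intros)
      show "v (t, x) * \<phi> t x = 0" if "x \<notin> snd ` K" for x
      proof -
        have "(t, x) \<notin> K" using that by force
        then show ?thesis using bspec[OF K(3), of "(t, x)"] t by simp
      qed
    qed
    then have "(LINT x|lborel. ?g (t, x)) = 0" unfolding eq .
    moreover have "(LINT x|lebesgue. ?g (t, x)) = (LINT x|lborel. ?g (t, x))"
      by (rule integral_completion) (use borel_measurable_continuous_onI[OF gc] in simp)
    ultimately show ?thesis by simp
  qed
  have "(LINT p|strip_measure I. ?g p) = int_strip I (\<lambda>t x. ?g (t, x))"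
    using int_strip_eq_integral[OF time_interval_borel[OF I], of "\<lambda>t x. ?g (t, x)"] int by (simp add: split_def)
  also have "\<dots> = 0"
  proof -
    have z: "(\<lambda>t. indicator I t *\<^sub>R (LINT x|lebesgue. ?g (t, x))) = (\<lambda>_. 0 :: real)"
    proof
      show "indicator I t *\<^sub>R (LINT x|lebesgue. ?g (t, x)) = 0" for t
        using inner[of t] by (cases "t \<in> I") simp_all
    qed
    show ?thesis unfolding int_strip_def set_lebesgue_integral_def z by simp
  qed
  finally show ?thesis .
qed

section \<open>Fluxes\<close>

text \<open>Derivatives within the product set restrict to the slices on which only $u$ or only $x$
  varies; these are full spaces, so the restricted derivatives are the ordinary ones.\<close>

lemma class_F_properties:
  fixes \<zeta> :: "real \<Rightarrow> real^'n \<Rightarrow> real \<Rightarrow> real"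
  assumes \<zeta>: "\<zeta> \<in> class_F I"
  shows "continuous_on ((I \<times> UNIV) \<times> UNIV) (\<lambda>(p, w). \<zeta> (fst p) (snd p) w)"
    "\<And>t x w. t \<in> I \<Longrightarrow> ((\<lambda>w. \<zeta> t x w) has_real_derivative d_u \<zeta> t x w) (at w)"
    "continuous_on ((I \<times> UNIV) \<times> UNIV) (\<lambda>(p, w). d_u \<zeta> (fst p) (snd p) w)"
    "\<And>t x w. t \<in> I \<Longrightarrow> ((\<lambda>y. \<zeta> t y w) has_derivative (\<lambda>h. grad (\<lambda>y. \<zeta> t y w) x \<bullet> h)) (at x)"
    "continuous_on ((I \<times> UNIV) \<times> UNIV) (\<lambda>(p, w). grad (\<lambda>y. \<zeta> (fst p) y w) (snd p))"
    "\<And>t x w. t \<in> I \<Longrightarrow> ((\<lambda>y. d_u \<zeta> t y w) has_derivative (\<lambda>h. grad (\<lambda>y. d_u \<zeta> t y w) x \<bullet> h)) (at x)"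
    "continuous_on ((I \<times> UNIV) \<times> UNIV) (\<lambda>(p, w). grad (\<lambda>y. d_u \<zeta> (fst p) y w) (snd p))"
proof -
  let ?D = "closure I \<times> (UNIV :: (real^'n) set) \<times> (UNIV :: real set)"
  let ?z = "\<lambda>(t, x, u). \<zeta> t x u"
  have IJ: "t \<in> I \<Longrightarrow> t \<in> closure I" for t using closure_subset by blast
  have ck: "Ck_on 1 ?D ?z"
    and dx: "\<And>t x u. t \<in> closure I \<Longrightarrow> (\<lambda>y. d_u \<zeta> t y u) differentiable (at x)"
    and gc: "continuous_on ?D (\<lambda>(t, x, u). grad (\<lambda>y. d_u \<zeta> t y u) x)"
    using \<zeta> unfolding class_F_def Let_def by blast+
  obtain Z where Z: "\<And>p. p \<in> ?D \<Longrightarrow> (?z has_derivative Z p) (at p within ?D)"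
    and Zc: "\<And>v. continuous_on ?D (\<lambda>p. Z p v)"
    using ck unfolding Ck_on_1 by blast
  have reorder: "continuous_on ((I \<times> UNIV) \<times> UNIV) (\<lambda>(p, w). k (fst p, snd p, w))"
    if "continuous_on ?D k" for k :: "real \<times> (real^'n) \<times> real \<Rightarrow> 'b::topological_space"
    unfolding split_def
    by (rule continuous_on_compose2[OF that]) (use IJ in \<open>auto intro!: continuous_intros\<close>)
  have "continuous_on ?D ?z" using Z by (rule has_derivative_continuous_on)
  from reorder[OF this] show "continuous_on ((I \<times> UNIV) \<times> UNIV) (\<lambda>(p, w). \<zeta> (fst p) (snd p) w)" by simp
  have du: "((\<lambda>w. \<zeta> t x w) has_real_derivative Z (t, x, w) (0, 0, 1)) (at w)" if t: "t \<in> I" for t x w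
  proof -
    have m: "(t, x, w) \<in> ?D" using IJ[OF t] by simp
    have lin: "linear (Z (t, x, w))" using Z[OF m] by (rule has_derivative_linear)
    have c: "((\<lambda>w. (t, x, w)) has_derivative (\<lambda>h. (0, 0, h))) (at w)"
      by (intro derivative_eq_intros) auto
    have "range (\<lambda>w. (t, x, w)) \<subseteq> ?D" using IJ[OF t] by auto
    from has_derivative_slice[OF Z[OF m] c this]
    have "((\<lambda>w. \<zeta> t x w) has_derivative (\<lambda>h. Z (t, x, w) (0, 0, h))) (at w)" by simp
    moreover have "(\<lambda>h. Z (t, x, w) (0, 0, h)) = (*) (Z (t, x, w) (0, 0, 1))"
    proof
      show "Z (t, x, w) (0, 0, h) = Z (t, x, w) (0, 0, 1) * h" for h
        using linear_scale[OF lin, of h "(0, 0, 1)"] by simp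
    qed
    ultimately show ?thesis unfolding has_field_derivative_def by simp
  qed
  have due: "d_u \<zeta> t x w = Z (t, x, w) (0, 0, 1)" if t: "t \<in> I" for t x w
    unfolding d_u_def using du[OF t] by (intro vector_derivative_at) (simp add: has_real_derivative_iff_has_vector_derivative)
  show "((\<lambda>w. \<zeta> t x w) has_real_derivative d_u \<zeta> t x w) (at w)" if "t \<in> I" for t x w
    using du[OF that] due[OF that] by simp
  show "continuous_on ((I \<times> UNIV) \<times> UNIV) (\<lambda>(p, w). d_u \<zeta> (fst p) (snd p) w)"
    by (rule continuous_on_eq[OF reorder[OF Zc[of "(0, 0, 1)"]]]) (auto simp: due)
  have gx: "((\<lambda>y. \<zeta> t y w) has_derivative (\<lambda>h. Z (t, x, w) (0, h, 0))) (at x)" if t: "t \<in> I" for t x w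
  proof -
    have m: "(t, x, w) \<in> ?D" using IJ[OF t] by simp
    have c: "((\<lambda>y. (t, y, w)) has_derivative (\<lambda>h. (0, h, 0))) (at x)"
      by (intro derivative_eq_intros) auto
    have "range (\<lambda>y. (t, y, w)) \<subseteq> ?D" using IJ[OF t] by auto
    from has_derivative_slice[OF Z[OF m] c this] show ?thesis by simp
  qed
  show "((\<lambda>y. \<zeta> t y w) has_derivative (\<lambda>h. grad (\<lambda>y. \<zeta> t y w) x \<bullet> h)) (at x)" if "t \<in> I" for t x w
    by (rule grad_eq(2)[OF gx[OF that]])
  show "continuous_on ((I \<times> UNIV) \<times> UNIV) (\<lambda>(p, w). grad (\<lambda>y. \<zeta> (fst p) y w) (snd p))"
  proof -
    have "continuous_on ((I \<times> UNIV) \<times> UNIV) (\<lambda>q. grad (\<lambda>y. \<zeta> (fst (fst q)) y (snd q)) (snd (fst q)) $ j)" for j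
      by (rule continuous_on_eq[OF reorder[OF Zc[of "(0, axis j 1, 0)"]]]) (auto simp: grad_nth[OF gx])
    then have "continuous_on ((I \<times> UNIV) \<times> UNIV) (\<lambda>q. \<chi> j. grad (\<lambda>y. \<zeta> (fst (fst q)) y (snd q)) (snd (fst q)) $ j)"
      by (rule continuous_on_vec_lambda)
    then show ?thesis by (simp add: split_def)
  qed
  show "((\<lambda>y. d_u \<zeta> t y w) has_derivative (\<lambda>h. grad (\<lambda>y. d_u \<zeta> t y w) x \<bullet> h)) (at x)" if "t \<in> I" for t x w
    using dx[OF IJ[OF that]] unfolding differentiable_def by (auto intro: grad_eq(2))
  from reorder[OF gc] show "continuous_on ((I \<times> UNIV) \<times> UNIV) (\<lambda>(p, w). grad (\<lambda>y. d_u \<zeta> (fst p) y w) (snd p))" by simp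
qed

lemma strip_slice:
  assumes "continuous_on ((I \<times> UNIV) \<times> UNIV) (\<lambda>(p, w). k p w)" "t \<in> I"
  shows "continuous_on UNIV (\<lambda>(x, w). k (t, x) w)"
proof -
  have "continuous_on UNIV (\<lambda>q. (\<lambda>(p, w). k p w) ((t, fst q), snd q))"
    by (rule continuous_on_compose2[OF assms(1)]) (use assms(2) in \<open>auto intro!: continuous_intros\<close>)
  then show ?thesis by (simp add: split_def)
qed

lemma slice_snd: "continuous_on UNIV (\<lambda>(x, w). k x w) \<Longrightarrow> continuous_on UNIV (\<lambda>w. k x w)"
proof -
  assume a: "continuous_on UNIV (\<lambda>(x, w). k x w)"
  have "continuous_on UNIV (\<lambda>w. (\<lambda>(x, w). k x w) (x, w))"
    by (rule continuous_on_compose2[OF a]) (auto intro!: continuous_intros)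
  then show ?thesis by simp
qed

lemma prim_d_u:
  assumes \<zeta>: "\<zeta> \<in> class_F I" and t: "t \<in> I"
  shows "prim (\<lambda>_. 1) (\<lambda>w. d_u \<zeta> t x w) v = \<zeta> t x v - \<zeta> t x 0"
proof (rule prim_one_FTC)
  show "continuous_on UNIV (\<lambda>w. d_u \<zeta> t x w)"
    using slice_snd[OF strip_slice[OF class_F_properties(3)[OF \<zeta>] t]] by simp
qed (rule class_F_properties(2)[OF \<zeta> t])

lemma prim_d_u_has_derivative:
  fixes \<zeta> :: "real \<Rightarrow> real^'n \<Rightarrow> real \<Rightarrow> real"
  assumes \<zeta>: "\<zeta> \<in> class_F I" and t: "t \<in> I" and e: "locbdd e"
  shows "((\<lambda>y. prim e (\<lambda>w. d_u \<zeta> t y w) v) has_derivative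
      (\<lambda>h. (\<chi> j. prim e (\<lambda>w. grad (\<lambda>y. d_u \<zeta> t y w) x $ j) v) \<bullet> h)) (at x)"
proof -
  note pr = class_F_properties[OF \<zeta>]
  have kc: "continuous_on UNIV (\<lambda>w. d_u \<zeta> t x w)" for x
    using slice_snd[OF strip_slice[OF pr(3) t]] by simp
  have Gc: "continuous_on UNIV (\<lambda>(x, w). grad (\<lambda>y. d_u \<zeta> t y w) x)"
    using strip_slice[OF pr(7) t] by simp
  have Gcw: "continuous_on UNIV (\<lambda>w. grad (\<lambda>y. d_u \<zeta> t y w) x)" for x
    using slice_snd[OF Gc] .
  have "prim e (\<lambda>w. grad (\<lambda>y. d_u \<zeta> t y w) x \<bullet> h) v = (\<chi> j. prim e (\<lambda>w. grad (\<lambda>y. d_u \<zeta> t y w) x $ j) v) \<bullet> h" for h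
  proof -
    have "prim e (\<lambda>w. grad (\<lambda>y. d_u \<zeta> t y w) x \<bullet> h) v = prim e (\<lambda>w. \<Sum>j\<in>UNIV. h $ j * grad (\<lambda>y. d_u \<zeta> t y w) x $ j) v"
      by (simp add: inner_vec_def mult.commute)
    also have "\<dots> = (\<Sum>j\<in>UNIV. prim e (\<lambda>w. h $ j * grad (\<lambda>y. d_u \<zeta> t y w) x $ j) v)"
      by (rule prim_sum_right[OF e]) (auto intro!: continuous_intros Gcw)
    also have "\<dots> = (\<chi> j. prim e (\<lambda>w. grad (\<lambda>y. d_u \<zeta> t y w) x $ j) v) \<bullet> h"
      by (simp add: inner_vec_def prim_scale_right mult.commute)
    finally show ?thesis .
  qed
  then show ?thesis using prim_has_derivative[OF e pr(6)[OF t] Gc kc, of v x] by simp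
qed

text \<open>Interchange of $\partial_u$ and $\nabla_x$ without second derivatives of $\zeta$ other than
  $\nabla_x\partial_u\zeta$: both sides are the $x$-gradient of
  $\zeta(t,x,v)-\zeta(t,x,0)=\int_0^v\partial_u\zeta$.\<close>

lemma prim_grad_d_u:
  fixes \<zeta> :: "real \<Rightarrow> real^'n \<Rightarrow> real \<Rightarrow> real"
  assumes \<zeta>: "\<zeta> \<in> class_F I" and t: "t \<in> I"
  shows "prim (\<lambda>_. 1) (\<lambda>w. grad (\<lambda>y. d_u \<zeta> t y w) x $ j) v = grad (\<lambda>y. \<zeta> t y v) x $ j - grad (\<lambda>y. \<zeta> t y 0) x $ j"
proof -
  note pr = class_F_properties[OF \<zeta>]
  have 1: "((\<lambda>y. \<zeta> t y v - \<zeta> t y 0) has_derivative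
      (\<lambda>h. (\<chi> j. prim (\<lambda>_. 1) (\<lambda>w. grad (\<lambda>y. d_u \<zeta> t y w) x $ j) v) \<bullet> h)) (at x)"
    using prim_d_u_has_derivative[OF \<zeta> t locbdd_const[of 1], of v x] unfolding prim_d_u[OF \<zeta> t] .
  have 2: "((\<lambda>y. \<zeta> t y v - \<zeta> t y 0) has_derivative
      (\<lambda>h. grad (\<lambda>y. \<zeta> t y v) x \<bullet> h - grad (\<lambda>y. \<zeta> t y 0) x \<bullet> h)) (at x)"
    by (intro has_derivative_diff pr(4)[OF t])
  from fun_cong[OF has_derivative_unique[OF 1 2], of "axis j 1"]
  show ?thesis by (simp add: inner_axis)
qed

lemma class_Fn_component: "f \<in> class_Fn I \<Longrightarrow> (\<lambda>t x u. f t x u $ i) \<in> class_F I"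
  by (simp add: class_Fn_def)

lemma d_u_component:
  fixes f :: "real \<Rightarrow> real^'n \<Rightarrow> real \<Rightarrow> real^'n"
  assumes f: "f \<in> class_Fn I" and t: "t \<in> I"
  shows "d_u f t x w $ i = d_u (\<lambda>t x u. f t x u $ i) t x w"
proof -
  have "((\<lambda>w. f t x w) has_derivative (\<lambda>h. h *\<^sub>R (\<chi> i. d_u (\<lambda>t x u. f t x u $ i) t x w))) (at w)"
  proof (rule has_derivative_vecI)
    fix i
    show "((\<lambda>w. f t x w $ i) has_derivative (\<lambda>h. (h *\<^sub>R (\<chi> i. d_u (\<lambda>t x u. f t x u $ i) t x w)) $ i)) (at w)"
      using class_F_properties(2)[OF class_Fn_component[OF f] t]
      by (simp add: has_field_derivative_def mult_commute_abs)
  qed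
  then have "vector_derivative (\<lambda>w. f t x w) (at w) = (\<chi> i. d_u (\<lambda>t x u. f t x u $ i) t x w)"
    by (intro vector_derivative_at) (simp add: has_vector_derivative_def)
  then show ?thesis by (simp add: d_u_def[of f])
qed

lemma entropy_flux_component:
  fixes f :: "real \<Rightarrow> real^'n \<Rightarrow> real \<Rightarrow> real^'n"
  assumes f: "f \<in> class_Fn I" and t: "t \<in> I" and e: "locbdd (acr_deriv E)"
  shows "entropy_flux f E t x v $ i = prim (acr_deriv E) (\<lambda>w. d_u (\<lambda>t x u. f t x u $ i) t x w) v"
proof -
  let ?e = "acr_deriv E"
  let ?d = "\<lambda>w. \<chi> i. d_u (\<lambda>t x u. f t x u $ i) t x w"
  have dc: "continuous_on UNIV (\<lambda>w. d_u (\<lambda>t x u. f t x u $ i) t x w)" for i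
    using slice_snd[OF strip_slice[OF class_F_properties(3)[OF class_Fn_component[OF f]] t]] by simp
  have dvec: "d_u f t x w = ?d w" for w by (simp add: vec_eq_iff d_u_component[OF f t])
  have ints: "set_integrable lborel {a..b} (\<lambda>w. ?e w *\<^sub>R ?d w)" for a b
    unfolding set_integrable_def
  proof -
    obtain B where B: "B \<ge> 0" "\<And>w. w \<in> {a..b} \<Longrightarrow> \<bar>?e w\<bar> \<le> B" using locbdd_bound[OF e] by blast
    have c: "continuous_on UNIV ?d" by (intro continuous_on_vec_lambda dc)
    obtain M where M: "M \<ge> 0" "\<And>w. w \<in> {a..b} \<Longrightarrow> \<bar>norm (?d w)\<bar> \<le> M"
      using continuous_compact_bound[OF continuous_on_norm[OF continuous_on_subset[OF c subset_UNIV]] compact_Icc] by blast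
    show "integrable lborel (\<lambda>w. indicator {a..b} w *\<^sub>R ?e w *\<^sub>R ?d w)"
    proof (rule integrableI_bounded_set_indicator[where B="B * M"])
      show "(\<lambda>w. ?e w *\<^sub>R ?d w) \<in> borel_measurable lborel"
        using locbdd_borel[OF e] borel_measurable_continuous_onI[OF c] by measurable
      show "AE w in lborel. w \<in> {a..b} \<longrightarrow> norm (?e w *\<^sub>R ?d w) \<le> B * M"
        using B M by (intro AE_I2) (auto intro!: mult_mono)
    qed (auto simp: emeasure_lborel_Icc_eq)
  qed
  have int: "set_integrable lborel (einterval (ereal a) (ereal b)) (\<lambda>w. ?e w *\<^sub>R ?d w)" for a b
    by (rule set_integrable_subset[OF ints[of a b]]) (auto simp: einterval_iff)
  have comp: "(LINT w:einterval (ereal a) (ereal b)|lborel. ?e w *\<^sub>R ?d w) $ i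
      = (LINT w:einterval (ereal a) (ereal b)|lborel. ?e w * ?d w $ i)" for a b
  proof -
    have "(\<integral>w. indicator (einterval (ereal a) (ereal b)) w *\<^sub>R ?e w *\<^sub>R ?d w \<partial>lborel) $ i
       = (\<integral>w. (indicator (einterval (ereal a) (ereal b)) w *\<^sub>R ?e w *\<^sub>R ?d w) $ i \<partial>lborel)"
      by (rule integral_bounded_linear[OF bounded_linear_vec_nth int[unfolded set_integrable_def], symmetric])
    then show ?thesis unfolding set_lebesgue_integral_def by (simp add: mult.assoc)
  qed
  show ?thesis
    unfolding entropy_flux_def prim_def dvec interval_lebesgue_integral_def
    using comp[of 0 v] comp[of v 0] by simp
qed

lemma dvg_entropy_flux:
  fixes f :: "real \<Rightarrow> real^'n \<Rightarrow> real \<Rightarrow> real^'n"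
  assumes f: "f \<in> class_Fn I" and t: "t \<in> I" and e: "locbdd (acr_deriv E)"
  shows "dvg (\<lambda>y. entropy_flux f E t y v) x =
     (\<Sum>i\<in>UNIV. prim (acr_deriv E) (\<lambda>w. grad (\<lambda>y. d_u (\<lambda>t x u. f t x u $ i) t y w) x $ i) v)"
proof -
  have "((\<lambda>y. entropy_flux f E t y v $ i) has_derivative
      (\<lambda>h. (\<chi> j. prim (acr_deriv E) (\<lambda>w. grad (\<lambda>y. d_u (\<lambda>t x u. f t x u $ i) t y w) x $ j) v) \<bullet> h)) (at x)" for i
    unfolding entropy_flux_component[OF f t e]
    by (rule prim_d_u_has_derivative[OF class_Fn_component[OF f] t e])
  from dvg_eq[OF this] show ?thesis by simp
qed

lemma dvg_flux:
  fixes f :: "real \<Rightarrow> real^'n \<Rightarrow> real \<Rightarrow> real^'n"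
  assumes f: "f \<in> class_Fn I" and t: "t \<in> I"
  shows "dvg (\<lambda>y. f t y w) x = (\<Sum>i\<in>UNIV. grad (\<lambda>y. f t y w $ i) x $ i)"
  by (rule dvg_eq) (rule class_F_properties(4)[OF class_Fn_component[OF f] t])

section \<open>Productions as functionals\<close>

text \<open>Only the values on $[-R,R]$ of the derivative of an entropy influence its production.\<close>

locale strip_problem =
  fixes I :: "real set"
    and f :: "real \<Rightarrow> real^'n \<Rightarrow> real \<Rightarrow> real^'n"
    and g :: "real \<Rightarrow> real^'n \<Rightarrow> real \<Rightarrow> real"
    and u0 :: "real^'n \<Rightarrow> real"
    and u :: "real \<Rightarrow> real^'n \<Rightarrow> real"
    and \<phi> :: "real \<Rightarrow> real^'n \<Rightarrow> real"
    and R :: real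
  assumes I: "time_interval I"
    and f: "f \<in> class_Fn I"
    and g: "continuous_on (closure I \<times> UNIV \<times> UNIV) (\<lambda>(t, x, w). g t x w)"
    and u0: "u0 \<in> borel_measurable lebesgue" "AE x in lebesgue. \<bar>u0 x\<bar> \<le> R"
    and u: "(\<lambda>p. u (fst p) (snd p)) \<in> borel_measurable (strip_measure I)"
      "AE p in strip_measure I. \<bar>u (fst p) (snd p)\<bar> \<le> R"
    and R: "R \<ge> 0"
    and \<phi>: "\<phi> \<in> C1c I"
begin

abbreviation S :: "(real \<times> (real^'n)) set" where "S \<equiv> I \<times> UNIV"
abbreviation M :: "(real \<times> (real^'n)) measure" where "M \<equiv> lebesgue_on S"

text \<open>The integrands as functions of $p=(t,x)$ and $w$: the components of the flux, their
  $u$-derivatives, and the $i$th terms of $\operatorname{div}_xf$ and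
  $\operatorname{div}_x\partial_uf$.\<close>

definition "U p = u (fst p) (snd p)"
definition "F i p w = f (fst p) (snd p) w $ i"
definition "dF i p w = d_u (\<lambda>t x u. f t x u $ i) (fst p) (snd p) w"
definition "D i p w = grad (\<lambda>y. f (fst p) y w $ i) (snd p) $ i"
definition "dD i p w = grad (\<lambda>y. d_u (\<lambda>t x u. f t x u $ i) (fst p) y w) (snd p) $ i"
definition "G p w = g (fst p) (snd p) w"
definition "\<psi> p = \<phi> (fst p) (snd p)"
definition "\<psi>t p = d_t I \<phi> (fst p) (snd p)"
definition "\<psi>x i p = grad (\<phi> (fst p)) (snd p) $ i"

definition continuous_coeff :: "(real \<times> (real^'n) \<Rightarrow> real \<Rightarrow> real) \<Rightarrow> bool" where
  "continuous_coeff k \<longleftrightarrow> continuous_on (S \<times> UNIV) (\<lambda>(p, w). k p w)"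

text \<open>Every term of a production has one of three forms: the entropy or its flux enters through a
  primitive (\<open>A\<close>), the derivative of the entropy through its values (\<open>B\<close>), and the
  initial datum through a primitive (\<open>Z\<close>).\<close>

definition A :: "(real \<Rightarrow> real) \<Rightarrow> (real \<times> (real^'n) \<Rightarrow> real \<Rightarrow> real) \<Rightarrow> (real \<times> (real^'n) \<Rightarrow> real) \<Rightarrow> real" where
  "A e k \<theta> = (LINT p|M. prim e (k p) (U p) * \<theta> p)"
definition B :: "(real \<Rightarrow> real) \<Rightarrow> (real \<times> (real^'n) \<Rightarrow> real \<Rightarrow> real) \<Rightarrow> (real \<times> (real^'n) \<Rightarrow> real) \<Rightarrow> real" where
  "B e k \<theta> = (LINT p|M. e (U p) * k p (U p) * \<theta> p)"
definition Z :: "(real \<Rightarrow> real) \<Rightarrow> real" where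
  "Z h = (LINT x|lebesgue. h (u0 x) * \<phi> 0 x)"

abbreviation B1 where "B1 \<equiv> B (\<lambda>_. 1)"
text \<open>The integral of the coefficient frozen at the value $c$, which does not involve $u$.\<close>

abbreviation Q where "Q c k \<theta> \<equiv> B (\<lambda>_. 1) (\<lambda>p w. k p c) \<theta>"
abbreviation sg :: "real \<Rightarrow> real \<Rightarrow> real" where "sg c \<equiv> (\<lambda>w. sgn (w - c))"

text \<open>The production of the entropy $\int_0^u e$.\<close>

definition N :: "(real \<Rightarrow> real) \<Rightarrow> real" where
  "N e = A e (\<lambda>_ _. 1) \<psi>t + (\<Sum>i\<in>UNIV. A e (dF i) (\<psi>x i)) - (\<Sum>i\<in>UNIV. B e (D i) \<psi>)
    + (\<Sum>i\<in>UNIV. A e (dD i) \<psi>) + B e G \<psi> + Z (prim e (\<lambda>_. 1))"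

lemma S_borel: "S \<in> sets borel" by (rule strip_borel[OF I])

lemma space_M: "space M = S" by (simp add: space_restrict_space)

lemma fst_in: "p \<in> S \<Longrightarrow> fst p \<in> I" by auto

lemma cutoffs: "cutoff S \<psi>" "cutoff S \<psi>t" "cutoff S (\<psi>x i)"
  using C1c_properties(1-3)[OF I \<phi>] unfolding \<psi>_def[abs_def] \<psi>t_def[abs_def] \<psi>x_def[abs_def] by auto

lemma U_measurable_bounded: "U \<in> borel_measurable M" "AE p in M. \<bar>U p\<bar> \<le> R"
  using u unfolding strip_measure_def U_def[abs_def] by auto

lemma continuous_coeffs: "continuous_coeff (F i)" "continuous_coeff (dF i)" "continuous_coeff (D i)" "continuous_coeff (dD i)"
proof -
  note pr = class_F_properties[OF class_Fn_component[OF f, of i]]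
  show "continuous_coeff (F i)" "continuous_coeff (dF i)"
    using pr(1) pr(3) unfolding continuous_coeff_def F_def dF_def by auto
  show "continuous_coeff (D i)"
    using continuous_on_component[OF pr(5), of i] unfolding continuous_coeff_def D_def split_def .
  show "continuous_coeff (dD i)"
    using continuous_on_component[OF pr(7), of i] unfolding continuous_coeff_def dD_def split_def .
qed

lemma continuous_coeff_G: "continuous_coeff G"
proof -
  have "continuous_on (S \<times> UNIV) (\<lambda>q. (\<lambda>(t, x, w). g t x w) (fst (fst q), snd (fst q), snd q))"
    by (rule continuous_on_compose2[OF g]) (use closure_subset in \<open>fastforce intro!: continuous_intros\<close>)+
  then show ?thesis unfolding continuous_coeff_def G_def by (simp add: split_def)
qed

lemma continuous_coeff_const: "continuous_coeff (\<lambda>_ _. r)"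
  unfolding continuous_coeff_def by (simp add: split_def)

lemma continuous_coeff_id: "continuous_coeff (\<lambda>_ w. w)"
  unfolding continuous_coeff_def split_def by (intro continuous_intros)

lemma continuous_coeff_at:
  assumes "continuous_coeff k"
  shows "continuous_on S (\<lambda>p. k p c)" "continuous_coeff (\<lambda>p w. k p c)"
proof -
  have "continuous_on S (\<lambda>p. (\<lambda>(p, w). k p w) (p, c))"
    by (rule continuous_on_compose2[OF assms[unfolded continuous_coeff_def]]) (auto intro!: continuous_intros)
  then show c: "continuous_on S (\<lambda>p. k p c)" by simp
  have "continuous_on (S \<times> UNIV) (\<lambda>q::(real \<times> (real^'n)) \<times> real. k (fst q) c)"
    by (rule continuous_on_compose2[OF c]) (auto intro!: continuous_intros)
  then show "continuous_coeff (\<lambda>p w. k p c)" unfolding continuous_coeff_def by (simp add: split_def)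
qed

lemma A_integrable:
  assumes "continuous_coeff k" "cutoff S \<theta>" "locbdd e"
  shows "integrable M (\<lambda>p. prim e (k p) (U p) * \<theta> p)"
  using prim_functional(1)[OF S_borel assms(1)[unfolded continuous_coeff_def] assms(2) U_measurable_bounded R assms(3)] by simp

lemma B_integrable:
  assumes "continuous_coeff k" "cutoff S \<theta>" "locbdd e"
  shows "integrable M (\<lambda>p. e (U p) * k p (U p) * \<theta> p)"
  using eval_functional(1)[OF S_borel assms(1)[unfolded continuous_coeff_def] assms(2) U_measurable_bounded assms(3)] by simp

lemma A_functional:
  assumes "continuous_coeff k" "cutoff S \<theta>"
  shows "bounded_functional R (\<lambda>e. A e k \<theta>)"
  using prim_functional(2)[OF S_borel assms(1)[unfolded continuous_coeff_def] assms(2) U_measurable_bounded R] unfolding A_def by simp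

lemma B_functional:
  assumes "continuous_coeff k" "cutoff S \<theta>"
  shows "bounded_functional R (\<lambda>e. B e k \<theta>)"
  using eval_functional(2)[OF S_borel assms(1)[unfolded continuous_coeff_def] assms(2) U_measurable_bounded] unfolding B_def by simp

lemma cutoff_0: "cutoff UNIV (\<phi> 0)"
proof -
  obtain K where K: "compact K" "K \<subseteq> S" "\<forall>p\<in>S - K. \<psi> p = 0" by (rule cutoff_support[OF cutoffs(1)])
  have "\<phi> 0 x = 0" if "x \<notin> snd ` K" for x
  proof -
    have "(0, x) \<notin> K" using that by force
    then show ?thesis using bspec[OF K(3), of "(0, x)"] time_interval_zero[OF I] by (simp add: \<psi>_def)
  qed
  moreover have "continuous_on UNIV (\<phi> 0)"
    using C1c_properties(5)[OF I \<phi> time_interval_zero[OF I]]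
    by (meson has_derivative_continuous_on has_derivative_at_withinI)
  moreover have "compact (snd ` K)" using K by (intro compact_continuous_image continuous_intros)
  ultimately show ?thesis unfolding cutoff_def by (intro conjI exI[of _ "snd ` K"]) auto
qed

lemma prim_one: "prim (\<lambda>_. 1) (\<lambda>_. 1) v = v"
  using prim_one_FTC[of "\<lambda>_. 1" "\<lambda>w. w" v] by simp

lemma Z_prim:
  shows "\<And>e. locbdd e \<Longrightarrow> integrable lebesgue (\<lambda>x. prim e (\<lambda>_. 1) (u0 x) * \<phi> 0 x)"
    and "bounded_functional R (\<lambda>e. Z (prim e (\<lambda>_. 1)))"
proof -
  have c: "continuous_on (UNIV \<times> UNIV) (\<lambda>q::(real^'n) \<times> real. 1 :: real)" by simp
  have m: "u0 \<in> borel_measurable (lebesgue_on UNIV)" "AE x in lebesgue_on UNIV. \<bar>u0 x\<bar> \<le> R"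
    using u0 unfolding lebesgue_on_UNIV_eq by auto
  note * = prim_functional[OF _ c cutoff_0 m R]
  show "integrable lebesgue (\<lambda>x. prim e (\<lambda>_. 1) (u0 x) * \<phi> 0 x)" if "locbdd e" for e
    using *(1)[OF _ that] by (simp add: lebesgue_on_UNIV_eq)
  show "bounded_functional R (\<lambda>e. Z (prim e (\<lambda>_. 1)))"
    using *(2) unfolding Z_def by (simp add: lebesgue_on_UNIV_eq)
qed

lemma \<phi>0_integrable: "integrable lebesgue (\<phi> 0)"
  using cutoff_integrable[OF _ cutoff_0] by (simp add: lebesgue_on_UNIV_eq)

lemma Z_id_integrable: "integrable lebesgue (\<lambda>x. u0 x * \<phi> 0 x)"
  using Z_prim(1)[OF locbdd_const[of 1]] by (simp add: prim_one)

lemma N_functional: "bounded_functional R N"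
proof -
  have minus: "bounded_functional R (\<lambda>e. L e - L' e)" if "bounded_functional R L" "bounded_functional R L'" for L L'
    using bounded_functional_add[OF that(1) bounded_functional_scale[OF that(2), of "-1"]] by simp
  show ?thesis
    unfolding N_def[abs_def]
    by (intro bounded_functional_add minus bounded_functional_sum A_functional B_functional Z_prim
        continuous_coeffs continuous_coeff_G continuous_coeff_const cutoffs finite)
qed

lemma int_strip_M:
  assumes "integrable M H" "\<And>t x. t \<in> I \<Longrightarrow> h t x = H (t, x)"
  shows "int_strip I h = (LINT p|M. H p)"
proof -
  have "h t = (\<lambda>x. H (t, x))" if "t \<in> I" for t using assms(2)[OF that] by blast
  then have "int_strip I h = int_strip I (\<lambda>t x. H (t, x))"
    unfolding int_strip_def set_lebesgue_integral_def
    by (intro Bochner_Integration.integral_cong) (auto simp: indicator_def)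
  also have "\<dots> = (LINT p|strip_measure I. H (fst p, snd p))"
    by (rule int_strip_eq_integral[OF time_interval_borel[OF I]]) (simp add: strip_measure_def assms(1))
  finally show ?thesis by (simp add: strip_measure_def)
qed

lemma LINT_M_cong: "(\<And>p. p \<in> S \<Longrightarrow> h p = h' p) \<Longrightarrow> (LINT p|M. h p) = (LINT p|M. h' p)"
  by (rule Bochner_Integration.integral_cong) (auto simp: space_M)

lemma time_identity: "Q c (\<lambda>_ w. w) \<psi>t = - c * (LINT x|lebesgue. \<phi> 0 x)"
  using integral_time_derivative[OF I \<phi>] unfolding B_def \<psi>t_def strip_measure_def by simp

lemma space_identity: "Q c (F i) (\<psi>x i) + Q c (D i) \<psi> = 0"
proof -
  let ?w = "\<lambda>p. grad (\<lambda>y. f (fst p) y c $ i) (snd p)"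
  have "(LINT p|strip_measure I. F i p c * grad (\<phi> (fst p)) (snd p) $ i + ?w p $ i * \<phi> (fst p) (snd p)) = 0"
  proof (rule integral_space_derivative[OF I \<phi>])
    show "continuous_on S (\<lambda>p. F i p c)" using continuous_coeff_at(1)[OF continuous_coeffs(1)] .
    show "continuous_on S (\<lambda>p. ?w p $ i)" using continuous_coeff_at(1)[OF continuous_coeffs(3)] unfolding D_def .
    show "((\<lambda>y. F i (t, y) c) has_derivative (\<lambda>h. ?w (t, x) \<bullet> h)) (at x)" if "t \<in> I" for t x
      using class_F_properties(4)[OF class_Fn_component[OF f] that] by (simp add: F_def)
  qed
  then have "(LINT p|M. F i p c * \<psi>x i p + D i p c * \<psi> p) = 0"
    unfolding \<psi>x_def \<psi>_def D_def strip_measure_def .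
  moreover have "integrable M (\<lambda>p. F i p c * \<psi>x i p)" "integrable M (\<lambda>p. D i p c * \<psi> p)"
    using B_integrable[OF continuous_coeff_at(2)[OF continuous_coeffs(1)] cutoffs(3) locbdd_const[of 1]]
      B_integrable[OF continuous_coeff_at(2)[OF continuous_coeffs(3)] cutoffs(1) locbdd_const[of 1]] by simp_all
  ultimately show ?thesis unfolding B_def by simp
qed

lemma prim_dF: "p \<in> S \<Longrightarrow> prim (\<lambda>_. 1) (dF i p) v = F i p v - F i p 0"
  using prim_d_u[OF class_Fn_component[OF f] fst_in] unfolding dF_def[abs_def] F_def by blast

lemma prim_dD: "p \<in> S \<Longrightarrow> prim (\<lambda>_. 1) (dD i p) v = D i p v - D i p 0"
  using prim_grad_d_u[OF class_Fn_component[OF f] fst_in] unfolding dD_def[abs_def] D_def by blast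

lemma A_one:
  assumes k: "continuous_coeff k" "continuous_coeff K" "cutoff S \<theta>"
    and K: "\<And>p v. p \<in> S \<Longrightarrow> prim (\<lambda>_. 1) (k p) v = K p v - K p 0"
  shows "A (\<lambda>_. 1) k \<theta> = B1 K \<theta> - Q 0 K \<theta>"
proof -
  have "A (\<lambda>_. 1) k \<theta> = (LINT p|M. 1 * K p (U p) * \<theta> p - 1 * K p 0 * \<theta> p)"
    unfolding A_def by (rule LINT_M_cong) (simp add: K left_diff_distrib)
  then show ?thesis
    using B_integrable[OF k(2,3) locbdd_const[of 1]] B_integrable[OF continuous_coeff_at(2)[OF k(2), of 0] k(3) locbdd_const[of 1]]
    unfolding B_def by simp
qed

lemma A_sgn:
  assumes k: "continuous_coeff k" "continuous_coeff K" "cutoff S \<theta>"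
    and K: "\<And>p v. p \<in> S \<Longrightarrow> prim (\<lambda>_. 1) (k p) v = K p v - K p 0"
  shows "A (sg c) k \<theta> = B (sg c) K \<theta> - B (sg c) (\<lambda>p w. K p c) \<theta> + sgn c * (Q 0 K \<theta> - Q c K \<theta>)"
proof -
  note i = B_integrable[OF k(2,3) locbdd_sgn[of c]]
    B_integrable[OF continuous_coeff_at(2)[OF k(2), of c] k(3) locbdd_sgn[of c]]
    B_integrable[OF continuous_coeff_at(2)[OF k(2), of 0] k(3) locbdd_const[of 1]]
    B_integrable[OF continuous_coeff_at(2)[OF k(2), of c] k(3) locbdd_const[of 1]]
  have kc: "continuous_on UNIV (k p)" if "p \<in> S" for p
    using slice_continuous[OF k(1)[unfolded continuous_coeff_def] that] by simp
  have "A (sg c) k \<theta> = (LINT p|M. sgn (U p - c) * K p (U p) * \<theta> p - sgn (U p - c) * K p c * \<theta> p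
      + sgn c * (1 * K p 0 * \<theta> p - 1 * K p c * \<theta> p))"
    unfolding A_def by (rule LINT_M_cong) (simp add: prim_sgn[OF kc K] algebra_simps)
  then show ?thesis using i unfolding B_def by simp
qed

lemmas A_rules =
  A_one[OF continuous_coeff_const continuous_coeff_id cutoffs(2)]
  A_one[OF continuous_coeffs(2) continuous_coeffs(1) cutoffs(3) prim_dF]
  A_one[OF continuous_coeffs(4) continuous_coeffs(3) cutoffs(1) prim_dD]
  A_sgn[OF continuous_coeff_const continuous_coeff_id cutoffs(2)]
  A_sgn[OF continuous_coeffs(2) continuous_coeffs(1) cutoffs(3) prim_dF]
  A_sgn[OF continuous_coeffs(4) continuous_coeffs(3) cutoffs(1) prim_dD]

lemma distributional_identity:
  assumes "distributional_solution I f g u0 u"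
  shows "B1 (\<lambda>_ w. w) \<psi>t + (\<Sum>i\<in>UNIV. B1 (F i) (\<psi>x i)) + B1 G \<psi> + Z (\<lambda>w. w) = 0"
proof -
  note i = B_integrable[OF continuous_coeff_id cutoffs(2) locbdd_const[of 1]]
    B_integrable[OF continuous_coeffs(1) cutoffs(3) locbdd_const[of 1]]
    B_integrable[OF continuous_coeff_G cutoffs(1) locbdd_const[of 1]]
  have 1: "int_strip I (\<lambda>t x. u t x * d_t I \<phi> t x + f t x (u t x) \<bullet> grad (\<phi> t) x)
      = (LINT p|M. 1 * U p * \<psi>t p + (\<Sum>i\<in>UNIV. 1 * F i p (U p) * \<psi>x i p))"
    by (rule int_strip_M) (use i in \<open>auto simp: U_def F_def \<psi>t_def \<psi>x_def inner_vec_def\<close>)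
  have 2: "int_strip I (\<lambda>t x. g t x (u t x) * \<phi> t x) = (LINT p|M. 1 * G p (U p) * \<psi> p)"
    by (rule int_strip_M) (use i in \<open>auto simp: U_def G_def \<psi>_def\<close>)
  have "int_strip I (\<lambda>t x. u t x * d_t I \<phi> t x + f t x (u t x) \<bullet> grad (\<phi> t) x)
     + int_strip I (\<lambda>t x. g t x (u t x) * \<phi> t x) + (LINT x|lebesgue. u0 x * \<phi> 0 x) = 0"
    using assms \<phi> unfolding distributional_solution_def by blast
  then show ?thesis using i unfolding 1 2 B_def Z_def by simp
qed

lemma N_const:
  assumes "distributional_solution I f g u0 u"
  shows "N (\<lambda>_. 1) = 0"
proof -
  have "(\<Sum>i\<in>UNIV. Q 0 (F i) (\<psi>x i)) + (\<Sum>i\<in>UNIV. Q 0 (D i) \<psi>) = 0"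
    unfolding sum.distrib[symmetric] by (simp add: space_identity)
  moreover have "Z (prim (\<lambda>_. 1) (\<lambda>_. 1)) = Z (\<lambda>w. w)" by (simp add: prim_one Z_def)
  ultimately show ?thesis
    using distributional_identity[OF assms] time_identity[of 0]
    unfolding N_def by (simp add: A_rules prim_one sum_subtractf)
qed

lemma kruzhkov_eq:
  "kruzhkov_production I f g u0 u c \<phi> =
     B (sg c) (\<lambda>_ w. w) \<psi>t - B (sg c) (\<lambda>_ w. c) \<psi>t
     + (\<Sum>i\<in>UNIV. B (sg c) (F i) (\<psi>x i) - B (sg c) (\<lambda>p w. F i p c) (\<psi>x i))
     - (\<Sum>i\<in>UNIV. B (sg c) (\<lambda>p w. D i p c) \<psi>)
     + B (sg c) G \<psi> + Z (\<lambda>w. \<bar>w - c\<bar>)"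
proof -
  note i = B_integrable[OF continuous_coeff_id cutoffs(2) locbdd_sgn[of c]]
    B_integrable[OF continuous_coeff_const[of c] cutoffs(2) locbdd_sgn[of c]]
    B_integrable[OF continuous_coeffs(1) cutoffs(3) locbdd_sgn[of c]]
    B_integrable[OF continuous_coeff_at(2)[OF continuous_coeffs(1), where c=c] cutoffs(3) locbdd_sgn[of c]]
    B_integrable[OF continuous_coeff_at(2)[OF continuous_coeffs(3), where c=c] cutoffs(1) locbdd_sgn[of c]]
    B_integrable[OF continuous_coeff_G cutoffs(1) locbdd_sgn[of c]]
  have abs: "\<bar>v - c\<bar> = sgn (v - c) * v - sgn (v - c) * c" for v :: real by (simp add: sgn_if abs_if)
  have 1: "int_strip I (\<lambda>t x. \<bar>u t x - c\<bar> * d_t I \<phi> t x + kruzhkov_flux f t x (u t x) c \<bullet> grad (\<phi> t) x)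
      = (LINT p|M. (sgn (U p - c) * U p * \<psi>t p - sgn (U p - c) * c * \<psi>t p)
         + (\<Sum>i\<in>UNIV. sgn (U p - c) * F i p (U p) * \<psi>x i p - sgn (U p - c) * F i p c * \<psi>x i p))"
  proof (rule int_strip_M)
    fix t x
    show "\<bar>u t x - c\<bar> * d_t I \<phi> t x + kruzhkov_flux f t x (u t x) c \<bullet> grad (\<phi> t) x =
         sgn (U (t, x) - c) * U (t, x) * \<psi>t (t, x) - sgn (U (t, x) - c) * c * \<psi>t (t, x) +
         (\<Sum>i\<in>UNIV. sgn (U (t, x) - c) * F i (t, x) (U (t, x)) * \<psi>x i (t, x) - sgn (U (t, x) - c) * F i (t, x) c * \<psi>x i (t, x))"
      unfolding abs by (simp add: U_def F_def \<psi>t_def \<psi>x_def kruzhkov_flux_def inner_vec_def sum_distrib_left algebra_simps)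
  qed (use i in auto)
  have 2: "int_strip I (\<lambda>t x. sgn (u t x - c) * dvg (\<lambda>y. f t y c) x * \<phi> t x)
     = (LINT p|M. (\<Sum>i\<in>UNIV. sgn (U p - c) * D i p c * \<psi> p))"
    by (rule int_strip_M) (use i in \<open>auto simp: dvg_flux[OF f] U_def D_def \<psi>_def sum_distrib_left sum_distrib_right\<close>)
  have 3: "int_strip I (\<lambda>t x. sgn (u t x - c) * g t x (u t x) * \<phi> t x) = (LINT p|M. sgn (U p - c) * G p (U p) * \<psi> p)"
    by (rule int_strip_M) (use i in \<open>auto simp: U_def G_def \<psi>_def\<close>)
  show ?thesis unfolding kruzhkov_production_def 1 2 3 using i by (simp add: B_def Z_def)
qed

lemma N_sgn: "N (sg c) = kruzhkov_production I f g u0 u c \<phi>"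
proof -
  have s0: "(\<Sum>i\<in>UNIV. Q r (F i) (\<psi>x i)) = - (\<Sum>i\<in>UNIV. Q r (D i) \<psi>)" for r
    unfolding sum_negf[symmetric] using space_identity[where c=r] by (intro sum.cong) (auto simp: add_eq_0_iff2)
  have k1: "prim (sg c) (\<lambda>_. 1) v = \<bar>v - c\<bar> - \<bar>c\<bar>" for v
    using prim_sgn[of "\<lambda>_. 1" "\<lambda>w. w" c v] by (simp add: prim_one) (simp add: sgn_if abs_if)
  have z: "Z (prim (sg c) (\<lambda>_. 1)) = Z (\<lambda>w. \<bar>w - c\<bar>) - \<bar>c\<bar> * (LINT x|lebesgue. \<phi> 0 x)"
  proof -
    have "integrable lebesgue (\<lambda>x. (prim (sg c) (\<lambda>_. 1) (u0 x) * \<phi> 0 x) + \<bar>c\<bar> * \<phi> 0 x)"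
      using Z_prim(1)[OF locbdd_sgn[of c]] \<phi>0_integrable by simp
    then have "integrable lebesgue (\<lambda>x. \<bar>u0 x - c\<bar> * \<phi> 0 x)" by (simp add: k1 left_diff_distrib)
    then show ?thesis unfolding Z_def k1 using \<phi>0_integrable by (simp add: left_diff_distrib)
  qed
  have t: "sgn c * (Q 0 (\<lambda>_ w. w) \<psi>t - Q c (\<lambda>_ w. w) \<psi>t) = \<bar>c\<bar> * (LINT x|lebesgue. \<phi> 0 x)"
    unfolding time_identity by (simp add: sgn_if abs_if)
  have "A (sg c) (\<lambda>_ _. 1) \<psi>t = B (sg c) (\<lambda>_ w. w) \<psi>t - B (sg c) (\<lambda>_ w. c) \<psi>t + \<bar>c\<bar> * (LINT x|lebesgue. \<phi> 0 x)"
    using A_rules(4)[of 1 c] t by (simp add: prim_one)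
  then show ?thesis
    unfolding N_def kruzhkov_eq z
    by (simp add: A_rules(5,6) sum.distrib sum_subtractf sum_distrib_left[symmetric] s0 algebra_simps)
qed

text \<open>If $u$ stays on one side of $c$, then $|u-c|$ is an affine function of $u$, and $\mu_c$ is
  $s$ times the difference of the weak formulations for $u$ and for the constant $c$, which solves
  the equation with the source $\operatorname{div}_xf(t,x,c)$.\<close>

lemma kruzhkov_zero:
  assumes sol: "distributional_solution I f g u0 u"
    and s: "AE p in M. sgn (U p - c) = s" "AE x in lebesgue. \<bar>u0 x - c\<bar> = s * (u0 x - c)"
  shows "kruzhkov_production I f g u0 u c \<phi> = 0"
proof -
  have B: "B (sg c) k \<theta> = s * B1 k \<theta>" if "continuous_coeff k" "cutoff S \<theta>" for k \<theta>
  proof -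
    have "B (sg c) k \<theta> = (LINT p|M. s * (1 * k p (U p) * \<theta> p))"
      unfolding B_def
    proof (rule integral_cong_AE)
      show "AE p in M. sgn (U p - c) * k p (U p) * \<theta> p = s * (1 * k p (U p) * \<theta> p)"
        using s(1) by eventually_elim simp
    qed (use B_integrable[OF that locbdd_sgn[of c]] B_integrable[OF that locbdd_const[of 1]] in auto)
    then show ?thesis by (simp add: B_def)
  qed
  have "Z (\<lambda>w. \<bar>w - c\<bar>) = (LINT x|lebesgue. s * (u0 x * \<phi> 0 x - c * \<phi> 0 x))"
    unfolding Z_def
  proof (rule integral_cong_AE)
    have m: "\<phi> 0 \<in> borel_measurable lebesgue" using \<phi>0_integrable by auto
    show "(\<lambda>x. \<bar>u0 x - c\<bar> * \<phi> 0 x) \<in> borel_measurable lebesgue" using u0(1) m by measurable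
    show "(\<lambda>x. s * (u0 x * \<phi> 0 x - c * \<phi> 0 x)) \<in> borel_measurable lebesgue" using u0(1) m by measurable
    show "AE x in lebesgue. \<bar>u0 x - c\<bar> * \<phi> 0 x = s * (u0 x * \<phi> 0 x - c * \<phi> 0 x)"
    proof (rule eventually_mono[OF s(2)])
      show "\<bar>u0 x - c\<bar> * \<phi> 0 x = s * (u0 x * \<phi> 0 x - c * \<phi> 0 x)" if "\<bar>u0 x - c\<bar> = s * (u0 x - c)" for x
        unfolding that by (simp add: algebra_simps)
    qed
  qed
  also have "\<dots> = s * (Z (\<lambda>w. w) - c * (LINT x|lebesgue. \<phi> 0 x))"
    using Z_id_integrable \<phi>0_integrable by (simp add: Z_def)
  finally have z: "Z (\<lambda>w. \<bar>w - c\<bar>) = s * (Z (\<lambda>w. w) - c * (LINT x|lebesgue. \<phi> 0 x))" .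
  have s0: "(\<Sum>i\<in>UNIV. Q c (F i) (\<psi>x i)) = - (\<Sum>i\<in>UNIV. Q c (D i) \<psi>)"
    unfolding sum_negf[symmetric] using space_identity[where c=c] by (intro sum.cong) (auto simp: add_eq_0_iff2)
  note BB = B[OF continuous_coeff_id cutoffs(2)] B[OF continuous_coeff_const cutoffs(2)]
    B[OF continuous_coeffs(1) cutoffs(3)] B[OF continuous_coeff_at(2)[OF continuous_coeffs(1)] cutoffs(3)]
    B[OF continuous_coeff_at(2)[OF continuous_coeffs(3)] cutoffs(1)] B[OF continuous_coeff_G cutoffs(1)]
  have "kruzhkov_production I f g u0 u c \<phi> =
     s * (B1 (\<lambda>_ w. w) \<psi>t - Q c (\<lambda>_ w. w) \<psi>t + ((\<Sum>i\<in>UNIV. B1 (F i) (\<psi>x i)) - (\<Sum>i\<in>UNIV. Q c (F i) (\<psi>x i)))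
      - (\<Sum>i\<in>UNIV. Q c (D i) \<psi>) + B1 G \<psi> + (Z (\<lambda>w. w) - c * (LINT x|lebesgue. \<phi> 0 x)))"
    unfolding kruzhkov_eq BB z sum_subtractf sum_distrib_left[symmetric] by (simp add: algebra_simps)
  also have "\<dots> = s * (B1 (\<lambda>_ w. w) \<psi>t + (\<Sum>i\<in>UNIV. B1 (F i) (\<psi>x i)) + B1 G \<psi> + Z (\<lambda>w. w))"
    unfolding s0 time_identity by simp
  finally show ?thesis using distributional_identity[OF sol] by simp
qed

lemma entropy_eq:
  assumes E: "E \<in> ACR"
  shows "entropy_production I f g u0 u E \<phi> = N (acr_deriv E)"
proof -
  let ?e = "acr_deriv E"
  have lb: "locbdd ?e" using E by (intro balanced_locbdd normalised_derivative_balanced[of E] acr_deriv_normalised)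
  have Ep: "E v = E 0 + prim ?e (\<lambda>_. 1) v" for v
    using acr_primitive[OF E, of v] by (simp add: prim_def)
  note i = A_integrable[OF continuous_coeff_const[of 1] cutoffs(2) lb]
    A_integrable[OF continuous_coeffs(2) cutoffs(3) lb]
    B_integrable[OF continuous_coeffs(3) cutoffs(1) lb]
    A_integrable[OF continuous_coeffs(4) cutoffs(1) lb]
    B_integrable[OF continuous_coeff_G cutoffs(1) lb]
    cutoff_integrable[OF S_borel cutoffs(2)]
  have 1: "int_strip I (\<lambda>t x. E (u t x) * d_t I \<phi> t x + entropy_flux f E t x (u t x) \<bullet> grad (\<phi> t) x)
      = (LINT p|M. (E 0 * \<psi>t p + prim ?e (\<lambda>_. 1) (U p) * \<psi>t p) + (\<Sum>i\<in>UNIV. prim ?e (dF i p) (U p) * \<psi>x i p))"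
  proof (rule int_strip_M)
    fix t x assume "t \<in> I"
    then have ef: "entropy_flux f E t x (u t x) $ i = prim ?e (dF i (t, x)) (U (t, x))" for i
      using entropy_flux_component[OF f _ lb] by (simp add: U_def dF_def[abs_def])
    show "E (u t x) * d_t I \<phi> t x + entropy_flux f E t x (u t x) \<bullet> grad (\<phi> t) x =
      (E 0 * \<psi>t (t, x) + prim ?e (\<lambda>_. 1) (U (t, x)) * \<psi>t (t, x)) + (\<Sum>i\<in>UNIV. prim ?e (dF i (t, x)) (U (t, x)) * \<psi>x i (t, x))"
      unfolding inner_vec_def ef Ep[of "u t x"] by (simp add: U_def \<psi>t_def \<psi>x_def distrib_right)
  qed (use i in auto)
  have 2: "int_strip I (\<lambda>t x. ?e (u t x) * dvg (\<lambda>y. f t y (u t x)) x * \<phi> t x)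
     = (LINT p|M. (\<Sum>i\<in>UNIV. ?e (U p) * D i p (U p) * \<psi> p))"
    by (rule int_strip_M) (use i in \<open>auto simp: dvg_flux[OF f] U_def D_def \<psi>_def sum_distrib_left sum_distrib_right\<close>)
  have 3: "int_strip I (\<lambda>t x. dvg (\<lambda>y. entropy_flux f E t y (u t x)) x * \<phi> t x)
     = (LINT p|M. (\<Sum>i\<in>UNIV. prim ?e (dD i p) (U p) * \<psi> p))"
    by (rule int_strip_M) (use i in \<open>auto simp: dvg_entropy_flux[OF f _ lb] U_def dD_def[abs_def] \<psi>_def sum_distrib_right\<close>)
  have 4: "int_strip I (\<lambda>t x. ?e (u t x) * g t x (u t x) * \<phi> t x) = (LINT p|M. ?e (U p) * G p (U p) * \<psi> p)"
    by (rule int_strip_M) (use i in \<open>auto simp: U_def G_def \<psi>_def\<close>)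
  have 5: "(LINT x|lebesgue. E (u0 x) * \<phi> 0 x) = E 0 * (LINT x|lebesgue. \<phi> 0 x) + Z (prim ?e (\<lambda>_. 1))"
  proof -
    have "(LINT x|lebesgue. E (u0 x) * \<phi> 0 x) = (LINT x|lebesgue. E 0 * \<phi> 0 x + prim ?e (\<lambda>_. 1) (u0 x) * \<phi> 0 x)"
      by (subst Ep) (simp add: distrib_right)
    then show ?thesis using Z_prim(1)[OF lb] \<phi>0_integrable by (simp add: Z_def)
  qed
  have t: "(LINT p|M. \<psi>t p) = - (LINT x|lebesgue. \<phi> 0 x)"
    using integral_time_derivative[OF I \<phi>] unfolding \<psi>t_def strip_measure_def .
  show ?thesis unfolding entropy_production_def 1 2 3 4 5 N_def A_def B_def using i by (simp add: t)
qed

end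

section \<open>The range of the initial datum\<close>

text \<open>The squared positive part is the continuously differentiable profile from which all test functions below are
  built, in time and in space.\<close>

lemma max0_square_derivative: "((\<lambda>y::real. (max 0 y)\<^sup>2) has_real_derivative 2 * max 0 y) (at y)"
proof (cases y "0::real" rule: linorder_cases)
  case less
  have "((\<lambda>y::real. 0) has_real_derivative 2 * max 0 y) (at y)" using less by simp
  then show ?thesis by (rule DERIV_cong_ev[THEN iffD1, rotated -1, OF _ refl])
      (use less in \<open>auto intro!: eventually_mono[OF eventually_nhds_in_open[of "{..<0}"]]\<close>)
next
  case equal
  have "((\<lambda>h::real. (max 0 h)\<^sup>2 / h) \<longlongrightarrow> 0) (at 0)"
  proof (rule tendsto_0_le[where K=1 and f="\<lambda>h. h"])
    show "((\<lambda>h::real. h) \<longlongrightarrow> 0) (at 0)" by (rule tendsto_ident_at)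
    show "\<forall>\<^sub>F h::real in at 0. norm ((max 0 h)\<^sup>2 / h) \<le> norm h * 1"
      by (rule always_eventually) (auto simp: max_def power2_eq_square)
  qed
  then show ?thesis using equal by (simp add: DERIV_def)
next
  case greater
  have "((\<lambda>y::real. y\<^sup>2) has_real_derivative 2 * max 0 y) (at y)"
    using greater by (auto intro!: derivative_eq_intros)
  then show ?thesis by (rule DERIV_cong_ev[THEN iffD1, rotated -1, OF _ refl])
      (use greater in \<open>auto intro!: eventually_mono[OF eventually_nhds_in_open[of "{0<..}"]]\<close>)
qed

text \<open>A non-negative function in $C^1_c$ with its gradient and a compact set that carries it.\<close>

definition test_pair :: "('a::euclidean_space \<Rightarrow> real) \<Rightarrow> ('a \<Rightarrow> 'a) \<Rightarrow> 'a set \<Rightarrow> bool" where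
  "test_pair \<psi> \<gamma> K \<longleftrightarrow> (\<forall>x. 0 \<le> \<psi> x) \<and> (\<forall>x. (\<psi> has_derivative (\<lambda>h. \<gamma> x \<bullet> h)) (at x)) \<and>
     continuous_on UNIV \<gamma> \<and> compact K \<and> (\<forall>x. x \<notin> K \<longrightarrow> \<psi> x = 0)"

lemma test_pair_continuous: "test_pair \<psi> \<gamma> K \<Longrightarrow> continuous_on UNIV \<psi>"
  unfolding test_pair_def by (meson has_derivative_continuous_on has_derivative_at_withinI)

lemma test_pair_sum:
  assumes "finite T" "\<And>i. i \<in> T \<Longrightarrow> test_pair (\<psi> i) (\<gamma> i) (K i)"
  shows "test_pair (\<lambda>x. \<Sum>i\<in>T. \<psi> i x) (\<lambda>x. \<Sum>i\<in>T. \<gamma> i x) (\<Union>i\<in>T. K i)"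
proof -
  have d: "((\<lambda>x. \<Sum>i\<in>T. \<psi> i x) has_derivative (\<lambda>h. (\<Sum>i\<in>T. \<gamma> i x) \<bullet> h)) (at x)" for x
    unfolding inner_sum_left by (rule has_derivative_sum) (use assms(2) in \<open>auto simp: test_pair_def\<close>)
  show ?thesis
    unfolding test_pair_def
    using assms by (intro conjI allI d) (auto simp: test_pair_def intro!: sum_nonneg continuous_on_sum compact_UN sum.neutral)
qed

lemma test_pair_bump:
  fixes x0 :: "'a::euclidean_space"
  assumes "\<rho> > 0"
  shows "test_pair (\<lambda>y. (max 0 (\<rho>\<^sup>2 - (y - x0) \<bullet> (y - x0)))\<^sup>2)
      (\<lambda>y. (- 4 * max 0 (\<rho>\<^sup>2 - (y - x0) \<bullet> (y - x0))) *\<^sub>R (y - x0)) (cball x0 \<rho>)"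
proof -
  have d: "((\<lambda>y. (max 0 (\<rho>\<^sup>2 - (y - x0) \<bullet> (y - x0)))\<^sup>2) has_derivative
      (\<lambda>h. ((- 4 * max 0 (\<rho>\<^sup>2 - (x - x0) \<bullet> (x - x0))) *\<^sub>R (x - x0)) \<bullet> h)) (at x)" for x
  proof -
    have 1: "((\<lambda>y. \<rho>\<^sup>2 - (y - x0) \<bullet> (y - x0)) has_derivative (\<lambda>h. - 2 * ((x - x0) \<bullet> h))) (at x)"
      by (auto intro!: derivative_eq_intros simp: inner_commute)
    have 2: "((\<lambda>y::real. (max 0 y)\<^sup>2) has_derivative (\<lambda>k. (2 * max 0 (\<rho>\<^sup>2 - (x - x0) \<bullet> (x - x0))) * k)) (at (\<rho>\<^sup>2 - (x - x0) \<bullet> (x - x0)))"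
      using max0_square_derivative unfolding has_field_derivative_def .
    have "(\<lambda>h. (2 * max 0 (\<rho>\<^sup>2 - (x - x0) \<bullet> (x - x0))) * (- 2 * ((x - x0) \<bullet> h)))
        = (\<lambda>h. ((- 4 * max 0 (\<rho>\<^sup>2 - (x - x0) \<bullet> (x - x0))) *\<^sub>R (x - x0)) \<bullet> h)" by (simp add: fun_eq_iff)
    then show ?thesis using has_derivative_compose[OF 1 2] by simp
  qed
  have z: "(max 0 (\<rho>\<^sup>2 - (x - x0) \<bullet> (x - x0)))\<^sup>2 = 0" if "x \<notin> cball x0 \<rho>" for x
  proof -
    have "\<rho> < norm (x - x0)" using that by (simp add: dist_norm norm_minus_commute)
    then have "\<rho>\<^sup>2 < (norm (x - x0))\<^sup>2" using assms by (intro power_strict_mono) auto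
    then show ?thesis by (simp add: power2_norm_eq_inner)
  qed
  show ?thesis unfolding test_pair_def
    by (intro conjI allI impI d) (use z in \<open>auto intro!: continuous_intros\<close>)
qed

lemma test_pair_exists:
  fixes K :: "'a::euclidean_space set"
  assumes "compact K" "open W" "K \<subseteq> W"
  obtains q \<gamma> C where "test_pair q \<gamma> C" "\<And>x. x \<in> K \<Longrightarrow> 0 < q x" "\<And>x. x \<notin> W \<Longrightarrow> q x = 0"
proof -
  have "\<exists>r>0. cball x r \<subseteq> W" if "x \<in> K" for x using assms that open_contains_cball by blast
  then obtain r where r: "\<And>x. x \<in> K \<Longrightarrow> r x > 0" "\<And>x. x \<in> K \<Longrightarrow> cball x (r x) \<subseteq> W" by metis
  have "K \<subseteq> (\<Union>x\<in>K. ball x (r x))" using r(1) by force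
  then obtain T where T: "T \<subseteq> K" "finite T" "K \<subseteq> (\<Union>x\<in>T. ball x (r x))"
    using compactE_image[OF assms(1), of K "\<lambda>x. ball x (r x)"] by blast
  let ?b = "\<lambda>x y. (max 0 ((r x)\<^sup>2 - (y - x) \<bullet> (y - x)))\<^sup>2"
  let ?g = "\<lambda>x y. (- 4 * max 0 ((r x)\<^sup>2 - (y - x) \<bullet> (y - x))) *\<^sub>R (y - x)"
  have tp: "test_pair (?b x) (?g x) (cball x (r x))" if "x \<in> T" for x
    using test_pair_bump[OF r(1)] that T(1) by blast
  show ?thesis
  proof (rule that[OF test_pair_sum[OF T(2) tp]])
    show "0 < (\<Sum>i\<in>T. ?b i x)" if xK: "x \<in> K" for x
    proof -
      obtain i where i: "i \<in> T" "x \<in> ball i (r i)" using T(3) xK by blast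
      then have "norm (x - i) < r i" by (simp add: dist_norm norm_minus_commute)
      then have "(norm (x - i))\<^sup>2 < (r i)\<^sup>2" by (intro power_strict_mono) auto
      then have "0 < ?b i x" by (simp add: power2_norm_eq_inner)
      then show ?thesis using i(1) T(2) by (intro sum_pos2) auto
    qed
    show "(\<Sum>i\<in>T. ?b i x) = 0" if xW: "x \<notin> W" for x
    proof (rule sum.neutral, rule ballI)
      fix i assume i: "i \<in> T"
      then have "x \<notin> cball i (r i)" using r(2) T(1) xW by blast
      then show "?b i x = 0" using tp[OF i] unfolding test_pair_def by blast
    qed
  qed
qed

lemma test_pair_saturate:
  assumes q: "test_pair q \<gamma> C" and \<kappa>: "\<kappa> > 0"
  shows "test_pair (\<lambda>x. q x / (\<kappa> + q x)) (\<lambda>x. (\<kappa> / (\<kappa> + q x)\<^sup>2) *\<^sub>R \<gamma> x) C"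
proof -
  have q0: "0 \<le> q x" for x using q by (simp add: test_pair_def)
  then have pos: "\<kappa> + q x > 0" for x using \<kappa> by (simp add: add_pos_nonneg)
  have d: "((\<lambda>x. q x / (\<kappa> + q x)) has_derivative (\<lambda>h. ((\<kappa> / (\<kappa> + q x)\<^sup>2) *\<^sub>R \<gamma> x) \<bullet> h)) (at x)" for x
  proof -
    have 1: "(q has_derivative (\<lambda>h. \<gamma> x \<bullet> h)) (at x)" using q by (simp add: test_pair_def)
    have 2: "((\<lambda>y. y / (\<kappa> + y)) has_derivative (*) (\<kappa> / (\<kappa> + q x)\<^sup>2)) (at (q x))"
      unfolding has_field_derivative_def[symmetric]
      using pos[of x] by (auto intro!: derivative_eq_intros simp: power2_eq_square)
    show ?thesis using has_derivative_compose[OF 1 2] by simp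
  qed
  have qc: "continuous_on UNIV q" using test_pair_continuous[OF q] .
  have ne: "\<kappa> + q x \<noteq> 0" for x using pos[of x] by simp
  show ?thesis unfolding test_pair_def
    by (intro conjI allI impI d)
      (use q q0 pos qc ne in \<open>auto simp: test_pair_def less_imp_le intro!: continuous_intros\<close>)
qed

text \<open>Otherwise $v<-\delta$ on a compact set $K$ of positive measure. A test function with values in
  $[1/2,1]$ on $K$, at most $1$ everywhere, and supported in a sufficiently small open
  neighbourhood $W$ of $K$ has a negative integral against $v$.\<close>

lemma AE_nonneg_if_test_pairs:
  fixes v :: "'a::euclidean_space \<Rightarrow> real"
  assumes v: "v \<in> borel_measurable lebesgue" "AE x in lebesgue. \<bar>v x\<bar> \<le> C"
    and tests: "\<And>\<psi> \<gamma> K. test_pair \<psi> \<gamma> K \<Longrightarrow> 0 \<le> (LINT x|lebesgue. v x * \<psi> x)"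
  shows "AE x in lebesgue. 0 \<le> v x"
proof (rule ccontr)
  assume neg: "\<not> (AE x in lebesgue. 0 \<le> v x)"
  define A where "A n = {x. v x < - (1 / real (Suc n))} \<inter> ball 0 (real n)" for n
  have Am: "A n \<in> sets lebesgue" for n
  proof -
    have "{x \<in> space lebesgue. v x < - (1 / real (Suc n))} \<in> sets lebesgue" using v(1) by measurable
    then show ?thesis by (auto simp: A_def)
  qed
  have "\<exists>n. A n \<notin> null_sets lebesgue"
  proof (rule ccontr)
    assume "\<nexists>n. A n \<notin> null_sets lebesgue"
    then have "(\<Union>n. A n) \<in> null_sets lebesgue" by (intro null_sets_UN) auto
    moreover have "{x \<in> space lebesgue. \<not> 0 \<le> v x} \<subseteq> (\<Union>n. A n)"
    proof
      fix x assume "x \<in> {x \<in> space lebesgue. \<not> 0 \<le> v x}"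
      then have "0 < - v x" by simp
      then obtain n1 where n1: "inverse (real (Suc n1)) < - v x" using reals_Archimedean by blast
      obtain n2 where n2: "norm x < real n2" using reals_Archimedean2 by blast
      let ?n = "max n1 n2"
      have "1 / real (Suc ?n) \<le> inverse (real (Suc n1))" by (simp add: field_simps)
      then have "x \<in> A ?n" using n1 n2 by (auto simp: A_def)
      then show "x \<in> (\<Union>n. A n)" by blast
    qed
    ultimately have "AE x in lebesgue. 0 \<le> v x" by (rule AE_I')
    then show False using neg by contradiction
  qed
  then obtain n where n: "A n \<notin> null_sets lebesgue" by blast
  define \<delta> where "\<delta> = 1 / real (Suc n)"
  have \<delta>: "\<delta> > 0" by (simp add: \<delta>_def)
  have Al: "A n \<in> lmeasurable"
    by (rule bounded_set_imp_lmeasurable[OF _ Am]) (auto simp: A_def intro: bounded_subset[OF bounded_ball])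
  have mA: "measure lebesgue (A n) > 0"
  proof -
    have "measure lebesgue (A n) \<noteq> 0"
    proof
      assume "measure lebesgue (A n) = 0"
      then have "emeasure lebesgue (A n) = 0" using Al by (simp add: emeasure_eq_measure2)
      then show False using n Am by (auto simp: null_sets_def)
    qed
    then show ?thesis by (simp add: zero_less_measure_iff)
  qed
  obtain K where K: "closed K" "K \<subseteq> A n" "A n - K \<in> lmeasurable" "emeasure lebesgue (A n - K) < ennreal (measure lebesgue (A n) / 2)"
    using sets_lebesgue_inner_closed[OF Am, of "measure lebesgue (A n) / 2"] mA by auto
  have Kb: "bounded K" using K(2) by (auto simp: A_def intro: bounded_subset[OF bounded_ball])
  have Kc: "compact K" using K(1) Kb by (simp add: compact_eq_bounded_closed)
  have Kl: "K \<in> lmeasurable" using lmeasurable_compact[OF Kc] .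
  have "measure lebesgue (A n - K) < measure lebesgue (A n) / 2"
    using K(3,4) mA by (simp add: emeasure_eq_measure2 ennreal_less_iff)
  moreover have "measure lebesgue (A n) \<le> measure lebesgue K + measure lebesgue (A n - K)"
  proof -
    have "A n = K \<union> (A n - K)" using K(2) by blast
    then show ?thesis using measure_Un_le[of K lebesgue "A n - K"] Kl K(3) by (metis fmeasurableD)
  qed
  ultimately have mK: "measure lebesgue K > 0" using mA by linarith
  define C' where "C' = max 0 C + 1"
  have C': "C' > 0" "AE x in lebesgue. \<bar>v x\<bar> \<le> C'" using v(2) by (auto simp: C'_def elim!: eventually_mono)
  \<comment> \<open>The integral over $K$ is at most $-\delta|K|/2$, that over $W\setminus K$ at most
    $C'|W\setminus K|$.\<close>
  define \<eta> where "\<eta> = \<delta> * measure lebesgue K / (2 * C')"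
  have \<eta>: "\<eta> > 0" using \<delta> mK C' by (simp add: \<eta>_def)
  obtain W where W: "open W" "K \<subseteq> W" "W - K \<in> lmeasurable" "emeasure lebesgue (W - K) < ennreal \<eta>"
    using sets_lebesgue_outer_open[OF fmeasurableD[OF Kl] \<eta>] by blast
  have mW: "measure lebesgue (W - K) < \<eta>" using W(3,4) \<eta> by (simp add: emeasure_eq_measure2 ennreal_less_iff)
  obtain q \<gamma> C0 where q: "test_pair q \<gamma> C0" "\<And>x. x \<in> K \<Longrightarrow> 0 < q x" "\<And>x. x \<notin> W \<Longrightarrow> q x = 0"
    using test_pair_exists[OF Kc W(1,2)] by blast
  have qc: "continuous_on UNIV q" by (rule test_pair_continuous[OF q(1)])
  have "K \<noteq> {}" using mK by auto
  then obtain xm where xm: "xm \<in> K" "\<And>x. x \<in> K \<Longrightarrow> q xm \<le> q x"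
    using continuous_attains_inf[OF Kc _ continuous_on_subset[OF qc subset_UNIV]] by blast
  define \<kappa> where "\<kappa> = q xm"
  have \<kappa>: "\<kappa> > 0" using q(2)[OF xm(1)] by (simp add: \<kappa>_def)
  \<comment> \<open>With \<open>\<kappa>\<close> the minimum of $q$ on $K$ the quotient is at least $1/2$ on $K$.\<close>
  define \<psi> where "\<psi> x = q x / (\<kappa> + q x)" for x
  have tp: "test_pair \<psi> (\<lambda>x. (\<kappa> / (\<kappa> + q x)\<^sup>2) *\<^sub>R \<gamma> x) C0"
    unfolding \<psi>_def[abs_def] by (rule test_pair_saturate[OF q(1) \<kappa>])
  have q0: "0 \<le> q x" for x using q(1) by (simp add: test_pair_def)
  have \<psi>01: "0 \<le> \<psi> x" "\<psi> x \<le> 1" for x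
  proof -
    have "\<kappa> + q x > 0" using q0[of x] \<kappa> by linarith
    then show "0 \<le> \<psi> x" "\<psi> x \<le> 1" using q0[of x] \<kappa> by (auto simp: \<psi>_def)
  qed
  have \<psi>K: "\<psi> x \<ge> 1 / 2" if "x \<in> K" for x
  proof -
    have "\<kappa> \<le> q x" using xm(2)[OF that] by (simp add: \<kappa>_def)
    then show ?thesis using \<kappa> by (simp add: \<psi>_def field_simps)
  qed
  have bd: "AE x in lebesgue. v x * \<psi> x \<le> (- \<delta> / 2) * indicator K x + C' * indicator (W - K) x"
    using C'(2)
  proof eventually_elim
    fix x assume vC: "\<bar>v x\<bar> \<le> C'"
    consider "x \<in> K" | "x \<in> W - K" | "x \<notin> W" using W(2) by blast
    then show "v x * \<psi> x \<le> (- \<delta> / 2) * indicator K x + C' * indicator (W - K) x"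
    proof cases
      case 1
      then have "v x < - \<delta>" using K(2) by (auto simp: A_def \<delta>_def)
      then have "v x * \<psi> x \<le> (- \<delta>) * \<psi> x" using \<psi>01[of x] by (intro mult_right_mono) auto
      also have "\<dots> \<le> - \<delta> / 2" using \<psi>K[OF 1] \<delta> by (simp add: field_simps)
      finally show ?thesis using 1 by simp
    next
      case 2
      have "v x * \<psi> x \<le> C' * 1" using vC \<psi>01[of x] C'(1) by (intro mult_mono) auto
      then show ?thesis using 2 by simp
    next
      case 3
      then have "\<psi> x = 0" using q(3) by (simp add: \<psi>_def)
      moreover have "x \<notin> K" using 3 W(2) by blast
      ultimately show ?thesis using 3 by simp
    qed
  qed
  have \<psi>m: "\<psi> \<in> borel_measurable lebesgue"
    using borel_measurable_continuous_onI[OF test_pair_continuous[OF tp]] by (simp add: measurable_completion)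
  have int: "integrable lebesgue (\<lambda>x. v x * \<psi> x)"
  proof -
    have ae: "AE x in lebesgue. \<bar>v x * \<psi> x\<bar> \<le> C' * indicator C0 x"
      using C'(2)
    proof eventually_elim
      fix x assume "\<bar>v x\<bar> \<le> C'"
      show "\<bar>v x * \<psi> x\<bar> \<le> C' * indicator C0 x"
      proof (cases "x \<in> C0")
        case True
        have "\<bar>v x\<bar> * \<bar>\<psi> x\<bar> \<le> C' * 1" using \<open>\<bar>v x\<bar> \<le> C'\<close> \<psi>01[of x] C'(1) by (intro mult_mono) auto
        then show ?thesis using True by (simp add: abs_mult)
      next
        case False
        then show ?thesis using tp by (simp add: test_pair_def)
      qed
    qed
    have m: "(\<lambda>x. v x * \<psi> x) \<in> borel_measurable lebesgue" using v(1) \<psi>m by measurable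
    have c: "compact C0" using q(1) by (simp add: test_pair_def)
    show ?thesis
      by (rule lebesgue_on_bounded_integrable(1)[of UNIV, unfolded lebesgue_on_UNIV_eq, OF _ m c subset_UNIV ae]) simp
  qed
  have ind: "integrable lebesgue (indicator K :: 'a \<Rightarrow> real)" "integrable lebesgue (indicator (W - K) :: 'a \<Rightarrow> real)"
    using Kl W(3) by (auto simp: fmeasurable_def)
  have "0 \<le> (LINT x|lebesgue. v x * \<psi> x)" by (rule tests[OF tp])
  also have "\<dots> \<le> (LINT x|lebesgue. (- \<delta> / 2) * indicator K x + C' * indicator (W - K) x)"
    using ind by (intro integral_mono_AE[OF int _ bd]) auto
  also have "\<dots> = (- \<delta> / 2) * measure lebesgue K + C' * measure lebesgue (W - K)"
    using ind by simp
  also have "\<dots> < (- \<delta> / 2) * measure lebesgue K + C' * \<eta>" using mW C'(1) by simp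
  also have "\<dots> = 0" using C'(1) by (simp add: \<eta>_def)
  finally show False by simp
qed

lemma test_pair_gradient_zero:
  fixes \<psi> :: "'a::euclidean_space \<Rightarrow> real"
  assumes "test_pair \<psi> \<gamma> K" "x \<notin> K"
  shows "\<gamma> x = 0"
proof -
  have d: "(\<psi> has_derivative (\<lambda>h. \<gamma> x \<bullet> h)) (at x)" and K: "compact K" and z: "\<And>y. y \<notin> K \<Longrightarrow> \<psi> y = 0"
    using assms(1) by (auto simp: test_pair_def)
  have "open (- K)" using K by (simp add: compact_imp_closed open_Compl)
  then have "(\<psi> has_derivative (\<lambda>_. 0)) (at x)"
    using has_derivative_transform_within_open[OF has_derivative_const[of 0 "at x"], of "- K" \<psi>] assms(2) z by auto
  from fun_cong[OF has_derivative_unique[OF d this], of "\<gamma> x"] show ?thesis by simp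
qed

text \<open>The factor in time decreases from $1$ at $t=0$ to $0$ at $t=\epsilon$.\<close>

lemma product_test_function:
  fixes \<psi> :: "real^'n \<Rightarrow> real"
  assumes I: "time_interval I" and \<epsilon>: "0 < \<epsilon>" "\<epsilon> \<in> I" and tp: "test_pair \<psi> \<gamma> K"
  defines "\<eta> \<equiv> \<lambda>t. (max 0 (1 - t / \<epsilon>))\<^sup>2"
  defines "\<phi> \<equiv> \<lambda>t x. \<eta> t * \<psi> x"
  shows "\<phi> \<in> C1c I"
    "\<And>t x. t \<in> I \<Longrightarrow> d_t I \<phi> t x \<le> 0"
    "\<And>t x. grad (\<phi> t) x = \<eta> t *\<^sub>R \<gamma> x"
proof -
  let ?S = "I \<times> (UNIV :: (real^'n) set)"
  define \<eta>' where "\<eta>' t = 2 * max 0 (1 - t / \<epsilon>) * (- 1 / \<epsilon>)" for t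
  have \<psi>0: "0 \<le> \<psi> x" and \<psi>d: "(\<psi> has_derivative (\<lambda>h. \<gamma> x \<bullet> h)) (at x)" and \<gamma>c: "continuous_on UNIV \<gamma>"
    and K: "compact K" and \<psi>K: "x \<notin> K \<Longrightarrow> \<psi> x = 0" for x
    using tp by (auto simp: test_pair_def)
  have \<psi>c: "continuous_on UNIV \<psi>" by (rule test_pair_continuous[OF tp])
  have \<eta>d: "(\<eta> has_real_derivative \<eta>' t) (at t)" for t
    unfolding \<eta>_def \<eta>'_def
    by (rule DERIV_chain2[OF max0_square_derivative]) (use \<epsilon> in \<open>auto intro!: derivative_eq_intros\<close>)
  have \<eta>c: "continuous_on UNIV \<eta>" "continuous_on UNIV \<eta>'"
    unfolding \<eta>_def \<eta>'_def using \<epsilon> by (auto intro!: continuous_intros)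
  let ?D = "\<lambda>p h. \<eta> (fst p) * (\<gamma> (snd p) \<bullet> snd h) + (\<eta>' (fst p) * fst h) * \<psi> (snd p)"
  have der: "((\<lambda>(t, x). \<phi> t x) has_derivative ?D p) (at p within ?S)" for p
  proof -
    have 1: "((\<lambda>p. \<eta> (fst p)) has_derivative (\<lambda>h. \<eta>' (fst p) * fst h)) (at p within ?S)"
      by (rule has_derivative_compose[OF has_derivative_fst[OF has_derivative_ident] \<eta>d[unfolded has_field_derivative_def]])
    have 2: "((\<lambda>p. \<psi> (snd p)) has_derivative (\<lambda>h. \<gamma> (snd p) \<bullet> snd h)) (at p within ?S)"
      by (rule has_derivative_compose[OF has_derivative_snd[OF has_derivative_ident] \<psi>d])
    from has_derivative_mult[OF 1 2] show ?thesis by (simp add: \<phi>_def split_def)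
  qed
  have cont: "continuous_on ?S (\<lambda>p. ?D p v)" for v
  proof -
    have "continuous_on ?S (\<lambda>p. \<eta> (fst p))" "continuous_on ?S (\<lambda>p. \<eta>' (fst p))"
      "continuous_on ?S (\<lambda>p. \<psi> (snd p))" "continuous_on ?S (\<lambda>p. \<gamma> (snd p))"
      by (rule continuous_on_compose2[OF \<eta>c(1)] continuous_on_compose2[OF \<eta>c(2)]
          continuous_on_compose2[OF \<psi>c] continuous_on_compose2[OF \<gamma>c]; auto intro!: continuous_intros)+
    then show ?thesis by (intro continuous_intros)
  qed
  define A where "A = {p \<in> ?S. (\<lambda>(t, x). \<phi> t x) p \<noteq> 0}"
  have "A \<subseteq> {0..\<epsilon>} \<times> K"
  proof
    fix p assume p: "p \<in> A"
    obtain t x where tx: "p = (t, x)" by force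
    have t: "t \<in> I" and ne: "\<eta> t \<noteq> 0" "\<psi> x \<noteq> 0" using p by (auto simp: A_def tx \<phi>_def)
    have "t \<le> \<epsilon>"
    proof (rule ccontr)
      assume "\<not> t \<le> \<epsilon>"
      then have "1 - t / \<epsilon> \<le> 0" using \<epsilon> by (simp add: field_simps)
      then show False using ne(1) by (simp add: \<eta>_def)
    qed
    then show "p \<in> {0..\<epsilon>} \<times> K" using time_interval_nonneg[OF I t] ne(2) \<psi>K by (auto simp: tx)
  qed
  moreover have cK: "compact ({0..\<epsilon>} \<times> K)" using K by (intro compact_Times) auto
  ultimately have cl: "closure A \<subseteq> {0..\<epsilon>} \<times> K" by (simp add: closure_minimal compact_imp_closed)
  moreover have "{0..\<epsilon>} \<times> K \<subseteq> ?S" using time_interval_down[OF I \<epsilon>(2)] by auto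
  ultimately have "?S \<inter> closure A = closure A" by blast
  moreover have "compact (closure A)" using cl cK by (meson bounded_subset closed_closure compact_eq_bounded_closed)
  ultimately have "compactly_supported_on ?S (\<lambda>(t, x). \<phi> t x)"
    unfolding compactly_supported_on_def A_def by simp
  then show C: "\<phi> \<in> C1c I"
    unfolding C1c_def Ck_on_1 using der cont by (intro CollectI conjI exI[of _ ?D] ballI allI) auto
  show "d_t I \<phi> t x \<le> 0" if "t \<in> I" for t x
  proof -
    have "d_t I \<phi> t x = \<eta>' t * \<psi> x"
      using C1c_derivatives(2)[OF I that, of \<phi> "?D (t, x)" x] der[of "(t, x)"] by simp
    moreover have "\<eta>' t \<le> 0" using \<epsilon> by (simp add: \<eta>'_def)
    ultimately show ?thesis using \<psi>0[of x] by (simp add: mult_nonpos_nonneg)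
  qed
  show "grad (\<phi> t) x = \<eta> t *\<^sub>R \<gamma> x" for t x
  proof -
    have "(\<phi> t has_derivative (\<lambda>h. \<eta> t * (\<gamma> x \<bullet> h))) (at x)"
      unfolding \<phi>_def by (intro has_derivative_mult_right \<psi>d)
    from grad_nth[OF this] show ?thesis by (simp add: vec_eq_iff inner_axis)
  qed
qed

lemma measure_lebesgue_Icc_Times:
  fixes K :: "'a::euclidean_space set"
  assumes "compact K" "0 \<le> \<epsilon>"
  shows "measure lebesgue ({0..\<epsilon>::real} \<times> K) = \<epsilon> * measure lebesgue K"
proof -
  have K: "K \<in> sets borel" using assms(1) by (simp add: compact_imp_closed borel_closed)
  have e: "emeasure lborel ({0..\<epsilon>} \<times> K) = emeasure lborel {0..\<epsilon>} * emeasure lborel K"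
    unfolding lborel_prod[symmetric] using K by (intro lborel.emeasure_pair_measure_Times) auto
  have "{0..\<epsilon>} \<times> K \<in> sets borel" using assms(1) by (intro borel_compact compact_Times) auto
  then have "measure lebesgue ({0..\<epsilon>} \<times> K) = measure lborel ({0..\<epsilon>} \<times> K)" by simp
  also have "\<dots> = \<epsilon> * measure lborel K" using e assms(2) by (simp add: measure_def enn2real_mult)
  finally show ?thesis using K by simp
qed

text \<open>Test the equation with $\eta(t)\psi(x)$, where $\psi\ge0$ and $\eta$ decreases from
  $1$ to $0$ on $[0,\epsilon]$. The term with $\partial_t\varphi\le0$ is bounded by
  means of $su\le m$, and this bound integrates to $-m\int\psi$; the flux and the source contribute
  $O(\epsilon)$. As $\epsilon\to0$ it follows that $\int(m-su_o)\psi\ge0$. The choices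
  $s=1$ and $s=-1$ give the upper and the lower bound.\<close>

lemma initial_datum_le:
  fixes f :: "real \<Rightarrow> real^'n \<Rightarrow> real \<Rightarrow> real^'n"
  assumes I: "time_interval I" and f: "f \<in> class_Fn I"
    and g: "continuous_on (closure I \<times> UNIV \<times> UNIV) (\<lambda>(t, x, w). g t x w)"
    and u0: "u0 \<in> borel_measurable lebesgue" "AE x in lebesgue. \<bar>u0 x\<bar> \<le> R"
    and u: "(\<lambda>p. u (fst p) (snd p)) \<in> borel_measurable (strip_measure I)"
      "AE p in strip_measure I. \<bar>u (fst p) (snd p)\<bar> \<le> R"
    and R: "R \<ge> 0"
    and sol: "distributional_solution I f g u0 u"
    and le: "AE p in strip_measure I. s * u (fst p) (snd p) \<le> m"
  shows "AE x in lebesgue. s * u0 x \<le> m"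
proof -
  have "AE x in lebesgue. 0 \<le> m - s * u0 x"
  proof (rule AE_nonneg_if_test_pairs)
    show "(\<lambda>x. m - s * u0 x) \<in> borel_measurable lebesgue" using u0(1) by measurable
    show "AE x in lebesgue. \<bar>m - s * u0 x\<bar> \<le> \<bar>m\<bar> + \<bar>s\<bar> * R"
      using u0(2)
    proof eventually_elim
      fix x assume "\<bar>u0 x\<bar> \<le> R"
      then have "\<bar>s * u0 x\<bar> \<le> \<bar>s\<bar> * R" by (simp add: abs_mult mult_left_mono)
      then show "\<bar>m - s * u0 x\<bar> \<le> \<bar>m\<bar> + \<bar>s\<bar> * R" by linarith
    qed
    fix \<psi> :: "real^'n \<Rightarrow> real" and \<gamma> K assume tp: "test_pair \<psi> \<gamma> K"
    have K: "compact K" and \<gamma>c: "continuous_on UNIV \<gamma>" and \<psi>K: "\<And>x. x \<notin> K \<Longrightarrow> \<psi> x = 0"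
      using tp by (auto simp: test_pair_def)
    have \<psi>c: "continuous_on UNIV \<psi>" by (rule test_pair_continuous[OF tp])
    obtain b where b: "b \<in> I" "0 < b" using time_interval_above[OF I time_interval_zero[OF I]] by blast
    have bI: "{0..b} \<subseteq> I" by (rule time_interval_down[OF I b(1)])
    let ?k = "\<lambda>q. (\<Sum>i\<in>UNIV. \<bar>f (fst (fst q)) (snd (fst q)) (snd q) $ i\<bar> * \<bar>\<gamma> (snd (fst q)) $ i\<bar>)
        + \<bar>g (fst (fst q)) (snd (fst q)) (snd q)\<bar> * \<bar>\<psi> (snd (fst q))\<bar>"
    let ?T = "({0..b} \<times> K) \<times> {-R..R}"
    have kc: "continuous_on ?T ?k"
    proof -
      have fc: "continuous_on ?T (\<lambda>q. f (fst (fst q)) (snd (fst q)) (snd q) $ i)" for i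
        using class_F_properties(1)[OF class_Fn_component[OF f], of i] bI
        by (auto simp: split_def intro: continuous_on_subset)
      have "continuous_on ?T (\<lambda>q. (\<lambda>(t, x, w). g t x w) (fst (fst q), snd (fst q), snd q))"
        by (rule continuous_on_compose2[OF g]) (use bI closure_subset in \<open>fastforce intro!: continuous_intros\<close>)+
      then have gc: "continuous_on ?T (\<lambda>q. g (fst (fst q)) (snd (fst q)) (snd q))" by simp
      have pc: "continuous_on ?T (\<lambda>q. \<psi> (snd (fst q)))" "continuous_on ?T (\<lambda>q. \<gamma> (snd (fst q)))"
        by (rule continuous_on_compose2[OF \<psi>c] continuous_on_compose2[OF \<gamma>c]; auto intro!: continuous_intros)+
      show ?thesis by (intro continuous_intros fc gc pc)
    qed
    have "compact ?T" using K by (intro compact_Times) auto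
    then obtain C0 where C0: "C0 \<ge> 0" "\<And>q. q \<in> ?T \<Longrightarrow> \<bar>?k q\<bar> \<le> C0"
      using continuous_compact_bound[OF kc] by blast
    let ?L = "LINT x|lebesgue. (m - s * u0 x) * \<psi> x"
    have main: "- ((\<bar>s\<bar> * C0 * measure lebesgue K) * \<epsilon>) \<le> ?L" if \<epsilon>: "0 < \<epsilon>" "\<epsilon> < b" for \<epsilon>
    proof -
      have \<epsilon>I: "\<epsilon> \<in> I" using bI \<epsilon> by auto
      define \<eta> where "\<eta> t = (max 0 (1 - t / \<epsilon>))\<^sup>2" for t
      define \<phi> where "\<phi> t x = \<eta> t * \<psi> x" for t x
      note ptf = product_test_function[OF I \<epsilon>(1) \<epsilon>I tp, folded \<eta>_def, folded \<phi>_def]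
      interpret P: strip_problem I f g u0 u \<phi> R
        by unfold_locales (use I f g u0 u R ptf(1) in auto)
      have \<eta>1: "0 \<le> \<eta> t" "\<eta> t \<le> 1" if "t \<in> I" for t
      proof -
        have "0 \<le> t / \<epsilon>" using time_interval_nonneg[OF I that] \<epsilon> by simp
        then show "0 \<le> \<eta> t" "\<eta> t \<le> 1" by (auto simp: \<eta>_def power_le_one)
      qed
      have \<phi>0: "\<phi> 0 = \<psi>" by (auto simp: \<phi>_def \<eta>_def)
      note i = P.B_integrable[OF P.continuous_coeff_id P.cutoffs(2) locbdd_const[of 1]]
        P.B_integrable[OF P.continuous_coeffs(1) P.cutoffs(3) locbdd_const[of 1]]
        P.B_integrable[OF P.continuous_coeff_G P.cutoffs(1) locbdd_const[of 1]]
        cutoff_integrable[OF P.S_borel P.cutoffs(2)]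
      let ?rest = "(\<Sum>i\<in>UNIV. P.B1 (P.F i) (P.\<psi>x i)) + P.B1 P.G P.\<psi>"
      let ?r = "\<lambda>p. (\<Sum>i\<in>UNIV. 1 * P.F i p (P.U p) * P.\<psi>x i p) + 1 * P.G p (P.U p) * P.\<psi> p"
      have ri: "integrable P.M ?r" using i by auto
      have rest_eq: "?rest = (LINT p|P.M. ?r p)" using i by (simp add: P.B_def)
      have "\<bar>LINT p|P.M. ?r p\<bar> \<le> C0 * measure lebesgue ({0..\<epsilon>} \<times> K)"
      proof (rule lebesgue_on_bounded_integrable(2)[OF P.S_borel borel_measurable_integrable[OF ri]])
        show "compact ({0..\<epsilon>} \<times> K)" using K by (intro compact_Times) auto
        show "{0..\<epsilon>} \<times> K \<subseteq> P.S" using bI \<epsilon> by auto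
        have sp: "AE p in P.M. p \<in> P.S" by (rule AE_I2) (simp add: P.space_M)
        show "AE p in P.M. \<bar>?r p\<bar> \<le> C0 * indicator ({0..\<epsilon>} \<times> K) p"
          using P.U_measurable_bounded(2) sp
        proof eventually_elim
          fix p assume pU: "\<bar>P.U p\<bar> \<le> R" and pS: "p \<in> P.S"
          obtain t x where p: "p = (t, x)" by force
          have t: "t \<in> I" using pS by (simp add: p)
          have r: "?r p = \<eta> t * ((\<Sum>i\<in>UNIV. f t x (P.U p) $ i * \<gamma> x $ i) + g t x (P.U p) * \<psi> x)"
            by (simp add: p P.F_def P.G_def P.\<psi>x_def P.\<psi>_def ptf(3) \<phi>_def distrib_left sum_distrib_left mult_ac)
          show "\<bar>?r p\<bar> \<le> C0 * indicator ({0..\<epsilon>} \<times> K) p"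
          proof (cases "t \<le> \<epsilon> \<and> x \<in> K")
            case True
            then have pin: "p \<in> {0..\<epsilon>} \<times> K" using time_interval_nonneg[OF I t] by (simp add: p)
            then have "(p, P.U p) \<in> ?T" using \<epsilon> pU by (auto simp: abs_le_iff)
            from C0(2)[OF this] have kb: "?k (p, P.U p) \<le> C0" by simp
            have "\<bar>(\<Sum>i\<in>UNIV. f t x (P.U p) $ i * \<gamma> x $ i) + g t x (P.U p) * \<psi> x\<bar> \<le> ?k (p, P.U p)"
              unfolding p fst_conv snd_conv abs_mult[symmetric]
              by (intro order_trans[OF abs_triangle_ineq] add_mono sum_abs order_refl)
            then have "\<bar>(\<Sum>i\<in>UNIV. f t x (P.U p) $ i * \<gamma> x $ i) + g t x (P.U p) * \<psi> x\<bar> \<le> C0" using kb by linarith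
            then have "\<bar>?r p\<bar> \<le> 1 * C0" unfolding r abs_mult using \<eta>1[OF t] by (intro mult_mono) auto
            then show ?thesis using pin by simp
          next
            case False
            have "\<eta> t = 0 \<or> x \<notin> K"
            proof (cases "t \<le> \<epsilon>")
              case True then show ?thesis using False by simp
            next
              case False
              then have "1 - t / \<epsilon> \<le> 0" using \<epsilon> by (simp add: field_simps)
              then show ?thesis by (simp add: \<eta>_def)
            qed
            then have "?r p = 0" unfolding r using \<psi>K test_pair_gradient_zero[OF tp] by auto
            then show ?thesis using False by (auto simp: p)
          qed
        qed
      qed
      also have "measure lebesgue ({0..\<epsilon>} \<times> K) = \<epsilon> * measure lebesgue K"
        using measure_lebesgue_Icc_Times[OF K] \<epsilon> by simp
      finally have rest: "\<bar>?rest\<bar> \<le> C0 * (\<epsilon> * measure lebesgue K)" unfolding rest_eq .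
      have tt: "(LINT p|P.M. P.\<psi>t p) = - (LINT x|lebesgue. \<psi> x)"
        using P.time_identity[of 1] by (simp add: P.B_def \<phi>0)
      have "m * (LINT p|P.M. P.\<psi>t p) = (LINT p|P.M. m * P.\<psi>t p)" by simp
      also have "\<dots> \<le> (LINT p|P.M. s * (1 * P.U p * P.\<psi>t p))"
      proof (rule integral_mono_AE)
        have sp: "AE p in P.M. p \<in> P.S" by (rule AE_I2) (simp add: P.space_M)
        have le': "AE p in P.M. s * P.U p \<le> m" using le unfolding strip_measure_def P.U_def .
        show "AE p in P.M. m * P.\<psi>t p \<le> s * (1 * P.U p * P.\<psi>t p)"
          using le' sp
        proof eventually_elim
          fix p assume "s * P.U p \<le> m" "p \<in> P.S"
          moreover have "P.\<psi>t p \<le> 0" using ptf(2) \<open>p \<in> P.S\<close> by (auto simp: P.\<psi>t_def)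
          ultimately have "m * P.\<psi>t p \<le> (s * P.U p) * P.\<psi>t p" by (intro mult_right_mono_neg)
          then show "m * P.\<psi>t p \<le> s * (1 * P.U p * P.\<psi>t p)" by (simp add: mult.assoc)
        qed
      qed (use i in auto)
      also have "\<dots> = s * P.B1 (\<lambda>_ w. w) P.\<psi>t" by (simp add: P.B_def)
      finally have time: "- m * (LINT x|lebesgue. \<psi> x) \<le> s * P.B1 (\<lambda>_ w. w) P.\<psi>t" unfolding tt by simp
      have dist: "P.B1 (\<lambda>_ w. w) P.\<psi>t + ?rest + P.Z (\<lambda>w. w) = 0"
        using P.distributional_identity[OF sol] by simp
      have "?L = m * (LINT x|lebesgue. \<psi> x) - s * P.Z (\<lambda>w. w)"
      proof -
        have "?L = (LINT x|lebesgue. m * \<psi> x - s * (u0 x * \<psi> x))"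
          by (intro Bochner_Integration.integral_cong) (auto simp: algebra_simps)
        then show ?thesis using P.\<phi>0_integrable P.Z_id_integrable unfolding \<phi>0 by (simp add: P.Z_def \<phi>0)
      qed
      also have "P.Z (\<lambda>w. w) = - (P.B1 (\<lambda>_ w. w) P.\<psi>t + ?rest)" using dist by linarith
      finally have L: "?L = m * (LINT x|lebesgue. \<psi> x) + s * P.B1 (\<lambda>_ w. w) P.\<psi>t + s * ?rest"
        by (simp add: algebra_simps)
      have "\<bar>s * ?rest\<bar> \<le> \<bar>s\<bar> * (C0 * (\<epsilon> * measure lebesgue K))"
        unfolding abs_mult using rest by (intro mult_left_mono) auto
      then have "- ((\<bar>s\<bar> * C0 * measure lebesgue K) * \<epsilon>) \<le> s * ?rest" by (simp add: abs_le_iff mult_ac)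
      then show ?thesis using L time by linarith
    qed
    show "0 \<le> ?L"
    proof (rule tendsto_upperbound)
      show "((\<lambda>\<epsilon>. - ((\<bar>s\<bar> * C0 * measure lebesgue K) * \<epsilon>)) \<longlongrightarrow> 0) (at_right 0)"
        by (auto intro!: tendsto_eq_intros)
      show "\<forall>\<^sub>F \<epsilon> in at_right 0. - ((\<bar>s\<bar> * C0 * measure lebesgue K) * \<epsilon>) \<le> ?L"
        using main b(2) by (auto simp: eventually_at_right_field intro!: exI[of _ b])
    qed simp
  qed
  then show ?thesis by (rule eventually_mono) simp
qed

section \<open>The representation\<close>

theorem theorem2p21:
  fixes I :: "real set"
    and f :: "real \<Rightarrow> real^'n \<Rightarrow> real \<Rightarrow> real^'n"
    and g :: "real \<Rightarrow> real^'n \<Rightarrow> real \<Rightarrow> real"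
    and u\<^sub>o :: "real^'n \<Rightarrow> real"
    and u :: "real \<Rightarrow> real^'n \<Rightarrow> real"
    and E :: "real \<Rightarrow> real"
  assumes "I = {0..} \<or> (\<exists>T>0. I = {0..<T})"
    and "f \<in> class_Fn I"
    and "continuous_on (closure I \<times> UNIV \<times> UNIV) (\<lambda>(t, x, w). g t x w)"
    and "u\<^sub>o \<in> Linfty lebesgue"
    and "(\<lambda>(t, x). u t x) \<in> Linfty (strip_measure I)"
    and "distributional_solution I f g u\<^sub>o u"
    and "E \<in> ACR"
  shows "\<forall>\<phi>\<in>test_functions I. \<forall>a b.
           admissible_interval I u (\<lambda>k. kruzhkov_production I f g u\<^sub>o u k \<phi>) a b \<longrightarrow>
           ks_integrable (\<lambda>k. kruzhkov_production I f g u\<^sub>o u k \<phi>) (acr_deriv E) a b \<and>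
           entropy_production I f g u\<^sub>o u E \<phi> =
             1 / 2 * ks_integral (\<lambda>k. kruzhkov_production I f g u\<^sub>o u k \<phi>) (acr_deriv E) a b"
proof (intro ballI allI impI)
  fix \<phi> a b
  assume \<phi>: "\<phi> \<in> test_functions I"
    and adm: "admissible_interval I u (\<lambda>k. kruzhkov_production I f g u\<^sub>o u k \<phi>) a b"
  define h where "h k = kruzhkov_production I f g u\<^sub>o u k \<phi>" for k
  have I: "time_interval I" using assms(1) by (simp add: time_interval_def)
  obtain C1 where u0: "u\<^sub>o \<in> borel_measurable lebesgue" "AE x in lebesgue. \<bar>u\<^sub>o x\<bar> \<le> C1"
    using assms(4) by (auto simp: Linfty_def)
  obtain C2 where u: "(\<lambda>p. u (fst p) (snd p)) \<in> borel_measurable (strip_measure I)"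
      "AE p in strip_measure I. \<bar>u (fst p) (snd p)\<bar> \<le> C2"
    using assms(5) by (auto simp: Linfty_def split_def)
  define R where "R = max 0 (max C1 C2)"
  have R: "R \<ge> 0" by (simp add: R_def)
  have u0R: "AE x in lebesgue. \<bar>u\<^sub>o x\<bar> \<le> R" using u0(2) by eventually_elim (simp add: R_def)
  have uR: "AE p in strip_measure I. \<bar>u (fst p) (snd p)\<bar> \<le> R" using u(2) by eventually_elim (simp add: R_def)
  interpret P: strip_problem I f g u\<^sub>o u \<phi> R
    by unfold_locales (use I assms(2,3) u0(1) u0R u(1) uR R test_functions_C1c[OF \<phi>] in auto)
  note range = initial_datum_le[OF I assms(2,3) u0(1) u0R u(1) uR R assms(6)]
  have ab: "a < b"
    and a: "ereal a < ess_inf_strip I u \<or> ereal a = ess_inf_strip I u \<and> h a = 0"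
    and b: "ess_sup_strip I u < ereal b \<or> ess_sup_strip I u = ereal b \<and> h b = 0"
    using adm by (auto simp: admissible_interval_def h_def)
  have sup: "AE p in strip_measure I. ereal (u (fst p) (snd p)) \<le> ess_sup_strip I u"
    using esssup_AE[of "\<lambda>(t, x). ereal (u t x)" "strip_measure I"] by (simp add: ess_sup_strip_def split_def)
  have inf: "AE p in strip_measure I. ess_inf_strip I u \<le> ereal (u (fst p) (snd p))"
    using esssup_AE[of "\<lambda>(t, x). - ereal (u t x)" "strip_measure I"]
    by (simp add: ess_inf_strip_def split_def ereal_uminus_le_reorder)
  have below: "h c = 0" if "ereal c < ess_inf_strip I u" for c
  proof -
    have gt: "AE p in strip_measure I. c < u (fst p) (snd p)"
      using inf by eventually_elim (use that less_le_trans in \<open>fastforce\<close>)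
    have "AE p in strip_measure I. (-1) * u (fst p) (snd p) \<le> - c" using gt by eventually_elim simp
    from range[OF this] have "AE x in lebesgue. \<bar>u\<^sub>o x - c\<bar> = 1 * (u\<^sub>o x - c)" by eventually_elim simp
    moreover have "AE p in P.M. sgn (P.U p - c) = 1"
      using gt unfolding strip_measure_def P.U_def by eventually_elim simp
    ultimately show ?thesis unfolding h_def by (intro P.kruzhkov_zero[OF assms(6)])
  qed
  have above: "h c = 0" if "ess_sup_strip I u < ereal c" for c
  proof -
    have lt: "AE p in strip_measure I. u (fst p) (snd p) < c"
      using sup by eventually_elim (use that le_less_trans in \<open>fastforce\<close>)
    have "AE p in strip_measure I. 1 * u (fst p) (snd p) \<le> c" using lt by eventually_elim simp
    from range[OF this] have "AE x in lebesgue. \<bar>u\<^sub>o x - c\<bar> = (-1) * (u\<^sub>o x - c)" by eventually_elim simp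
    moreover have "AE p in P.M. sgn (P.U p - c) = -1"
      using lt unfolding strip_measure_def P.U_def by eventually_elim simp
    ultimately show ?thesis unfolding h_def by (intro P.kruzhkov_zero[OF assms(6)])
  qed
  have h0: "h c = 0" if ca: "c \<le> a \<or> b \<le> c" for c
  proof -
    \<comment> \<open>If an endpoint equals the essential bound, \<open>h\<close> vanishes there by admissibility; further
      out the inequality is strict.\<close>
    consider "c < a" | "c = a" | "c = b" | "b < c" using ca by linarith
    then show ?thesis
    proof cases
      case 1
      then have "ereal c < ereal a" by simp
      then show ?thesis using a below less_trans by metis
    next
      case 2 then show ?thesis using a below by blast
    next
      case 3 then show ?thesis using b above by blast
    next
      case 4
      then have "ereal b < ereal c" by simp
      then show ?thesis using b above less_trans by metis
    qed
  qed
  have bal: "balanced (acr_deriv E)"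
    by (rule normalised_derivative_balanced[OF acr_deriv_normalised[OF assms(7)]])
  have "has_ks_integral h (acr_deriv E) a b (2 * P.N (acr_deriv E))"
    by (rule bounded_functional_ks_representation[OF P.N_functional bal ab P.N_const[OF assms(6)] _ h0])
      (simp_all add: P.N_sgn h_def)
  from ks_integral_eq[OF this less_imp_le[OF ab]] P.entropy_eq[OF assms(7)]
  show "ks_integrable (\<lambda>k. kruzhkov_production I f g u\<^sub>o u k \<phi>) (acr_deriv E) a b \<and>
      entropy_production I f g u\<^sub>o u E \<phi> =
        1 / 2 * ks_integral (\<lambda>k. kruzhkov_production I f g u\<^sub>o u k \<phi>) (acr_deriv E) a b"
    by (simp add: h_def[abs_def])
qed

end
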